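(* For each $n\in\mathbb{N}$ let $\vec d_n=(d_1,\dots,d_n)\in\mathbb{N}^n$ be a degree sequence (the $d_i$ may depend on $n$) with $\sum_{i=1}^n d_i$ even, and put $m_0=\min_{1\le i\le n}d_i$, $m_\infty=\max_{1\le i\le n}d_i$, $m_k=\sum_{i=1}^n d_i^k$ for $k\in\mathbb{N}$. Assume that, as $n\to\infty$, (D1) $m_0\asymp m_\infty$ and (D2) $1\ll m_\infty\ll\sqrt n$. Let $\lambda_1$ be the largest eigenvalue of the adjacency matrix of the configuration model with degree sequence $\vec d_n$ conditioned on being simple, and let $\mathbb{P}$ and $\mathbb{E}$ denote probability and expectation under this conditional law. Then $$\mathbb{E}[\lambda_1]=\frac{m_2}{m_1}+\frac{m_1m_3}{m_2^2}-1+o(1),\qquad n\to\infty,$$ and $$\frac{\lambda_1}{\mathbb{E}[\lambda_1]}\to 1\quad\text{in }\mathbb{P}\text{-probability as } n\to\infty.$$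
   Context: Configuration model: given $\vec d_n$ with even sum, attach $d_i$ half-edges to each vertex $i\in\{1,\dots,n\}$ and choose a uniformly random perfect matching of the set of all $m_1=\sum_i d_i$ half-edges; each matched pair forms an edge. This gives a random multigraph in which vertex $i$ has degree $d_i$. Conditioned on being simple (no self-loops, no multiple edges) it is a uniformly random simple graph with degree sequence $\vec d_n$. The adjacency matrix has entries $a_{ij}$ equal to the number of edges between $i$ and $j$ (so $0$ or $1$ for a simple graph). Notation: $m_0\asymp m_\infty$ means that there is a constant $\theta<\infty$, independent of $n$, with $m_\infty/m_0\le\theta$ for all $n$; $1\ll m_\infty\ll\sqrt n$ means $m_\infty\to\infty$ and $m_\infty/\sqrt n\to0$ as $n\to\infty$. Statements are for $n$ large enough (simple graphs with the given degrees then exist). *)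

theory Defs
  imports
    "HOL-Probability.Probability_Mass_Function"
    "Jordan_Normal_Form.Spectral_Radius"
begin

text \<open>
  A degree sequence of length \<open>n\<close> is a function \<open>\<delta> :: nat \<Rightarrow> nat\<close> of which only the values
  at the vertices \<open>0, \<dots>, n - 1\<close> matter.
\<close>

definition min_degree :: "nat \<Rightarrow> (nat \<Rightarrow> nat) \<Rightarrow> nat" where
  "min_degree n \<delta> = Min (\<delta> ` {..<n})"

definition max_degree :: "nat \<Rightarrow> (nat \<Rightarrow> nat) \<Rightarrow> nat" where
  "max_degree n \<delta> = Max (\<delta> ` {..<n})"

definition degree_power_sum :: "nat \<Rightarrow> (nat \<Rightarrow> nat) \<Rightarrow> nat \<Rightarrow> nat" where
  "degree_power_sum n \<delta> k = (\<Sum>i<n. \<delta> i ^ k)"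

text \<open>The pair \<open>(i, k)\<close> is the \<open>k\<close>-th half-edge attached to vertex \<open>i\<close>.\<close>

definition half_edges :: "nat \<Rightarrow> (nat \<Rightarrow> nat) \<Rightarrow> (nat \<times> nat) set" where
  "half_edges n \<delta> = (SIGMA i:{..<n}. {..<\<delta> i})"

definition perfect_matchings :: "'a set \<Rightarrow> 'a set set set" where
  "perfect_matchings H = {M. partition_on H M \<and> (\<forall>e\<in>M. card e = 2)}"

definition configuration_model :: "nat \<Rightarrow> (nat \<Rightarrow> nat) \<Rightarrow> (nat \<times> nat) set set pmf" where
  "configuration_model n \<delta> = pmf_of_set (perfect_matchings (half_edges n \<delta>))"

text \<open>
  For \<open>i = j\<close> this counts every self-loop once; the convention does not matter for simple graphs.
\<close>

definition edge_count :: "(nat \<times> nat) set set \<Rightarrow> nat \<Rightarrow> nat \<Rightarrow> nat" where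
  "edge_count M i j = card {e \<in> M. \<exists>k l. e = {(i, k), (j, l)}}"

definition adjacency_matrix :: "nat \<Rightarrow> (nat \<times> nat) set set \<Rightarrow> real mat" where
  "adjacency_matrix n M = Matrix.mat n n (\<lambda>(i, j). real (edge_count M i j))"

definition simple_matching :: "nat \<Rightarrow> (nat \<times> nat) set set \<Rightarrow> bool" where
  "simple_matching n M \<longleftrightarrow>
     (\<forall>i<n. edge_count M i i = 0) \<and> (\<forall>i<n. \<forall>j<n. i \<noteq> j \<longrightarrow> edge_count M i j \<le> 1)"

text \<open>
  As with every use of \<^const>\<open>cond_pmf\<close>, this is the conditional law only if the event has
  positive probability, i.e. if a simple graph with degree sequence \<open>\<delta>\<close> exists.
\<close>

definition simple_configuration_model ::
    "nat \<Rightarrow> (nat \<Rightarrow> nat) \<Rightarrow> (nat \<times> nat) set set pmf" where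
  "simple_configuration_model n \<delta> = cond_pmf (configuration_model n \<delta>) {M. simple_matching n M}"

text \<open>
  The adjacency matrix is real symmetric, so all its eigenvalues are real and its largest
  eigenvalue is the maximum of its (finite, for \<open>n \<ge> 1\<close> nonempty) real spectrum.
\<close>

definition largest_eigenvalue :: "nat \<Rightarrow> (nat \<times> nat) set set \<Rightarrow> real" where
  "largest_eigenvalue n M = Max (spectrum (adjacency_matrix n M))"

definition expected_largest_eigenvalue :: "nat \<Rightarrow> (nat \<Rightarrow> nat) \<Rightarrow> real" where
  "expected_largest_eigenvalue n \<delta> =
     measure_pmf.expectation (simple_configuration_model n \<delta>) (largest_eigenvalue n)"

text \<open>
  Here \<open>X n\<close> is a random variable on its own probability space \<open>p n\<close>, so that convergence in
  probability to a constant only involves the laws.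
\<close>

definition tendsto_in_probability ::
    "(nat \<Rightarrow> 'a pmf) \<Rightarrow> (nat \<Rightarrow> 'a \<Rightarrow> real) \<Rightarrow> real \<Rightarrow> bool" where
  "tendsto_in_probability p X c \<longleftrightarrow>
     (\<forall>\<epsilon>>0. (\<lambda>n. measure_pmf.prob (p n) {\<omega>. \<bar>X n \<omega> - c\<bar> > \<epsilon>}) \<longlonglongrightarrow> 0)"

end

theory Submission
  imports Defs "HOL-Real_Asymp.Real_Asymp"
begin

text \<open>
  Let \<open>A\<close> be the adjacency matrix, \<open>d\<close> the vector of degrees, \<open>D\<close> the largest degree, \<open>m\<^sub>k\<close> the power
  sums of the degrees, and split \<open>A = d d\<^sup>T / m\<^sub>1 + B\<close>. The rank-one part has the eigenvalue
  \<open>\<mu> = m\<^sub>2 / m\<^sub>1\<close>. Let \<open>\<Lambda>\<close> be the largest eigenvalue and \<open>v\<close> an eigenvector. Pairing the equation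
  \<open>\<Lambda> v = d \<langle>d, v\<rangle> / m\<^sub>1 + B v\<close> with \<open>d\<close>, with \<open>B d\<close> and with \<open>B\<^sup>2 d\<close> gives
  \<open>\<Lambda> = \<mu> + \<langle>d, B d\<rangle> / (m\<^sub>1 \<Lambda>) + |B d|\<^sup>2 / (m\<^sub>1 \<Lambda>\<^sup>2) + r\<close>,
  and if the operator norm of \<open>B\<close> is at most \<open>c D\<close>, then \<open>r\<close> is at most of order \<open>c\<close> times the term
  before it. Replacing \<open>\<Lambda>\<close> by \<open>\<mu>\<close> on the right-hand side, one gets \<open>\<Lambda> = \<mu> + \<rho> + s\<close> up to a small
  error, where \<open>\<rho> = \<langle>d, B d\<rangle> / m\<^sub>2\<close> and \<open>s = |B d|\<^sup>2 / (m\<^sub>2 \<mu>)\<close>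
  (lemma \<open>rank_one_perturbation_eigenvalue\<close>). Here \<open>\<rho>\<close> has mean \<open>o(1)\<close>, and \<open>s\<close> has the bounded mean
  \<open>m\<^sub>1 m\<^sub>3 / m\<^sub>2\<^sup>2 - 1 + o(1)\<close>; this is where the second term of the asymptotic formula comes from.
  As the mean of \<open>s\<close> is bounded, it suffices to let \<open>c\<close> tend to \<open>0\<close>, that is, to show that the norm of
  \<open>B\<close> is \<open>o(D)\<close>. Because \<open>\<Lambda> \<le> D\<close>, an event of probability \<open>o(1 / D)\<close> may be neglected in the mean.

  All probabilistic information comes from one inequality, which holds in the conditional law itself:
  for a uniformly random simple matching \<open>M\<close>, the probability of \<open>F \<union> {e} \<subseteq> M\<close> is at most that of
  \<open>F \<subseteq> M\<close> divided by \<open>m\<^sub>1 - 2 |F| - 2 D (D + 1)\<close>. It is proved by switching \<open>e\<close> and another edge of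
  the matching (lemma \<open>containing_insert\<close>); the same switching shows that simple matchings exist.
  Working in the conditional law avoids dividing by the probability of being simple, which can be as
  small as \<open>exp (- C D\<^sup>2)\<close>.

  The moments of \<open>\<rho>\<close> and \<open>s\<close> are sums of probabilities of one or two edges. The switching inequality
  bounds them from above. Lower bounds come for free: the row sums of \<open>A\<close> are the degrees, so the
  probabilities of all edges, and of all paths of length two, have known sums, and an upper bound
  for each term whose sum is nearly sharp is nearly sharp on average (lemma \<open>weighted_sum_squeeze\<close>).

  For the norm of \<open>B\<close>, the inequality is applied to large sets \<open>F\<close>. It gives exponential tails for the
  number of matched pairs in a prescribed set, and a union bound over vertex sets yields
  \<open>|\<Sum>\<^sub>i\<^sub>\<in>\<^sub>S \<Sum>\<^sub>j\<^sub>\<in>\<^sub>T B\<^sub>i\<^sub>j| \<le> \<epsilon> D (|S| + |T|)\<close> for all \<open>S\<close> and \<open>T\<close> at once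
  (lemma \<open>large_discrepancy_probability\<close>). Cutting vectors into level sets turns this into a bound
  for the bilinear form of \<open>B\<close> (lemma \<open>discrepancy_bilinear_bound\<close>).
\<close>

section \<open>Perfect matchings and switchings\<close>

definition mate :: "'a set set \<Rightarrow> 'a \<Rightarrow> 'a" where
  "mate M g = (THE g'. {g, g'} \<in> M)"

definition switch :: "'a set set \<Rightarrow> 'a \<Rightarrow> 'a \<Rightarrow> 'a set set" where
  "switch M h g = (M - {{h, mate M h}, {g, mate M g}}) \<union> {{h, g}, {mate M h, mate M g}}"

lemma perfect_matchings_iff:
  "M \<in> perfect_matchings H \<longleftrightarrow>
     (\<forall>e\<in>M. e \<subseteq> H \<and> card e = 2) \<and> (\<forall>x\<in>H. \<exists>e\<in>M. x \<in> e) \<and>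
     (\<forall>e\<in>M. \<forall>e'\<in>M. e \<inter> e' \<noteq> {} \<longrightarrow> e = e')"
proof -
  have "{} \<notin> M" if "\<forall>e\<in>M. card e = 2" using that by force
  moreover have "\<Union>M = H \<longleftrightarrow> (\<forall>e\<in>M. e \<subseteq> H) \<and> (\<forall>x\<in>H. \<exists>e\<in>M. x \<in> e)" by blast
  moreover have "disjoint M \<longleftrightarrow> (\<forall>e\<in>M. \<forall>e'\<in>M. e \<inter> e' \<noteq> {} \<longrightarrow> e = e')"
    by (auto simp: disjoint_def)
  ultimately show ?thesis
    unfolding perfect_matchings_def partition_on_def mem_Collect_eq ball_conj_distrib by argo
qed

lemma perfect_matchingD:
  assumes "M \<in> perfect_matchings H"
  shows "e \<in> M \<Longrightarrow> e \<subseteq> H" "e \<in> M \<Longrightarrow> card e = 2" "x \<in> H \<Longrightarrow> \<exists>e\<in>M. x \<in> e"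
    "e \<in> M \<Longrightarrow> e' \<in> M \<Longrightarrow> x \<in> e \<Longrightarrow> x \<in> e' \<Longrightarrow> e = e'"
  using assms unfolding perfect_matchings_iff by (blast, blast, blast, blast)

lemma finite_perfect_matchings: "finite H \<Longrightarrow> finite (perfect_matchings H)"
  by (rule finite_subset[OF _ finitely_many_partition_on[of H]])
     (auto simp: perfect_matchings_def)

lemma finite_perfect_matching: "finite H \<Longrightarrow> M \<in> perfect_matchings H \<Longrightarrow> finite M"
  by (auto simp: perfect_matchings_def intro: finite_elements)

lemma mate_unique:
  assumes M: "M \<in> perfect_matchings H" and e: "{g, g'} \<in> M"
  shows "mate M g = g'"
  unfolding mate_def
proof (rule the_equality)
  show "{g, g'} \<in> M" by (rule e)
next
  fix y assume y: "{g, y} \<in> M"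
  have eq: "{g, y} = {g, g'}" by (rule perfect_matchingD(4)[OF M y e, of g]) auto
  have "card {g, g'} = 2" "card {g, y} = 2" using perfect_matchingD(2)[OF M] e y by auto
  then have "g \<noteq> g'" "g \<noteq> y" by auto
  with eq show "y = g'" by (auto simp: doubleton_eq_iff)
qed

lemma mate_props:
  assumes M: "M \<in> perfect_matchings H" and g: "g \<in> H"
  shows mate_edge: "{g, mate M g} \<in> M"
    and mate_in: "mate M g \<in> H"
    and mate_neq: "mate M g \<noteq> g"
    and mate_mate: "mate M (mate M g) = g"
proof -
  obtain e where e: "e \<in> M" "g \<in> e" using perfect_matchingD(3)[OF M g] by blast
  have "card e = 2" by (rule perfect_matchingD(2)[OF M e(1)])
  then obtain y where y: "e = {g, y}" "y \<noteq> g"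
    using e(2) unfolding card_2_iff by (auto simp: insert_commute doubleton_eq_iff)
  have my: "mate M g = y" using mate_unique[OF M] e y by simp
  show "{g, mate M g} \<in> M" using my e y by simp
  show "mate M g \<in> H" using my y perfect_matchingD(1)[OF M e(1)] by auto
  show "mate M g \<noteq> g" using my y by simp
  have "{y, g} \<in> M" using e y by (simp add: insert_commute)
  then show "mate M (mate M g) = g" using mate_unique[OF M] my by simp
qed

lemma edge_eq_mate:
  assumes M: "M \<in> perfect_matchings H" and e: "e \<in> M" and x: "x \<in> e"
  shows "e = {x, mate M x}"
proof -
  have "x \<in> H" using perfect_matchingD(1)[OF M e] x by blast
  from mate_edge[OF M this] show ?thesis
    using perfect_matchingD(4)[OF M e _ x] by blast
qed

lemma switch_perfect_matching:
  assumes M: "M \<in> perfect_matchings H" and h: "h \<in> H" and g: "g \<in> H"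
    and gh: "g \<noteq> h" "g \<noteq> mate M h"
  shows "switch M h g \<in> perfect_matchings H"
proof -
  let ?h = "mate M h" and ?g = "mate M g"
  have H: "?h \<in> H" "?g \<in> H" "?h \<noteq> h" "?g \<noteq> g"
    using mate_in[OF M] mate_neq[OF M] h g by auto
  have ne: "?g \<noteq> h" "?g \<noteq> ?h" using mate_mate[OF M] h g gh by metis+
  have rest: "x \<notin> e" if "e \<in> M - {{h, ?h}, {g, ?g}}" "x \<in> {h, ?h, g, ?g}" for e x
  proof
    assume x: "x \<in> e"
    have "e \<in> M" using that by blast
    then have "e = {x, mate M x}" using edge_eq_mate[OF M] x by blast
    then show False
      using that mate_mate[OF M h] mate_mate[OF M g] by (auto simp: insert_commute)
  qed
  show ?thesis
    unfolding perfect_matchings_iff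
  proof (intro conjI ballI impI)
    fix e assume e: "e \<in> switch M h g"
    then show "e \<subseteq> H" using perfect_matchingD(1)[OF M] H h g by (auto simp: switch_def)
    from e show "card e = 2" using perfect_matchingD(2)[OF M] gh ne by (auto simp: switch_def)
  next
    fix x assume x: "x \<in> H"
    then obtain e where e: "e \<in> M" "x \<in> e" using perfect_matchingD(3)[OF M] by blast
    then show "\<exists>e\<in>switch M h g. x \<in> e"
      unfolding switch_def by (cases "e = {h, ?h} \<or> e = {g, ?g}") auto
  next
    fix e e' assume e: "e \<in> switch M h g" and e': "e' \<in> switch M h g" and i: "e \<inter> e' \<noteq> {}"
    from i obtain x where x: "x \<in> e" "x \<in> e'" by blast
    show "e = e'"
    proof (cases "x \<in> {h, ?h, g, ?g}")
      case True
      then have "e \<notin> M - {{h, ?h}, {g, ?g}}" "e' \<notin> M - {{h, ?h}, {g, ?g}}"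
        using rest[OF _ True] x by auto
      then have ee: "e = {h, g} \<or> e = {?h, ?g}" "e' = {h, g} \<or> e' = {?h, ?g}"
        using e e' by (auto simp: switch_def)
      have "{h, g} \<inter> {?h, ?g} = {}" using gh ne H by auto
      with x ee show ?thesis by blast
    next
      case False
      then have "e \<in> M" "e' \<in> M" using e e' x unfolding switch_def by auto
      then show ?thesis using perfect_matchingD(4)[OF M] x by blast
    qed
  qed
qed

text \<open>
  A switching with a fixed first half-edge \<open>h\<close> can be undone: the new mate of \<open>h\<close> is \<open>g\<close>, and a second
  switching of \<open>h\<close> with its old mate restores the matching. This is what makes switchings injective.
\<close>

lemma switch_back:
  assumes M: "M \<in> perfect_matchings H" and h: "h \<in> H" and g: "g \<in> H"
    and gh: "g \<noteq> h" "g \<noteq> mate M h"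
  shows "mate (switch M h g) h = g" "switch (switch M h g) h (mate M h) = M"
proof -
  let ?N = "switch M h g" and ?h = "mate M h" and ?g = "mate M g"
  note N = switch_perfect_matching[OF assms]
  show 1: "mate ?N h = g" by (rule mate_unique[OF N]) (simp add: switch_def)
  have 2: "mate ?N ?h = ?g" by (rule mate_unique[OF N]) (simp add: switch_def)
  have ne: "?g \<noteq> h" "?g \<noteq> ?h" "?h \<noteq> h" "?g \<noteq> g" using mate_mate[OF M] mate_neq[OF M] h g gh by metis+
  have "{h, g} \<notin> M" "{?h, ?g} \<notin> M"
    using mate_unique[OF M] mate_mate[OF M] h g gh ne by metis+
  moreover have "{h, ?h} \<in> M" "{g, ?g} \<in> M" using mate_edge[OF M] h g by auto
  ultimately show "switch ?N h ?h = M"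
    unfolding switch_def[of ?N] 1 2 unfolding switch_def by auto
qed

definition neighbours :: "('v \<times> 'k) set set \<Rightarrow> 'v \<Rightarrow> 'v set" where
  "neighbours M i = {a. {i, a} \<in> (`) fst ` M}"

text \<open>
  The half-edges at \<open>i\<close> reach every neighbour of \<open>i\<close>, so a vertex has at most as many neighbours as
  half-edges, in a multigraph too.
\<close>

lemma neighbours_subset:
  assumes M: "M \<in> perfect_matchings H"
  shows "neighbours M i \<subseteq> (\<lambda>g. fst (mate M g)) ` {g \<in> H. fst g = i}"
proof
  fix a assume "a \<in> neighbours M i"
  then obtain e where e: "e \<in> M" "fst ` e = {i, a}" by (auto simp: neighbours_def)
  then obtain x where x: "x \<in> e" "fst x = i" by (metis (no_types) imageE insertI1)
  have ex: "e = {x, mate M x}" by (rule edge_eq_mate[OF M e(1) x(1)])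
  have "fst (mate M x) = a" using e(2) x(2) unfolding ex by (auto simp: doubleton_eq_iff)
  moreover have "x \<in> H" using perfect_matchingD(1)[OF M e(1)] x by blast
  ultimately show "a \<in> (\<lambda>g. fst (mate M g)) ` {g \<in> H. fst g = i}" using x by blast
qed

lemma mate_neighbour:
  assumes M: "M \<in> perfect_matchings H" and g: "g \<in> H"
  shows "fst (mate M g) \<in> neighbours M (fst g)" "fst g \<in> neighbours M (fst (mate M g))"
proof -
  have *: "{fst g, fst (mate M g)} \<in> (`) fst ` M"
    by (rule image_eqI[OF _ mate_edge[OF M g]]) simp
  then show "fst (mate M g) \<in> neighbours M (fst g)" by (simp add: neighbours_def)
  from * show "fst g \<in> neighbours M (fst (mate M g))" by (simp add: neighbours_def insert_commute)
qed

text \<open>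
  Both multigraph defects are properties of the map that sends a matched pair to the set of its
  vertices.
\<close>

lemma edge_count_eq:
  assumes M: "M \<in> perfect_matchings H"
  shows "edge_count M i j = card {e \<in> M. fst ` e = {i, j}}"
proof -
  have "(\<exists>k l. e = {(i, k), (j, l)}) \<longleftrightarrow> fst ` e = {i, j}" if e: "e \<in> M" for e
  proof
    assume "fst ` e = {i, j}"
    then obtain x where x: "x \<in> e" "fst x = i" by (metis (no_types) imageE insertI1)
    have ex: "e = {x, mate M x}" by (rule edge_eq_mate[OF M e x(1)])
    have "fst (mate M x) = j" using \<open>fst ` e = {i, j}\<close> x(2) unfolding ex by (auto simp: doubleton_eq_iff)
    with ex x show "\<exists>k l. e = {(i, k), (j, l)}" by (metis prod.collapse)
  qed auto
  then show ?thesis unfolding edge_count_def by (metis (mono_tags, lifting))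
qed

lemma half_edges_finite: "finite (half_edges n \<delta>)"
  by (simp add: half_edges_def)

lemma card_half_edges: "card (half_edges n \<delta>) = (\<Sum>i<n. \<delta> i)"
  by (simp add: half_edges_def)

lemma simple_matching_iff:
  assumes M: "M \<in> perfect_matchings (half_edges n \<delta>)"
  shows "simple_matching n M \<longleftrightarrow> (\<forall>e\<in>M. card (fst ` e) = 2) \<and> inj_on ((`) fst) M"
proof -
  have fin: "finite M" by (rule finite_perfect_matching[OF half_edges_finite M])
  have verts: "\<exists>i<n. \<exists>j<n. fst ` e = {i, j}" if e: "e \<in> M" for e
  proof -
    obtain x y where "e = {x, y}" using perfect_matchingD(2)[OF M e] by (auto simp: card_2_iff)
    then show ?thesis
      using perfect_matchingD(1)[OF M e] by (intro exI[of _ "fst x"] exI[of _ "fst y"]) (auto simp: half_edges_def)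
  qed
  show ?thesis
  proof
    assume s: "simple_matching n M"
    have c2: "card (fst ` e) = 2" if e: "e \<in> M" for e
    proof -
      obtain i j where ij: "i < n" "j < n" "fst ` e = {i, j}" using verts[OF e] by blast
      have "i \<noteq> j"
      proof
        assume "i = j"
        have "edge_count M i i = 0" using s ij by (simp add: simple_matching_def)
        then have "{e \<in> M. fst ` e = {i, i}} = {}" using fin by (simp add: edge_count_eq[OF M])
        then show False using e ij \<open>i = j\<close> by blast
      qed
      then show ?thesis using ij by simp
    qed
    moreover have "inj_on ((`) fst) M"
    proof (rule inj_onI)
      fix e e' assume e: "e \<in> M" "e' \<in> M" and eq: "fst ` e = fst ` e'"
      obtain i j where ij: "i < n" "j < n" "fst ` e = {i, j}" using verts[OF e(1)] by blast
      have "i \<noteq> j" using c2[OF e(1)] ij by auto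
      then have "edge_count M i j \<le> 1" using s ij by (simp add: simple_matching_def)
      then have "card {e \<in> M. fst ` e = {i, j}} \<le> 1" by (simp add: edge_count_eq[OF M])
      then show "e = e'" using e eq ij fin by (auto simp: card_le_Suc0_iff_eq)
    qed
    ultimately show "(\<forall>e\<in>M. card (fst ` e) = 2) \<and> inj_on ((`) fst) M" by blast
  next
    assume a: "(\<forall>e\<in>M. card (fst ` e) = 2) \<and> inj_on ((`) fst) M"
    have "edge_count M i i = 0" for i
      using a fin by (auto simp: edge_count_eq[OF M])
    moreover have "edge_count M i j \<le> 1" for i j
      using a fin unfolding edge_count_eq[OF M] inj_on_def by (auto simp: card_le_Suc0_iff_eq)
    ultimately show "simple_matching n M" by (simp add: simple_matching_def)
  qed
qed

section \<open>Counting simple matchings\<close>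

lemma inj_on_insert_fresh: "inj_on f A \<Longrightarrow> f a \<notin> f ` A \<Longrightarrow> inj_on f (insert a A)"
  unfolding inj_on_insert by blast

locale bounded_degrees =
  fixes n :: nat and \<delta> :: "nat \<Rightarrow> nat" and D :: nat
  assumes deg_le: "i < n \<Longrightarrow> \<delta> i \<le> D"
begin

abbreviation H :: "(nat \<times> nat) set" where "H \<equiv> half_edges n \<delta>"

definition simple_matchings :: "(nat \<times> nat) set set set" where
  "simple_matchings = {M \<in> perfect_matchings H. simple_matching n M}"

definition containing :: "(nat \<times> nat) set set \<Rightarrow> (nat \<times> nat) set set set" where
  "containing F = {M \<in> simple_matchings. F \<subseteq> M}"

text \<open>
  These half-edges \<open>g\<close> are chosen so that switching \<open>h\<close> with \<open>g\<close> keeps the pairs in \<open>F\<close> and creates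
  two edges between vertices that are distinct and were not adjacent before.
\<close>

definition switch_partners ::
    "(nat \<times> nat) set set \<Rightarrow> (nat \<times> nat) set set \<Rightarrow> nat \<times> nat \<Rightarrow> (nat \<times> nat) set" where
  "switch_partners M F h = {g \<in> H. g \<notin> \<Union>F \<and>
     fst g \<notin> insert (fst h) (neighbours M (fst h)) \<and>
     fst (mate M g) \<notin> insert (fst (mate M h)) (neighbours M (fst (mate M h)))}"

lemma finite_H [simp]: "finite H"
  by (rule half_edges_finite)

lemma finite_simple_matchings: "finite simple_matchings"
  unfolding simple_matchings_def by (simp add: finite_perfect_matchings)

lemma finite_containing: "finite (containing F)"
  unfolding containing_def by (simp add: finite_simple_matchings)

lemma simple_matchings_PM: "M \<in> simple_matchings \<Longrightarrow> M \<in> perfect_matchings H"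
  by (simp add: simple_matchings_def)

lemma card_half_edges_over:
  assumes "finite A"
  shows "card {g \<in> H. fst g \<in> A} \<le> card A * D"
proof -
  have "{g \<in> H. fst g \<in> A} = (SIGMA i:A \<inter> {..<n}. {..<\<delta> i})"
    by (auto simp: half_edges_def)
  then have "card {g \<in> H. fst g \<in> A} = (\<Sum>i\<in>A \<inter> {..<n}. \<delta> i)" by simp
  also have "\<dots> \<le> (\<Sum>i\<in>A \<inter> {..<n}. D)" by (rule sum_mono) (use deg_le in auto)
  also have "\<dots> \<le> card A * D" using assms by (simp add: card_mono)
  finally show ?thesis .
qed

lemma card_neighbours:
  assumes M: "M \<in> perfect_matchings H"
  shows "finite (neighbours M i)" "card (neighbours M i) \<le> D"
proof -
  have sub: "neighbours M i \<subseteq> (\<lambda>g. fst (mate M g)) ` {g \<in> H. fst g = i}"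
    by (rule neighbours_subset[OF M])
  show "finite (neighbours M i)" by (rule finite_subset[OF sub]) simp
  have "card (neighbours M i) \<le> card ((\<lambda>g. fst (mate M g)) ` {g \<in> H. fst g = i})"
    by (rule card_mono[OF _ sub]) simp
  also have "\<dots> \<le> card {g \<in> H. fst g \<in> {i}}"
    using card_image_le[of "{g \<in> H. fst g = i}"] by simp
  also have "\<dots> \<le> D" using card_half_edges_over[of "{i}"] by simp
  finally show "card (neighbours M i) \<le> D" .
qed

text \<open>
  Each pair in \<open>F\<close> excludes two half-edges. The condition on \<open>g\<close>, and likewise the condition on its
  mate, excludes the half-edges at a vertex and its at most \<open>D\<close> neighbours.
\<close>

lemma switch_partners_large:
  assumes M: "M \<in> perfect_matchings H" and F: "F \<subseteq> M"
  shows "card H \<le> card (switch_partners M F h) + 2 * card F + 2 * ((D + 1) * D)"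
proof -
  define N where "N i = insert i (neighbours M i)" for i
  have N: "finite (N i)" "card (N i) \<le> D + 1" for i
    using card_neighbours[OF M, of i] card_insert_le_m1[of "D + 1" "neighbours M i" i]
    by (auto simp: N_def)
  define B1 where "B1 = \<Union>F"
  define B2 where "B2 = {g \<in> H. fst g \<in> N (fst h)}"
  define B3 where "B3 = {g \<in> H. fst (mate M g) \<in> N (fst (mate M h))}"
  have finM: "finite M" by (rule finite_perfect_matching[OF _ M]) simp
  then have finF: "finite F" using F finite_subset by blast
  have finB1: "finite B1" unfolding B1_def
    using finF F perfect_matchingD(1)[OF M] by (meson finite_H finite_Union finite_subset subsetD)
  have "card B1 \<le> (\<Sum>e\<in>F. card e)" unfolding B1_def by (rule card_Union_le_sum_card)
  also have "\<dots> = 2 * card F"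
    using perfect_matchingD(2)[OF M] F by (simp add: subset_iff)
  finally have B1: "card B1 \<le> 2 * card F" .
  have step: "card {g \<in> H. fst g \<in> N i} \<le> (D + 1) * D" for i
    using card_half_edges_over[OF N(1)[of i]] N(2)[of i] by (meson le_trans mult_le_mono1)
  have B2: "card B2 \<le> (D + 1) * D" unfolding B2_def by (rule step)
  have "card B3 = card (mate M ` B3)"
    by (rule card_image[symmetric], rule inj_on_inverseI[of _ "mate M"])
       (use mate_mate[OF M] in \<open>auto simp: B3_def\<close>)
  also have "\<dots> \<le> card {g \<in> H. fst g \<in> N (fst (mate M h))}"
    by (rule card_mono) (use mate_in[OF M] in \<open>auto simp: B3_def\<close>)
  also have "\<dots> \<le> (D + 1) * D" by (rule step)
  finally have B3: "card B3 \<le> (D + 1) * D" .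
  have fin: "finite (switch_partners M F h)" by (simp add: switch_partners_def)
  have "H \<subseteq> switch_partners M F h \<union> (B1 \<union> (B2 \<union> B3))"
    unfolding switch_partners_def B1_def B2_def B3_def N_def by blast
  then have "card H \<le> card (switch_partners M F h \<union> (B1 \<union> (B2 \<union> B3)))"
    by (rule card_mono[rotated]) (use fin finB1 in \<open>auto simp: B2_def B3_def\<close>)
  also have "\<dots> \<le> card (switch_partners M F h) + (card B1 + (card B2 + card B3))"
    by (meson add_le_mono card_Un_le le_refl le_trans)
  finally show ?thesis using B1 B2 B3 by linarith
qed

lemma switch_partner_props:
  assumes M: "M \<in> perfect_matchings H" and h: "h \<in> H" and g: "g \<in> switch_partners M F h"
  shows "g \<in> H" "g \<noteq> h" "g \<noteq> mate M h"
    and "card {fst h, fst g} = 2" "card {fst (mate M h), fst (mate M g)} = 2"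
    and "{fst h, fst g} \<notin> (`) fst ` M" "{fst (mate M h), fst (mate M g)} \<notin> (`) fst ` M"
    and "fst g \<noteq> fst (mate M h)"
proof -
  note n = mate_neighbour(1)[OF M h]
  show "g \<in> H" "g \<noteq> h" "g \<noteq> mate M h" using g n by (auto simp: switch_partners_def)
  show "card {fst h, fst g} = 2" "card {fst (mate M h), fst (mate M g)} = 2"
    using g by (auto simp: switch_partners_def)
  show "{fst h, fst g} \<notin> (`) fst ` M" "{fst (mate M h), fst (mate M g)} \<notin> (`) fst ` M"
    using g by (auto simp: switch_partners_def neighbours_def)
  show "fst g \<noteq> fst (mate M h)" using g n by (auto simp: switch_partners_def)
qed

text \<open>
  Both new edges are simple and absent from \<open>M\<close>. They are not parallel to each other either: otherwise
  \<open>g\<close> would sit at the vertex of the mate of \<open>h\<close>, which is a neighbour of the vertex of \<open>h\<close>.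
\<close>

lemma switch_simple:
  assumes M: "M \<in> simple_matchings" and h: "h \<in> H" and g: "g \<in> switch_partners M F h"
  shows "switch M h g \<in> simple_matchings"
proof -
  have PM: "M \<in> perfect_matchings H" by (rule simple_matchings_PM[OF M])
  note gp = switch_partner_props[OF PM h g]
  have sPM: "switch M h g \<in> perfect_matchings H"
    by (rule switch_perfect_matching[OF PM h gp(1-3)])
  have s: "\<forall>e\<in>M. card (fst ` e) = 2" "inj_on ((`) fst) M"
    using M simple_matching_iff[OF PM] by (auto simp: simple_matchings_def)
  have "fst h \<noteq> fst (mate M h)" using s(1) mate_edge[OF PM h] by force
  then have d: "{fst h, fst g} \<noteq> {fst (mate M h), fst (mate M g)}"
    using gp(8) by (auto simp: doubleton_eq_iff)
  have "\<forall>e\<in>switch M h g. card (fst ` e) = 2"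
    using s(1) gp(4,5) by (auto simp: switch_def)
  moreover have "inj_on ((`) fst) (switch M h g)"
  proof -
    define N where "N = M - {{h, mate M h}, {g, mate M g}}"
    have "switch M h g = insert {h, g} (insert {mate M h, mate M g} N)"
      by (auto simp: switch_def N_def)
    moreover have "inj_on ((`) fst) N" using s(2) unfolding N_def by (rule inj_on_diff)
    moreover have "{fst h, fst g} \<notin> (`) fst ` N" "{fst (mate M h), fst (mate M g)} \<notin> (`) fst ` N"
      using gp(6,7) by (auto simp: N_def)
    ultimately show ?thesis
      using d by (simp only:) (intro inj_on_insert_fresh, simp_all)
  qed
  ultimately show ?thesis using simple_matching_iff[OF sPM] sPM by (simp add: simple_matchings_def)
qed

text \<open>
  Double counting of the switchings that destroy the edge \<open>e = {h, h'}\<close>. Every matching that contains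
  \<open>e\<close> and \<open>F\<close> has many switch partners, and the resulting matching contains \<open>F\<close>. By
  \<open>switch_back\<close>, the resulting matching determines both the original matching and the partner.
\<close>

lemma containing_insert:
  assumes e: "e \<notin> F"
  shows "card (containing (insert e F)) * (card H - 2 * card F - 2 * ((D + 1) * D)) \<le> card (containing F)"
proof (cases "containing (insert e F) = {}")
  case False
  then obtain M0 where M0: "M0 \<in> simple_matchings" "insert e F \<subseteq> M0"
    by (auto simp: containing_def)
  then have "card e = 2" "e \<subseteq> H"
    using perfect_matchingD(1,2)[OF simple_matchings_PM] by blast+
  then obtain h h' where hh: "e = {h, h'}" "h \<in> H" by (auto simp: card_2_iff)
  let ?A = "containing (insert e F)" and ?K = "card H - 2 * card F - 2 * ((D + 1) * D)"
  have A: "M \<in> simple_matchings" "M \<in> perfect_matchings H" "mate M h = h'" "F \<subseteq> M" "e \<in> M"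
    if "M \<in> ?A" for M
  proof -
    show M: "M \<in> simple_matchings" "F \<subseteq> M" "e \<in> M" using that by (auto simp: containing_def)
    show PM: "M \<in> perfect_matchings H" by (rule simple_matchings_PM[OF M(1)])
    show "mate M h = h'" using mate_unique[OF PM] M hh by blast
  qed
  let ?f = "\<lambda>(M, g). switch M h g"
  let ?S = "SIGMA M:?A. switch_partners M F h"
  have fin: "finite (switch_partners M F h)" for M by (simp add: switch_partners_def)
  have "card ?A * ?K = (\<Sum>M\<in>?A. ?K)" by simp
  also have "\<dots> \<le> (\<Sum>M\<in>?A. card (switch_partners M F h))"
  proof (rule sum_mono)
    fix M assume m: "M \<in> ?A"
    show "?K \<le> card (switch_partners M F h)"
      using switch_partners_large[OF A(2)[OF m] A(4)[OF m], of h] by linarith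
  qed
  also have "\<dots> = card ?S" using finite_containing fin by simp
  also have "card ?S = card (?f ` ?S)"
  proof (rule card_image[symmetric], rule inj_onI)
    fix x y assume x: "x \<in> ?S" and y: "y \<in> ?S" and eq: "?f x = ?f y"
    \<comment> \<open>the matching and the partner can be recovered from the switched matching\<close>
    have undo: "mate (?f z) h = snd z \<and> switch (?f z) h h' = fst z" if zS: "z \<in> ?S" for z
    proof -
      obtain M g where z: "z = (M, g)" "M \<in> ?A" "g \<in> switch_partners M F h" using zS by blast
      note gp = switch_partner_props[OF A(2)[OF z(2)] hh(2) z(3)]
      show ?thesis
        using switch_back[OF A(2)[OF z(2)] hh(2) gp(1-3)] A(3)[OF z(2)] z(1) by simp
    qed
    show "x = y" using undo[OF x] undo[OF y] eq by (metis prod.collapse)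
  qed
  also have "\<dots> \<le> card (containing F)"
  proof (rule card_mono[OF finite_containing], rule image_subsetI)
    fix z assume z0: "z \<in> ?S"
    then obtain M g where z: "z = (M, g)" "M \<in> ?A" "g \<in> switch_partners M F h" by blast
    note PM = A(2)[OF z(2)]
    have "switch M h g \<in> simple_matchings"
      by (rule switch_simple[OF A(1)[OF z(2)] hh(2) z(3)])
    moreover have "F \<subseteq> switch M h g"
    proof -
      have "g \<notin> \<Union>F" using z(3) by (simp add: switch_partners_def)
      then have "{h, mate M h} \<notin> F" "{g, mate M g} \<notin> F"
        using e A(3)[OF z(2)] hh by auto
      then show ?thesis using A(4)[OF z(2)] by (auto simp: switch_def)
    qed
    ultimately show "?f z \<in> containing F" using z(1) by (simp add: containing_def)
  qed
  finally show ?thesis .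
qed simp

lemma card_containing_le:
  assumes k: "2 * k + 2 * ((D + 1) * D) < card H" and F: "finite F" "card F \<le> k"
  shows "real (card (containing F))
    \<le> real (card simple_matchings) * (1 / (real (card H) - 2 * real k - 2 * real ((D + 1) * D))) ^ card F"
  using F
proof (induction F)
  case empty
  then show ?case by (simp add: containing_def)
next
  case (insert e F)
  let ?d = "real (card H) - 2 * real k - 2 * real ((D + 1) * D)"
  have kk: "card F \<le> k" using insert by simp
  have d0: "?d > 0"
    using of_nat_less_iff[where 'a = real, THEN iffD2, OF k] by (simp add: algebra_simps)
  have "?d \<le> real (card H - 2 * card F - 2 * ((D + 1) * D))"
  proof -
    have "2 * card F + 2 * ((D + 1) * D) \<le> card H" using k kk by linarith
    then have "real (card H - 2 * card F - 2 * ((D + 1) * D))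
       = real (card H) - 2 * real (card F) - 2 * real ((D + 1) * D)"
      by (simp add: of_nat_diff algebra_simps)
    then show ?thesis using kk by simp
  qed
  then have "real (card (containing (insert e F))) * ?d
      \<le> real (card (containing (insert e F))) * real (card H - 2 * card F - 2 * ((D + 1) * D))"
    by (rule mult_left_mono) simp
  also have "\<dots> \<le> real (card (containing F))"
    using containing_insert[OF insert(2)] unfolding of_nat_mult[symmetric] of_nat_le_iff .
  also have "\<dots> \<le> real (card simple_matchings) * (1 / ?d) ^ card F"
    by (rule insert.IH[OF kk])
  finally have "real (card (containing (insert e F)))
      \<le> real (card simple_matchings) * (1 / ?d) ^ card F / ?d"
    by (subst pos_le_divide_eq[OF d0])
  moreover have "card (insert e F) = Suc (card F)" using insert(1,2) by simp
  ultimately show ?case by (simp only: power_Suc2 divide_inverse mult_1 mult.assoc)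
qed

end

lemma perfect_matchings_nonempty:
  assumes "finite H" "even (card H)"
  shows "perfect_matchings H \<noteq> {}"
proof -
  obtain k where "card H = 2 * k" using assms(2) by blast
  then show ?thesis using assms(1)
  proof (induction k arbitrary: H)
    case 0
    then have "{} \<in> perfect_matchings H" by (simp add: perfect_matchings_iff)
    then show ?case by blast
  next
    case (Suc k)
    then have "H \<noteq> {}" by auto
    then obtain x where x: "x \<in> H" by blast
    have "card (H - {x}) = Suc (2 * k)" using Suc x by simp
    then obtain y where y: "y \<in> H" "y \<noteq> x" by (metis Diff_iff all_not_in_conv card.empty insertCI nat.distinct(1))
    have "card (H - {x, y}) = 2 * k" using Suc x y by (simp add: card_Diff_subset)
    then obtain M where M: "M \<in> perfect_matchings (H - {x, y})" using Suc by auto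
    have "partition_on H (insert {x, y} M)"
    proof (subst partition_on_insert)
      show "disjnt {x, y} (\<Union>M)"
        using M unfolding perfect_matchings_def partition_on_def disjnt_def by blast
      show "partition_on (H - {x, y}) M \<and> {x, y} \<subseteq> H \<and> {x, y} \<noteq> {}"
        using M x y by (simp add: perfect_matchings_def)
    qed
    then have "insert {x, y} M \<in> perfect_matchings H"
      using M y by (auto simp: perfect_matchings_def)
    then show ?case by blast
  qed
qed

context bounded_degrees begin

text \<open>
  Choose a matching whose edges join as many different pairs of distinct vertices as possible. If it
  has a loop or a parallel edge, then switching that edge gains two such pairs and loses at most the
  one that belonged to the partner edge, or gains one and loses none when the partner edge is a loop.
\<close>

lemma simple_matchings_nonempty:
  assumes ev: "even (card H)" and big: "2 * ((D + 1) * D) < card H"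
  shows "simple_matchings \<noteq> {}"
proof -
  \<comment> \<open>the pairs of distinct vertices that are joined by an edge\<close>
  define supp where "supp M = {s \<in> (`) fst ` M. card s = 2}" for M :: "(nat \<times> nat) set set"
  have fin_supp: "finite (supp M)" if "M \<in> perfect_matchings H" for M
    using finite_perfect_matching[OF _ that] by (simp add: supp_def)
  have "finite (card ` supp ` perfect_matchings H)" "card ` supp ` perfect_matchings H \<noteq> {}"
    using perfect_matchings_nonempty[OF finite_H ev] finite_perfect_matchings[OF finite_H] by auto
  then obtain M where M: "M \<in> perfect_matchings H"
      and max: "\<And>N. N \<in> perfect_matchings H \<Longrightarrow> card (supp N) \<le> card (supp M)"
    using Max_in[of "card ` supp ` perfect_matchings H"] Max_ge[of "card ` supp ` perfect_matchings H"]
    by (smt (verit) imageE image_eqI)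
  have "simple_matching n M"
  proof (rule ccontr)
    assume "\<not> simple_matching n M"
    then obtain e where e: "e \<in> M" and bad: "card (fst ` e) \<noteq> 2 \<or> (\<exists>e'\<in>M. e' \<noteq> e \<and> fst ` e = fst ` e')"
      unfolding simple_matching_iff[OF M] inj_on_def by blast
    obtain h where h: "h \<in> e" "h \<in> H"
      using perfect_matchingD(1,2)[OF M e] by (auto simp: card_2_iff)
    have eh: "e = {h, mate M h}" by (rule edge_eq_mate[OF M e h(1)])
    have "switch_partners M {} h \<noteq> {}"
      using switch_partners_large[OF M, of "{}" h] big by auto
    then obtain g where g: "g \<in> switch_partners M {} h" by blast
    note gp = switch_partner_props[OF M h(2) g]
    define N where "N = switch M h g"
    have N: "N \<in> perfect_matchings H"
      unfolding N_def by (rule switch_perfect_matching[OF M h(2) gp(1-3)])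
    define a b c where "a = {fst h, fst g}" and "b = {fst (mate M h), fst (mate M g)}"
      and "c = {fst g, fst (mate M g)}"
    have ab: "a \<in> supp N" "b \<in> supp N" "a \<notin> supp M" "b \<notin> supp M"
    proof -
      have "{h, g} \<in> N" "{mate M h, mate M g} \<in> N" by (auto simp: N_def switch_def)
      then have "fst ` {h, g} \<in> (`) fst ` N" "fst ` {mate M h, mate M g} \<in> (`) fst ` N" by blast+
      then show "a \<in> supp N" "b \<in> supp N" using gp(4,5) by (auto simp: supp_def a_def b_def)
      show "a \<notin> supp M" "b \<notin> supp M" using gp(6,7) by (auto simp: supp_def a_def b_def)
    qed
    \<comment> \<open>removing the bad edge \<open>e\<close> costs nothing: it is a loop or has a parallel copy\<close>
    have keep: "supp M - {c} \<subseteq> supp N"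
    proof
      fix s assume s: "s \<in> supp M - {c}"
      then obtain f where f: "f \<in> M" "fst ` f = s" by (auto simp: supp_def)
      have "\<exists>f\<in>M. f \<noteq> e \<and> fst ` f = s"
        using bad f s by (cases "f = e") (auto simp: supp_def)
      then obtain f where f: "f \<in> M" "f \<noteq> e" "fst ` f = s" by blast
      have "f \<noteq> {g, mate M g}" using f(3) s by (auto simp: c_def)
      then have "f \<in> N" using f eh by (auto simp: N_def switch_def)
      then show "s \<in> supp N" using f s by (auto simp: supp_def)
    qed
    have "card (supp M) < card (supp N)"
    proof (cases "c \<in> supp M")
      case False
      then have "insert a (supp M) \<subseteq> supp N" using keep ab by blast
      then have "card (insert a (supp M)) \<le> card (supp N)" by (rule card_mono[OF fin_supp[OF N]])
      then show ?thesis using ab fin_supp[OF M] by simp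
    next
      case True
      have "a \<noteq> b"
      proof
        assume "a = b"
        then have "fst g = fst (mate M g)" using gp(8) by (auto simp: a_def b_def doubleton_eq_iff)
        then show False using True by (simp add: supp_def c_def)
      qed
      have "insert a (insert b (supp M - {c})) \<subseteq> supp N" using keep ab by blast
      then have "card (insert a (insert b (supp M - {c}))) \<le> card (supp N)"
        by (rule card_mono[OF fin_supp[OF N]])
      moreover have "card (insert a (insert b (supp M - {c}))) = Suc (Suc (card (supp M) - 1))"
        using ab \<open>a \<noteq> b\<close> fin_supp[OF M] True by simp
      ultimately show ?thesis by linarith
    qed
    then show False using max[OF N] by simp
  qed
  then show ?thesis using M by (auto simp: simple_matchings_def)
qed

end

section \<open>Moments of the adjacency matrix\<close>

lemma double_sum_times:
  fixes f :: "'b \<Rightarrow> 'c \<Rightarrow> real" and g :: "'d \<Rightarrow> 'e \<Rightarrow> real"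
  shows "(\<Sum>k\<in>A. \<Sum>l\<in>B. f k l) * (\<Sum>k'\<in>A'. \<Sum>l'\<in>B'. g k' l')
    = (\<Sum>k\<in>A. \<Sum>l\<in>B. \<Sum>k'\<in>A'. \<Sum>l'\<in>B'. f k l * g k' l')"
proof -
  have 1: "(\<Sum>k\<in>A. \<Sum>l\<in>B. f k l) * Y = (\<Sum>k\<in>A. \<Sum>l\<in>B. f k l * Y)" for Y
    by (simp only: sum_distrib_right)
  have 2: "x * (\<Sum>k'\<in>A'. \<Sum>l'\<in>B'. g k' l') = (\<Sum>k'\<in>A'. \<Sum>l'\<in>B'. x * g k' l')" for x
    by (simp only: sum_distrib_left)
  show ?thesis by (subst 1) (simp only: 2)
qed

text \<open>
  The sum of the gaps \<open>b t - a t\<close> controls every weighted sum of them. Hence upper bounds for single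
  probabilities become two-sided estimates as soon as the unweighted sum is known exactly.
\<close>

lemma weighted_sum_squeeze:
  fixes a b w :: "'b \<Rightarrow> real"
  assumes ab: "\<And>t. t \<in> I \<Longrightarrow> a t \<le> b t" and w: "\<And>t. t \<in> I \<Longrightarrow> 0 \<le> w t" "\<And>t. t \<in> I \<Longrightarrow> w t \<le> W"
  shows "(\<Sum>t\<in>I. a t * w t) \<le> (\<Sum>t\<in>I. b t * w t)"
    and "(\<Sum>t\<in>I. b t * w t) - W * ((\<Sum>t\<in>I. b t) - (\<Sum>t\<in>I. a t)) \<le> (\<Sum>t\<in>I. a t * w t)"
proof -
  show "(\<Sum>t\<in>I. a t * w t) \<le> (\<Sum>t\<in>I. b t * w t)"
    using ab w by (intro sum_mono mult_right_mono) auto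
  have "(\<Sum>t\<in>I. b t * w t) - (\<Sum>t\<in>I. a t * w t) = (\<Sum>t\<in>I. (b t - a t) * w t)"
    by (simp add: sum_subtractf left_diff_distrib)
  also have "\<dots> \<le> (\<Sum>t\<in>I. (b t - a t) * W)"
    using ab w by (intro sum_mono mult_left_mono) auto
  also have "\<dots> = W * ((\<Sum>t\<in>I. b t) - (\<Sum>t\<in>I. a t))"
    unfolding sum_distrib_right[symmetric] sum_subtractf by (rule mult.commute)
  finally show "(\<Sum>t\<in>I. b t * w t) - W * ((\<Sum>t\<in>I. b t) - (\<Sum>t\<in>I. a t)) \<le> (\<Sum>t\<in>I. a t * w t)" by simp
qed

context bounded_degrees begin

definition avg :: "((nat \<times> nat) set set \<Rightarrow> real) \<Rightarrow> real" where
  "avg f = (\<Sum>M\<in>simple_matchings. f M) / real (card simple_matchings)"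

text \<open>
  An upper bound for the conditional probability of one more edge, given that fewer than \<open>k\<close> other
  edges are prescribed.
\<close>

definition edge_bound :: "nat \<Rightarrow> real" where
  "edge_bound k = 1 / (real (card H) - 2 * real k - 2 * real ((D + 1) * D))"

definition adj :: "(nat \<times> nat) set set \<Rightarrow> nat \<Rightarrow> nat \<Rightarrow> real" where
  "adj M i j = real (edge_count M i j)"

lemma avg_mono: "(\<And>M. M \<in> simple_matchings \<Longrightarrow> f M \<le> g M) \<Longrightarrow> avg f \<le> avg g"
  unfolding avg_def by (intro divide_right_mono sum_mono) auto

lemma avg_cong: "(\<And>M. M \<in> simple_matchings \<Longrightarrow> f M = g M) \<Longrightarrow> avg f = avg g"
  unfolding avg_def by simp

lemma avg_add: "avg (\<lambda>M. f M + g M) = avg f + avg g"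
  by (simp add: avg_def sum.distrib add_divide_distrib)

lemma avg_diff: "avg (\<lambda>M. f M - g M) = avg f - avg g"
  by (simp add: avg_def sum_subtractf diff_divide_distrib)

lemma avg_scale: "avg (\<lambda>M. c * f M) = c * avg f"
  by (simp add: avg_def sum_distrib_left[symmetric])

lemma avg_sum: "avg (\<lambda>M. \<Sum>i\<in>I. f i M) = (\<Sum>i\<in>I. avg (f i))"
  unfolding avg_def by (subst sum.swap) (simp add: sum_divide_distrib)

lemma avg_const: "simple_matchings \<noteq> {} \<Longrightarrow> avg (\<lambda>M. c) = c"
  using finite_simple_matchings by (simp add: avg_def)

lemma avg_nonneg: "(\<And>M. M \<in> simple_matchings \<Longrightarrow> 0 \<le> f M) \<Longrightarrow> 0 \<le> avg f"
  unfolding avg_def by (intro divide_nonneg_nonneg sum_nonneg) auto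

lemma avg_containing:
  assumes k: "2 * k + 2 * ((D + 1) * D) < card H" and F: "finite F" "card F \<le> k"
  shows "avg (\<lambda>M. of_bool (F \<subseteq> M)) \<le> edge_bound k ^ card F"
proof -
  have "(\<Sum>M\<in>simple_matchings. of_bool (F \<subseteq> M)) = real (card (containing F))"
    using finite_simple_matchings by (simp add: sum.If_cases of_bool_def containing_def Int_def)
  moreover have "real (card (containing F)) \<le> real (card simple_matchings) * edge_bound k ^ card F"
    unfolding edge_bound_def by (rule card_containing_le[OF k F])
  ultimately show ?thesis
  proof (cases "simple_matchings = {}")
    case False
    then have "real (card simple_matchings) > 0" using finite_simple_matchings by (simp add: card_gt_0_iff)
    then show ?thesis
      using \<open>real (card (containing F)) \<le> _\<close> \<open>_ = real (card (containing F))\<close>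
      by (simp add: avg_def pos_divide_le_eq mult.commute)
  next
    case True
    have "edge_bound k \<ge> 0"
      using of_nat_less_iff[where 'a = real, THEN iffD2, OF k] by (simp add: edge_bound_def algebra_simps)
    then show ?thesis using True by (simp add: avg_def)
  qed
qed

lemma edge_count_commute: "edge_count M i j = edge_count M j i"
proof -
  have "(\<exists>k l. e = {(i, k), (j, l)}) = (\<exists>k l. e = {(j, k), (i, l)})" for e :: "(nat \<times> nat) set"
    by (auto simp: insert_commute)
  then show ?thesis unfolding edge_count_def by simp
qed

lemma adj_commute: "adj M i j = adj M j i"
  by (simp add: adj_def edge_count_commute[of M i j])

lemma simple_matching_edges:
  assumes M: "M \<in> simple_matchings" and e: "{x, y} \<in> M"
  shows "fst x \<noteq> fst y"
proof -
  have "card (fst ` {x, y}) = 2"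
    using M e simple_matching_iff[OF simple_matchings_PM[OF M]] by (auto simp: simple_matchings_def)
  then show ?thesis by auto
qed

lemma adj_cases:
  assumes M: "M \<in> simple_matchings" and ij: "i < n" "j < n"
  shows "adj M i j = 0 \<or> adj M i j = 1"
proof -
  have "edge_count M i j \<le> 1"
    using M ij by (cases "i = j") (auto simp: simple_matchings_def simple_matching_def)
  then show ?thesis by (auto simp: adj_def le_Suc_eq)
qed

lemma adj_nonneg [simp]: "0 \<le> adj M i j"
  by (simp add: adj_def)

text \<open>
  For \<open>i = j\<close> both sides vanish, because a simple matching has no loops.
\<close>

lemma adj_eq_half_edges:
  assumes M: "M \<in> simple_matchings" and ij: "i < n" "j < n"
  shows "adj M i j = (\<Sum>k<\<delta> i. \<Sum>l<\<delta> j. of_bool ({(i, k), (j, l)} \<in> M))"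
proof (cases "i = j")
  case True
  have "adj M i j = 0" using M ij True by (simp add: adj_def simple_matchings_def simple_matching_def)
  moreover have "{(i, k), (j, l)} \<notin> M" for k l using simple_matching_edges[OF M] True by fastforce
  ultimately show ?thesis by simp
next
  case False
  note PM = simple_matchings_PM[OF M]
  let ?S = "{(k, l). k < \<delta> i \<and> l < \<delta> j \<and> {(i, k), (j, l)} \<in> M}"
  have "{e \<in> M. \<exists>k l. e = {(i, k), (j, l)}} = (\<lambda>(k, l). {(i, k), (j, l)}) ` ?S"
  proof (intro equalityI subsetI)
    fix e assume "e \<in> {e \<in> M. \<exists>k l. e = {(i, k), (j, l)}}"
    then obtain k l where e: "e \<in> M" "e = {(i, k), (j, l)}" by blast
    then have "(i, k) \<in> H" "(j, l) \<in> H" using perfect_matchingD(1)[OF PM] by blast+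
    then show "e \<in> (\<lambda>(k, l). {(i, k), (j, l)}) ` ?S" using e by (auto simp: half_edges_def)
  qed auto
  moreover have "inj_on (\<lambda>(k, l). {(i, k), (j, l)}) ?S"
    using False by (auto simp: inj_on_def doubleton_eq_iff)
  ultimately have "edge_count M i j = card ?S" by (simp add: edge_count_def card_image)
  also have "?S = (SIGMA k:{..<\<delta> i}. {l\<in>{..<\<delta> j}. {(i, k), (j, l)} \<in> M})" by auto
  also have "card \<dots> = (\<Sum>k<\<delta> i. card {l\<in>{..<\<delta> j}. {(i, k), (j, l)} \<in> M})" by simp
  finally show ?thesis by (simp add: adj_def of_bool_def sum.If_cases Int_def)
qed

lemma adj_row_sum:
  assumes M: "M \<in> simple_matchings" and i: "i < n"
  shows "(\<Sum>j<n. adj M i j) = real (\<delta> i)"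
proof -
  note PM = simple_matchings_PM[OF M]
  have one: "(\<Sum>j<n. \<Sum>l<\<delta> j. of_bool ({(i, k), (j, l)} \<in> M)) = (1 :: real)" if k: "k < \<delta> i" for k
  proof -
    have h: "(i, k) \<in> H" using i k by (simp add: half_edges_def)
    have "(\<Sum>j<n. \<Sum>l<\<delta> j. F (j, l)) = (\<Sum>g\<in>H. F g)" for F :: "nat \<times> nat \<Rightarrow> real"
      by (simp add: half_edges_def sum.Sigma split_def)
    from this[of "\<lambda>g. of_bool ({(i, k), g} \<in> M)"]
    have "(\<Sum>j<n. \<Sum>l<\<delta> j. of_bool ({(i, k), (j, l)} \<in> M)) = (\<Sum>g\<in>H. of_bool ({(i, k), g} \<in> M) :: real)" .
    also have "\<dots> = (\<Sum>g\<in>H. if g = mate M (i, k) then 1 else 0)"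
    proof (rule sum.cong[OF refl])
      fix g assume "g \<in> H"
      show "of_bool ({(i, k), g} \<in> M) = (if g = mate M (i, k) then 1 else (0 :: real))"
      proof (cases "g = mate M (i, k)")
        case True
        then show ?thesis using mate_edge[OF PM h] by simp
      next
        case False
        then have "{(i, k), g} \<notin> M" using mate_unique[OF PM] by blast
        then show ?thesis using False by simp
      qed
    qed
    also have "\<dots> = 1" using mate_in[OF PM h] by (simp add: sum.delta)
    finally show ?thesis .
  qed
  have "(\<Sum>j<n. adj M i j) = (\<Sum>j<n. \<Sum>k<\<delta> i. \<Sum>l<\<delta> j. of_bool ({(i, k), (j, l)} \<in> M))"
    by (rule sum.cong) (use adj_eq_half_edges[OF M i] in auto)
  also have "\<dots> = (\<Sum>k<\<delta> i. \<Sum>j<n. \<Sum>l<\<delta> j. of_bool ({(i, k), (j, l)} \<in> M))" by (rule sum.swap)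
  also have "\<dots> = (\<Sum>k<\<delta> i. 1)" by (rule sum.cong) (use one in auto)
  finally show ?thesis by simp
qed

definition msum :: "nat \<Rightarrow> real" where
  "msum r = (\<Sum>i<n. real (\<delta> i) ^ r)"

lemma card_H: "real (card H) = msum 1"
  by (simp add: card_half_edges msum_def)

lemma deg_le_real: "i < n \<Longrightarrow> real (\<delta> i) \<le> real D"
  using deg_le by simp

end

locale sparse_degrees = bounded_degrees +
  assumes ev: "even (card H)" and big: "4 + 2 * ((D + 1) * D) < card H"
begin

lemma nonempty: "simple_matchings \<noteq> {}"
  by (rule simple_matchings_nonempty[OF ev]) (use big in simp)

text \<open>
  One bound serves for single edges and for pairs of edges; the second assumption of the locale makes
  it positive.
\<close>

abbreviation p :: real where "p \<equiv> edge_bound 2"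

lemma p_pos: "p > 0"
  using of_nat_less_iff[where 'a = real, THEN iffD2, OF big] by (simp add: edge_bound_def algebra_simps)

lemma m1_p: "1 \<le> msum 1 * p"
proof -
  define X where "X = real (card H) - 2 * real 2 - 2 * real ((D + 1) * D)"
  have "X > 0" using p_pos by (simp add: X_def edge_bound_def)
  moreover have "X \<le> msum 1" unfolding X_def card_H by (simp del: of_nat_mult)
  ultimately show ?thesis unfolding edge_bound_def X_def[symmetric] by (simp add: pos_le_divide_eq)
qed

lemma avg_edge: "avg (\<lambda>M. of_bool (e \<in> M)) \<le> p"
proof -
  have "avg (\<lambda>M. of_bool ({e} \<subseteq> M)) \<le> p ^ card {e}"
    by (rule avg_containing) (use big in auto)
  then show ?thesis by simp
qed

lemma avg_two_edges:
  assumes "e \<noteq> e'" shows "avg (\<lambda>M. of_bool (e \<in> M) * of_bool (e' \<in> M)) \<le> p\<^sup>2"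
proof -
  have "avg (\<lambda>M. of_bool ({e, e'} \<subseteq> M)) \<le> p ^ card {e, e'}"
    by (rule avg_containing) (use big assms in auto)
  moreover have "card {e, e'} = 2" using assms by simp
  moreover have "(\<lambda>M. of_bool ({e, e'} \<subseteq> M)) = (\<lambda>M. of_bool (e \<in> M) * of_bool (e' \<in> M) :: real)"
    by (auto simp: of_bool_def)
  ultimately show ?thesis by simp
qed

lemma avg_adj:
  assumes ij: "i < n" "j < n"
  shows "avg (\<lambda>M. adj M i j) \<le> p * (real (\<delta> i) * real (\<delta> j))"
proof -
  have "avg (\<lambda>M. adj M i j) = avg (\<lambda>M. \<Sum>k<\<delta> i. \<Sum>l<\<delta> j. of_bool ({(i, k), (j, l)} \<in> M))"
    by (rule avg_cong, rule adj_eq_half_edges) (use ij in auto)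
  also have "\<dots> = (\<Sum>k<\<delta> i. \<Sum>l<\<delta> j. avg (\<lambda>M. of_bool ({(i, k), (j, l)} \<in> M)))"
    by (simp only: avg_sum)
  also have "\<dots> \<le> (\<Sum>k<\<delta> i. \<Sum>l<\<delta> j. p)" by (intro sum_mono avg_edge)
  finally show ?thesis by (simp add: mult_ac)
qed

lemma adj_prod_half_edges:
  assumes M: "M \<in> simple_matchings" and ij: "i < n" "j < n" "i' < n" "j' < n"
  shows "adj M i j * adj M i' j' = (\<Sum>k<\<delta> i. \<Sum>l<\<delta> j. \<Sum>k'<\<delta> i'. \<Sum>l'<\<delta> j'.
      of_bool ({(i, k), (j, l)} \<in> M) * of_bool ({(i', k'), (j', l')} \<in> M))"
  unfolding adj_eq_half_edges[OF M ij(1,2)] adj_eq_half_edges[OF M ij(3,4)]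
  by (rule double_sum_times)

lemma avg_adj_pair:
  assumes ij: "i < n" "j < n" "i' < n" "j' < n" and ne: "{i, j} \<noteq> {i', j'}"
  shows "avg (\<lambda>M. adj M i j * adj M i' j')
    \<le> p\<^sup>2 * (real (\<delta> i) * real (\<delta> j) * real (\<delta> i') * real (\<delta> j'))"
proof -
  have d: "{(i, k), (j, l)} \<noteq> {(i', k'), (j', l')}" for k l k' l'
  proof
    assume "{(i, k), (j, l)} = {(i', k'), (j', l')}"
    then have "fst ` {(i, k), (j, l)} = fst ` {(i', k'), (j', l')}" by simp
    then show False using ne by simp
  qed
  have "avg (\<lambda>M. adj M i j * adj M i' j') = avg (\<lambda>M. \<Sum>k<\<delta> i. \<Sum>l<\<delta> j. \<Sum>k'<\<delta> i'. \<Sum>l'<\<delta> j'.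
      of_bool ({(i, k), (j, l)} \<in> M) * of_bool ({(i', k'), (j', l')} \<in> M))"
    by (rule avg_cong, rule adj_prod_half_edges) (use ij in auto)
  also have "\<dots> = (\<Sum>k<\<delta> i. \<Sum>l<\<delta> j. \<Sum>k'<\<delta> i'. \<Sum>l'<\<delta> j'.
      avg (\<lambda>M. of_bool ({(i, k), (j, l)} \<in> M) * of_bool ({(i', k'), (j', l')} \<in> M)))"
    by (simp only: avg_sum)
  also have "\<dots> \<le> (\<Sum>k<\<delta> i. \<Sum>l<\<delta> j. \<Sum>k'<\<delta> i'. \<Sum>l'<\<delta> j'. p\<^sup>2)"
    by (intro sum_mono avg_two_edges d)
  finally show ?thesis by (simp add: mult_ac)
qed

text \<open>
  The factor \<open>\<delta> i - 1\<close>, which the bound for two disjoint edges lacks, reflects that two different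
  edges need two different half-edges at \<open>i\<close>. It makes the sum over all paths sharp.
\<close>

lemma avg_adj_path:
  assumes ij: "i < n" "j < n" "j' < n" and ne: "j \<noteq> j'"
  shows "avg (\<lambda>M. adj M i j * adj M i j')
    \<le> p\<^sup>2 * (real (\<delta> i) * (real (\<delta> i) - 1) * real (\<delta> j) * real (\<delta> j'))"
proof -
  let ?a = "\<lambda>k l k' l'. avg (\<lambda>M. of_bool ({(i, k), (j, l)} \<in> M) * of_bool ({(i, k'), (j', l')} \<in> M))"
  have same: "?a k l k l' = 0" for k l l'
  proof -
    have "\<not> ({(i, k), (j, l)} \<in> M \<and> {(i, k), (j', l')} \<in> M)" if "M \<in> simple_matchings" for M
      using mate_unique[OF simple_matchings_PM[OF that]] ne by (metis prod.inject)
    then have "?a k l k l' = avg (\<lambda>M. 0)" by (intro avg_cong) auto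
    then show ?thesis by (simp add: avg_const nonempty)
  qed
  have other: "?a k l k' l' \<le> p\<^sup>2" for k l k' l'
  proof (rule avg_two_edges)
    show "{(i, k), (j, l)} \<noteq> {(i, k'), (j', l')}"
      using ne by (auto simp: doubleton_eq_iff)
  qed
  have "avg (\<lambda>M. adj M i j * adj M i j') = avg (\<lambda>M. \<Sum>k<\<delta> i. \<Sum>l<\<delta> j. \<Sum>k'<\<delta> i. \<Sum>l'<\<delta> j'.
      of_bool ({(i, k), (j, l)} \<in> M) * of_bool ({(i, k'), (j', l')} \<in> M))"
    by (rule avg_cong, rule adj_prod_half_edges) (use ij in auto)
  also have "\<dots> = (\<Sum>k<\<delta> i. \<Sum>l<\<delta> j. \<Sum>k'<\<delta> i. \<Sum>l'<\<delta> j'. ?a k l k' l')"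
    by (simp only: avg_sum)
  also have "\<dots> \<le> (\<Sum>k<\<delta> i. \<Sum>l<\<delta> j. \<Sum>k'<\<delta> i. \<Sum>l'<\<delta> j'. if k' = k then 0 else p\<^sup>2)"
    using same other by (intro sum_mono) auto
  also have "\<dots> = (\<Sum>k<\<delta> i. \<Sum>l<\<delta> j. (real (\<delta> i) - 1) * (real (\<delta> j') * p\<^sup>2))"
  proof (intro sum.cong refl)
    fix k l assume k: "k \<in> {..<\<delta> i}"
    have "(\<Sum>k'<\<delta> i. \<Sum>l'<\<delta> j'. if k' = k then 0 else p\<^sup>2)
        = (\<Sum>k'\<in>{..<\<delta> i} - {k}. real (\<delta> j') * p\<^sup>2)"
      using k by (subst sum.remove[of _ k]) auto
    also have "\<dots> = (real (\<delta> i) - 1) * (real (\<delta> j') * p\<^sup>2)" using k by (simp add: of_nat_diff)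
    finally show "(\<Sum>k'<\<delta> i. \<Sum>l'<\<delta> j'. if k' = k then 0 else p\<^sup>2)
      = (real (\<delta> i) - 1) * (real (\<delta> j') * p\<^sup>2)" .
  qed
  finally show ?thesis by (simp add: mult_ac)
qed

lemma sum_avg_adj: "(\<Sum>i<n. \<Sum>j<n. avg (\<lambda>M. adj M i j)) = msum 1"
proof -
  have "(\<Sum>i<n. \<Sum>j<n. avg (\<lambda>M. adj M i j)) = avg (\<lambda>M. \<Sum>i<n. \<Sum>j<n. adj M i j)"
    by (simp only: avg_sum)
  also have "\<dots> = avg (\<lambda>M. msum 1)"
    by (rule avg_cong) (simp add: adj_row_sum msum_def)
  finally show ?thesis by (simp add: avg_const nonempty)
qed

lemma double_sum_prod:
  "(\<Sum>t\<in>{..<n} \<times> {..<n}. c * (f (fst t) * g (snd t))) = c * ((\<Sum>i<n. f i) * (\<Sum>j<n. g j :: real))"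
proof -
  have "(\<Sum>i<n. \<Sum>j<n. c * (f i * g j)) = (\<Sum>t\<in>{..<n} \<times> {..<n}. c * (f (fst t) * g (snd t)))"
    by (simp only: sum.cartesian_product split_def)
  moreover have "c * ((\<Sum>i<n. f i) * (\<Sum>j<n. g j)) = (\<Sum>i<n. \<Sum>j<n. c * (f i * g j))"
    unfolding sum_product by (simp only: sum_distrib_left)
  ultimately show ?thesis by simp
qed

lemma avg_weighted_adj:
  assumes w: "\<And>i j. i < n \<Longrightarrow> j < n \<Longrightarrow> 0 \<le> f i * g j" "\<And>i j. i < n \<Longrightarrow> j < n \<Longrightarrow> f i * g j \<le> W"
  defines "S \<equiv> p * ((\<Sum>i<n. real (\<delta> i) * f i) * (\<Sum>j<n. real (\<delta> j) * g j))"
  shows "avg (\<lambda>M. \<Sum>i<n. \<Sum>j<n. adj M i j * (f i * g j)) \<le> S"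
    and "S - W * (p * (msum 1)\<^sup>2 - msum 1) \<le> avg (\<lambda>M. \<Sum>i<n. \<Sum>j<n. adj M i j * (f i * g j))"
proof -
  let ?I = "{..<n} \<times> {..<n}"
  define a where "a t = avg (\<lambda>M. adj M (fst t) (snd t))" for t
  define b where "b t = p * (real (\<delta> (fst t)) * real (\<delta> (snd t)))" for t
  define w where "w t = f (fst t) * g (snd t)" for t
  have "avg (\<lambda>M. \<Sum>i<n. \<Sum>j<n. adj M i j * (f i * g j)) = (\<Sum>i<n. \<Sum>j<n. avg (\<lambda>M. adj M i j) * (f i * g j))"
    by (simp add: avg_sum avg_scale mult.commute[of "adj _ _ _"] mult.commute[of "avg _"])
  then have A: "avg (\<lambda>M. \<Sum>i<n. \<Sum>j<n. adj M i j * (f i * g j)) = (\<Sum>t\<in>?I. a t * w t)"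
    by (simp add: sum.cartesian_product a_def w_def split_def)
  have B: "(\<Sum>t\<in>?I. b t * w t) = S"
  proof -
    have "(\<Sum>t\<in>?I. b t * w t) = (\<Sum>t\<in>?I. p * ((real (\<delta> (fst t)) * f (fst t)) * (real (\<delta> (snd t)) * g (snd t))))"
      by (simp add: b_def w_def mult_ac)
    then show ?thesis unfolding S_def by (subst (asm) double_sum_prod)
  qed
  have B1: "(\<Sum>t\<in>?I. b t) = p * (msum 1)\<^sup>2"
    unfolding b_def by (subst double_sum_prod) (simp add: msum_def power2_eq_square)
  have A1: "(\<Sum>t\<in>?I. a t) = msum 1"
    using sum_avg_adj by (simp add: sum.cartesian_product a_def split_def)
  have ab: "a t \<le> b t" "0 \<le> w t" "w t \<le> W" if "t \<in> ?I" for t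
    using that w avg_adj by (auto simp: a_def b_def w_def)
  show "avg (\<lambda>M. \<Sum>i<n. \<Sum>j<n. adj M i j * (f i * g j)) \<le> S"
    unfolding A B[symmetric] by (rule weighted_sum_squeeze(1)[of _ _ _ _ W]) (use ab in auto)
  show "S - W * (p * (msum 1)\<^sup>2 - msum 1) \<le> avg (\<lambda>M. \<Sum>i<n. \<Sum>j<n. adj M i j * (f i * g j))"
    using weighted_sum_squeeze(2)[of ?I a b w, OF ab] unfolding A B B1 A1 .
qed

text \<open>
  The probabilities of all paths of length two sum to \<open>m\<^sub>2 - m\<^sub>1\<close>, since every vertex \<open>i\<close> is the
  middle of exactly \<open>\<delta> i (\<delta> i - 1)\<close> ordered paths.
\<close>

lemma avg_weighted_paths:
  defines "S \<equiv> p\<^sup>2 * ((msum 2 - msum 1) * (msum 2 * msum 2))"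
  shows "avg (\<lambda>M. \<Sum>i<n. \<Sum>j<n. \<Sum>k<n. (if j = k then 0 else adj M i j * adj M i k) * (real (\<delta> j) * real (\<delta> k))) \<le> S"
    and "S - (real D)\<^sup>2 * (p\<^sup>2 * ((msum 2 - msum 1) * (msum 1)\<^sup>2) - (msum 2 - msum 1))
      \<le> avg (\<lambda>M. \<Sum>i<n. \<Sum>j<n. \<Sum>k<n. (if j = k then 0 else adj M i j * adj M i k) * (real (\<delta> j) * real (\<delta> k)))"
proof -
  let ?I = "{..<n} \<times> ({..<n} \<times> {..<n})"
  let ?P = "\<lambda>M i j k. if j = k then 0 else adj M i j * adj M i k"
  define a where "a t = avg (\<lambda>M. ?P M (fst t) (fst (snd t)) (snd (snd t)))" for t
  define b where "b t = p\<^sup>2 * ((real (\<delta> (fst t)) * (real (\<delta> (fst t)) - 1)) * (real (\<delta> (fst (snd t))) * real (\<delta> (snd (snd t)))))" for t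
  define w where "w t = real (\<delta> (fst (snd t))) * real (\<delta> (snd (snd t)))" for t :: "nat \<times> nat \<times> nat"
  have m21: "(\<Sum>i<n. real (\<delta> i) * (real (\<delta> i) - 1)) = msum 2 - msum 1"
    by (simp add: msum_def sum_subtractf[symmetric] algebra_simps power2_eq_square)
  have triple: "(\<Sum>t\<in>?I. c * (f (fst t) * (g (fst (snd t)) * h (snd (snd t)))))
      = c * ((\<Sum>i<n. f i) * ((\<Sum>j<n. g j) * (\<Sum>k<n. h k :: real)))" for c f g h
  proof -
    have "(\<Sum>t\<in>?I. c * (f (fst t) * (g (fst (snd t)) * h (snd (snd t)))))
       = (\<Sum>i<n. \<Sum>j<n. \<Sum>k<n. c * (f i * (g j * h k)))"
      by (simp only: sum.cartesian_product split_def)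
    also have "\<dots> = (\<Sum>i<n. c * (f i * (\<Sum>j<n. \<Sum>k<n. g j * h k)))"
      by (simp only: sum_distrib_left)
    also have "\<dots> = c * ((\<Sum>i<n. f i) * (\<Sum>j<n. \<Sum>k<n. g j * h k))"
      by (simp only: sum_distrib_left[of c] sum_distrib_right)
    finally show ?thesis by (simp only: sum_product)
  qed
  have "avg (\<lambda>M. \<Sum>i<n. \<Sum>j<n. \<Sum>k<n. ?P M i j k * (real (\<delta> j) * real (\<delta> k)))
     = (\<Sum>i<n. \<Sum>j<n. \<Sum>k<n. avg (\<lambda>M. ?P M i j k) * (real (\<delta> j) * real (\<delta> k)))"
    unfolding avg_sum by (intro sum.cong refl) (subst mult.commute, simp only: avg_scale mult.commute)
  then have A: "avg (\<lambda>M. \<Sum>i<n. \<Sum>j<n. \<Sum>k<n. ?P M i j k * (real (\<delta> j) * real (\<delta> k))) = (\<Sum>t\<in>?I. a t * w t)"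
    by (simp add: sum.cartesian_product a_def w_def split_def)
  have B: "(\<Sum>t\<in>?I. b t * w t) = S"
  proof -
    have "(\<Sum>t\<in>?I. b t * w t) = (\<Sum>t\<in>?I. p\<^sup>2 * ((real (\<delta> (fst t)) * (real (\<delta> (fst t)) - 1)) *
         ((real (\<delta> (fst (snd t))))\<^sup>2 * (real (\<delta> (snd (snd t))))\<^sup>2)))"
      by (simp add: b_def w_def mult_ac power2_eq_square)
    also have "\<dots> = p\<^sup>2 * ((\<Sum>i<n. real (\<delta> i) * (real (\<delta> i) - 1)) * ((\<Sum>j<n. (real (\<delta> j))\<^sup>2) * (\<Sum>k<n. (real (\<delta> k))\<^sup>2)))"
      by (rule triple)
    finally show ?thesis unfolding S_def m21 by (simp add: msum_def)
  qed
  have B1: "(\<Sum>t\<in>?I. b t) = p\<^sup>2 * ((msum 2 - msum 1) * (msum 1)\<^sup>2)"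
    unfolding b_def by (subst triple) (simp only: m21, simp add: msum_def power2_eq_square)
  have "(\<Sum>t\<in>?I. a t) = avg (\<lambda>M. \<Sum>i<n. \<Sum>j<n. \<Sum>k<n. ?P M i j k)"
    by (simp add: avg_sum sum.cartesian_product a_def split_def)
  also have "\<dots> = avg (\<lambda>M. msum 2 - msum 1)"
  proof (rule avg_cong)
    fix M assume M: "M \<in> simple_matchings"
    have "(\<Sum>j<n. \<Sum>k<n. ?P M i j k) = (real (\<delta> i))\<^sup>2 - real (\<delta> i)" if i: "i < n" for i
    proof -
      have "(\<Sum>k<n. ?P M i j k) = adj M i j * real (\<delta> i) - adj M i j" if j: "j < n" for j
      proof -
        have "(\<Sum>k<n. ?P M i j k) = (\<Sum>k<n. adj M i j * adj M i k - (if k = j then adj M i j * adj M i j else 0))"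
          by (rule sum.cong) auto
        also have "\<dots> = adj M i j * real (\<delta> i) - adj M i j * adj M i j"
          using j by (simp add: sum_subtractf sum_distrib_left[symmetric] adj_row_sum[OF M i] sum.delta)
        also have "adj M i j * adj M i j = adj M i j" using adj_cases[OF M i j] by auto
        finally show ?thesis .
      qed
      then have "(\<Sum>j<n. \<Sum>k<n. ?P M i j k) = (\<Sum>j<n. adj M i j * real (\<delta> i) - adj M i j)" by simp
      then show ?thesis
        by (simp add: sum_subtractf sum_distrib_right[symmetric] adj_row_sum[OF M i] power2_eq_square)
    qed
    then show "(\<Sum>i<n. \<Sum>j<n. \<Sum>k<n. ?P M i j k) = msum 2 - msum 1"
      by (simp add: msum_def sum_subtractf)
  qed
  finally have A1: "(\<Sum>t\<in>?I. a t) = msum 2 - msum 1" by (simp add: avg_const nonempty)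
  have ab: "a t \<le> b t" "0 \<le> w t" "w t \<le> (real D)\<^sup>2" if tI: "t \<in> ?I" for t
  proof -
    obtain i j k where t: "t = (i, j, k)" "i < n" "j < n" "k < n" using tI by auto
    show "a t \<le> b t"
    proof (cases "j = k")
      case True
      have "real (\<delta> i) * (real (\<delta> i) - 1) \<ge> 0" by (cases "\<delta> i") auto
      then show ?thesis using True t by (simp add: a_def b_def avg_const nonempty)
    next
      case False
      then show ?thesis using avg_adj_path[of i j k] t by (simp add: a_def b_def mult.assoc)
    qed
    show "0 \<le> w t" by (simp add: w_def)
    show "w t \<le> (real D)\<^sup>2"
      using t deg_le_real unfolding w_def power2_eq_square by (intro mult_mono) auto
  qed
  show "avg (\<lambda>M. \<Sum>i<n. \<Sum>j<n. \<Sum>k<n. ?P M i j k * (real (\<delta> j) * real (\<delta> k))) \<le> S"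
    unfolding A B[symmetric] by (rule weighted_sum_squeeze(1)[of _ _ _ _ "(real D)\<^sup>2"]) (use ab in auto)
  show "S - (real D)\<^sup>2 * (p\<^sup>2 * ((msum 2 - msum 1) * (msum 1)\<^sup>2) - (msum 2 - msum 1))
      \<le> avg (\<lambda>M. \<Sum>i<n. \<Sum>j<n. \<Sum>k<n. ?P M i j k * (real (\<delta> j) * real (\<delta> k)))"
    using weighted_sum_squeeze(2)[of ?I a b w, OF ab] unfolding A B B1 A1 .
qed

definition quad :: "(nat \<times> nat) set set \<Rightarrow> real" where
  "quad M = (\<Sum>i<n. \<Sum>j<n. adj M i j * (real (\<delta> i) * real (\<delta> j)))"

definition adj_deg :: "(nat \<times> nat) set set \<Rightarrow> nat \<Rightarrow> real" where
  "adj_deg M i = (\<Sum>j<n. adj M i j * real (\<delta> j))"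

lemma avg_quad:
  "avg quad \<le> p * (msum 2)\<^sup>2"
  "p * (msum 2)\<^sup>2 - (real D)\<^sup>2 * (p * (msum 1)\<^sup>2 - msum 1) \<le> avg quad"
proof -
  have w: "0 \<le> real (\<delta> i) * real (\<delta> j)" "real (\<delta> i) * real (\<delta> j) \<le> (real D)\<^sup>2" if "i < n" "j < n" for i j
    using that deg_le_real unfolding power2_eq_square by (auto intro!: mult_mono)
  have s: "(\<Sum>i<n. real (\<delta> i) * real (\<delta> i)) = msum 2" by (simp add: msum_def power2_eq_square)
  have q: "avg quad = avg (\<lambda>M. \<Sum>i<n. \<Sum>j<n. adj M i j * (real (\<delta> i) * real (\<delta> j)))"
    unfolding quad_def ..
  note A = avg_weighted_adj[of "\<lambda>i. real (\<delta> i)" "\<lambda>i. real (\<delta> i)" "(real D)\<^sup>2", OF w]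
  show "avg quad \<le> p * (msum 2)\<^sup>2" using A(1) by (simp add: q s power2_eq_square)
  show "p * (msum 2)\<^sup>2 - (real D)\<^sup>2 * (p * (msum 1)\<^sup>2 - msum 1) \<le> avg quad"
    using A(2) unfolding q s by (simp add: power2_eq_square)
qed

lemma avg_adj_deg_square:
  defines "e1 \<equiv> p * (msum 1)\<^sup>2 - msum 1"
    and "e2 \<equiv> p\<^sup>2 * ((msum 2 - msum 1) * (msum 1)\<^sup>2) - (msum 2 - msum 1)"
    and "S \<equiv> p * (msum 1 * msum 3) + p\<^sup>2 * ((msum 2 - msum 1) * (msum 2 * msum 2))"
  shows "avg (\<lambda>M. \<Sum>i<n. (adj_deg M i)\<^sup>2) \<le> S"
    and "S - (real D)\<^sup>2 * (e1 + e2) \<le> avg (\<lambda>M. \<Sum>i<n. (adj_deg M i)\<^sup>2)"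
proof -
  let ?P = "\<lambda>M i j k. if j = k then 0 else adj M i j * adj M i k"
  have "(\<Sum>i<n. (adj_deg M i)\<^sup>2) = (\<Sum>i<n. \<Sum>j<n. adj M i j * (1 * (real (\<delta> j))\<^sup>2))
      + (\<Sum>i<n. \<Sum>j<n. \<Sum>k<n. ?P M i j k * (real (\<delta> j) * real (\<delta> k)))" if M: "M \<in> simple_matchings" for M
  proof -
    have "(adj_deg M i)\<^sup>2 = (\<Sum>j<n. adj M i j * (1 * (real (\<delta> j))\<^sup>2) + (\<Sum>k<n. ?P M i j k * (real (\<delta> j) * real (\<delta> k))))"
      if i: "i < n" for i
    proof -
      have "(\<Sum>k<n. (adj M i j * real (\<delta> j)) * (adj M i k * real (\<delta> k)))
          = adj M i j * (1 * (real (\<delta> j))\<^sup>2) + (\<Sum>k<n. ?P M i j k * (real (\<delta> j) * real (\<delta> k)))" if j: "j < n" for j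
      proof -
        have sq: "adj M i j * adj M i j = adj M i j" using adj_cases[OF M i j] by auto
        have "(adj M i j * real (\<delta> j)) * (adj M i k * real (\<delta> k))
           = (if k = j then (adj M i j * adj M i j) * (real (\<delta> j))\<^sup>2 else 0) + ?P M i j k * (real (\<delta> j) * real (\<delta> k))" for k
          by (simp add: power2_eq_square mult_ac)
        then show ?thesis using j by (simp add: sum.distrib sum.delta sq)
      qed
      then show ?thesis by (simp add: adj_deg_def power2_eq_square sum_product)
    qed
    then show ?thesis by (simp add: sum.distrib)
  qed
  then have eq: "avg (\<lambda>M. \<Sum>i<n. (adj_deg M i)\<^sup>2)
      = avg (\<lambda>M. \<Sum>i<n. \<Sum>j<n. adj M i j * (1 * (real (\<delta> j))\<^sup>2))
      + avg (\<lambda>M. \<Sum>i<n. \<Sum>j<n. \<Sum>k<n. ?P M i j k * (real (\<delta> j) * real (\<delta> k)))"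
    unfolding avg_add[symmetric] by (rule avg_cong)
  have s: "(\<Sum>i<n. real (\<delta> i) * 1) = msum 1" "(\<Sum>j<n. real (\<delta> j) * (real (\<delta> j))\<^sup>2) = msum 3"
    by (simp_all add: msum_def power2_eq_square power3_eq_cube mult_ac)
  let ?W1 = "\<lambda>M. \<Sum>i<n. \<Sum>j<n. adj M i j * (1 * (real (\<delta> j))\<^sup>2)"
  have w: "\<forall>i<n. \<forall>j<n. 0 \<le> 1 * (real (\<delta> j))\<^sup>2 \<and> 1 * (real (\<delta> j))\<^sup>2 \<le> (real D)\<^sup>2"
    using deg_le_real by (auto intro!: power_mono)
  have A: "avg ?W1 \<le> p * (msum 1 * msum 3)"
    "p * (msum 1 * msum 3) - (real D)\<^sup>2 * (p * (msum 1)\<^sup>2 - msum 1) \<le> avg ?W1"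
    using w avg_weighted_adj[of "\<lambda>i. 1" "\<lambda>j. (real (\<delta> j))\<^sup>2" "(real D)\<^sup>2", unfolded s] by blast+
  note B = avg_weighted_paths
  show "avg (\<lambda>M. \<Sum>i<n. (adj_deg M i)\<^sup>2) \<le> S" unfolding eq S_def using A(1) B(1) by linarith
  show "S - (real D)\<^sup>2 * (e1 + e2) \<le> avg (\<lambda>M. \<Sum>i<n. (adj_deg M i)\<^sup>2)"
    unfolding eq S_def e1_def e2_def using A(2) B(2) by (simp add: algebra_simps)
qed

text \<open>
  Two different edges contribute at most the product of the bounds for each of them. The only other
  contribution comes from an edge paired with itself, in one of the two orientations.
\<close>

lemma avg_quad_square: "avg (\<lambda>M. (quad M)\<^sup>2) \<le> p\<^sup>2 * (msum 2) ^ 4 + 2 * (real D) ^ 4 * msum 1"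
proof -
  let ?I = "{..<n} \<times> {..<n}"
  define d where "d t = real (\<delta> (fst t)) * real (\<delta> (snd t))" for t :: "nat \<times> nat"
  define a where "a M t = adj M (fst t) (snd t)" for M t
  have d0: "0 \<le> d t" for t by (simp add: d_def)
  have dD: "d t \<le> (real D)\<^sup>2" if "t \<in> ?I" for t
    using that deg_le_real unfolding d_def power2_eq_square by (intro mult_mono) auto
  have quad: "quad M = (\<Sum>t\<in>?I. a M t * d t)" for M
    by (simp add: quad_def sum.cartesian_product a_def d_def split_def)
  have sumd2: "(\<Sum>t\<in>?I. (d t)\<^sup>2) = (msum 2)\<^sup>2"
  proof -
    have "(d t)\<^sup>2 = 1 * ((real (\<delta> (fst t)))\<^sup>2 * (real (\<delta> (snd t)))\<^sup>2)" for t
      by (simp add: d_def power_mult_distrib)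
    then have "(\<Sum>t\<in>?I. (d t)\<^sup>2) = (\<Sum>t\<in>?I. 1 * ((real (\<delta> (fst t)))\<^sup>2 * (real (\<delta> (snd t)))\<^sup>2))"
      by (simp only:)
    also have "\<dots> = 1 * ((\<Sum>i<n. (real (\<delta> i))\<^sup>2) * (\<Sum>i<n. (real (\<delta> i))\<^sup>2))"
      by (rule double_sum_prod)
    finally show ?thesis by (simp add: msum_def power2_eq_square)
  qed
  let ?R = "\<lambda>t u. u = t \<or> u = prod.swap t"
  have pair_le: "avg (\<lambda>M. a M t * a M u) * (d t * d u)
      \<le> p\<^sup>2 * ((d t)\<^sup>2 * (d u)\<^sup>2) + (if ?R t u then avg (\<lambda>M. a M t) * (real D) ^ 4 else 0)"
    if t: "t \<in> ?I" and u: "u \<in> ?I" for t u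
  proof (cases "?R t u")
    case True
    have "a M t * a M u = a M t" if "M \<in> simple_matchings" for M
      using adj_cases[OF that, of "fst t" "snd t"] t True adj_commute[of M "fst t" "snd t"] by (auto simp: a_def)
    then have "avg (\<lambda>M. a M t * a M u) = avg (\<lambda>M. a M t)" by (rule avg_cong)
    moreover have "d t * d u \<le> (real D) ^ 4"
      using mult_mono[OF dD[OF t] dD[OF u]] d0 by (simp add: power2_eq_square power4_eq_xxxx)
    moreover have "avg (\<lambda>M. a M t) \<ge> 0" by (rule avg_nonneg) (simp add: a_def)
    ultimately have "avg (\<lambda>M. a M t * a M u) * (d t * d u) \<le> avg (\<lambda>M. a M t) * (real D) ^ 4"
      by (simp add: mult_left_mono)
    then show ?thesis using True by (simp add: add_increasing)
  next
    case False
    have "{fst t, snd t} \<noteq> {fst u, snd u}"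
      using False by (auto simp: doubleton_eq_iff prod_eq_iff)
    then have "avg (\<lambda>M. a M t * a M u) \<le> p\<^sup>2 * (d t * d u)"
      using avg_adj_pair[of "fst t" "snd t" "fst u" "snd u"] t u by (auto simp: a_def d_def mult.assoc)
    then have "avg (\<lambda>M. a M t * a M u) * (d t * d u) \<le> p\<^sup>2 * (d t * d u) * (d t * d u)"
      by (rule mult_right_mono) (simp add: d0)
    then show ?thesis using False by (simp add: power2_eq_square mult_ac)
  qed
  have "avg (\<lambda>M. (quad M)\<^sup>2) = avg (\<lambda>M. \<Sum>t\<in>?I. \<Sum>u\<in>?I. (d t * d u) * (a M t * a M u))"
    unfolding quad power2_eq_square sum_product by (simp add: mult_ac)
  also have "\<dots> = (\<Sum>t\<in>?I. \<Sum>u\<in>?I. avg (\<lambda>M. a M t * a M u) * (d t * d u))"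
    by (simp only: avg_sum avg_scale mult.commute)
  also have "\<dots> \<le> (\<Sum>t\<in>?I. \<Sum>u\<in>?I. p\<^sup>2 * ((d t)\<^sup>2 * (d u)\<^sup>2) + (if ?R t u then avg (\<lambda>M. a M t) * (real D) ^ 4 else 0))"
    by (intro sum_mono pair_le)
  also have "\<dots> = p\<^sup>2 * ((msum 2)\<^sup>2 * (msum 2)\<^sup>2)
      + (\<Sum>t\<in>?I. \<Sum>u\<in>?I. if ?R t u then avg (\<lambda>M. a M t) * (real D) ^ 4 else 0)"
    by (simp only: sum.distrib sum_distrib_left[symmetric] sum_distrib_right[symmetric] sumd2)
  also have "(\<Sum>t\<in>?I. \<Sum>u\<in>?I. if ?R t u then avg (\<lambda>M. a M t) * (real D) ^ 4 else 0)
      \<le> (\<Sum>t\<in>?I. 2 * (avg (\<lambda>M. a M t) * (real D) ^ 4))"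
  proof (rule sum_mono)
    fix t assume "t \<in> ?I"
    have nn: "avg (\<lambda>M. a M t) * (real D) ^ 4 \<ge> 0"
      by (intro mult_nonneg_nonneg avg_nonneg) (auto simp: a_def)
    have "(\<Sum>u\<in>?I. if ?R t u then avg (\<lambda>M. a M t) * (real D) ^ 4 else 0)
        = real (card {u \<in> ?I. ?R t u}) * (avg (\<lambda>M. a M t) * (real D) ^ 4)"
      by (simp add: sum.If_cases Int_def)
    also have "\<dots> \<le> 2 * (avg (\<lambda>M. a M t) * (real D) ^ 4)"
    proof (rule mult_right_mono[OF _ nn])
      have "card {u \<in> ?I. ?R t u} \<le> card {t, prod.swap t}" by (rule card_mono) auto
      also have "\<dots> \<le> 2" by (simp add: card_insert_if)
      finally show "real (card {u \<in> ?I. ?R t u}) \<le> 2" by simp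
    qed
    finally show "(\<Sum>u\<in>?I. if ?R t u then avg (\<lambda>M. a M t) * (real D) ^ 4 else 0)
       \<le> 2 * (avg (\<lambda>M. a M t) * (real D) ^ 4)" .
  qed
  also have "(\<Sum>t\<in>?I. 2 * (avg (\<lambda>M. a M t) * (real D) ^ 4)) = 2 * (real D) ^ 4 * msum 1"
  proof -
    have "(\<Sum>t\<in>?I. avg (\<lambda>M. a M t)) = msum 1"
      using sum_avg_adj by (simp add: sum.cartesian_product a_def split_def)
    then show ?thesis by (simp add: sum_distrib_left[symmetric] sum_distrib_right[symmetric] mult_ac)
  qed
  finally show ?thesis by (simp add: power2_eq_square power4_eq_xxxx)
qed

end

section \<open>Discrepancy of the random graph\<close>

text \<open>
  The exponential series of \<open>k\<close> contains the term \<open>k\<^sup>k / k!\<close>, and \<open>exp 1 \<le> 3\<close>.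
\<close>

lemma power_self_le_fact: "real k ^ k \<le> 3 ^ k * fact k"
proof -
  have "real k ^ k /\<^sub>R fact k \<le> exp (real k)"
    using sum_le_suminf[OF sums_summable[OF exp_converges[of "real k"]], of "{k}"]
      sums_unique[OF exp_converges[of "real k"]] by auto
  also have "exp (real k) = exp 1 ^ k" by (simp add: exp_of_nat_mult[symmetric])
  also have "\<dots> \<le> 3 ^ k" by (rule power_mono[OF exp_le]) simp
  finally show ?thesis by (simp add: field_simps)
qed

lemma binomial_le_three_power:
  assumes "k \<ge> 1"
  shows "real (N choose k) \<le> (3 * real N / real k) ^ k"
proof -
  have "real (N choose k) * fact k = real ((N choose k) * fact k)" by simp
  also have "\<dots> \<le> real (N ^ k)" using binomial_fact_pow of_nat_le_iff by blast
  finally have c: "real (N choose k) * fact k \<le> real N ^ k" by simp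
  have "real (N choose k) * real k ^ k \<le> real (N choose k) * (3 ^ k * fact k)"
    by (rule mult_left_mono[OF power_self_le_fact]) simp
  also have "\<dots> = 3 ^ k * (real (N choose k) * fact k)" by simp
  also have "\<dots> \<le> 3 ^ k * real N ^ k" using c by (rule mult_left_mono) simp
  finally have "real (N choose k) * real k ^ k \<le> 3 ^ k * real N ^ k" .
  then show ?thesis using assms by (simp add: power_divide power_mult_distrib pos_le_divide_eq)
qed

lemma power_le_binomial_fact:
  assumes "k \<le> y" shows "(y - k) ^ k \<le> (y choose k) * fact k"
proof -
  have "fact m * m ^ k \<le> (fact (m + k) :: nat)" for m
  proof (induction k)
    case (Suc k)
    have "fact m * m ^ Suc k = (fact m * m ^ k) * m" by (simp add: mult_ac)
    also have "\<dots> \<le> fact (m + k) * Suc (m + k)" using Suc by (intro mult_le_mono) auto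
    finally show ?case by (simp add: mult_ac)
  qed simp
  from this[of "y - k"] have "fact (y - k) * (y - k) ^ k \<le> (fact y :: nat)" using assms by simp
  also have "fact y = fact (y - k) * ((y choose k) * fact k)"
    using binomial_fact_lemma[OF assms] by (simp add: mult_ac)
  finally show ?thesis by simp
qed

lemma geometric_sum_le:
  fixes Q :: real
  assumes "0 \<le> Q" "Q \<le> 1 / 2"
  shows "(\<Sum>w=1..n. Q ^ w) \<le> 2 * Q"
proof -
  have "(\<Sum>w=1..n. Q ^ w) \<le> 2 * Q * (1 - (1 / 2) ^ n)"
  proof (induction n)
    case (Suc n)
    have "Q ^ n \<le> (1 / 2) ^ n" using assms by (intro power_mono) auto
    then have "Q ^ Suc n \<le> Q * (1 / 2) ^ n" using assms by (simp add: mult_left_mono)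
    then show ?case using Suc by (simp add: algebra_simps)
  qed simp
  also have "\<dots> \<le> 2 * Q * 1" using assms by (intro mult_left_mono) auto
  finally show ?thesis by simp
qed

text \<open>
  Restricting to increasing pairs avoids counting an edge inside \<open>S \<inter> T\<close> twice within one set of
  pairs: it occurs once in each of the two sums.
\<close>

lemma sum_rectangle_split:
  fixes f :: "nat \<Rightarrow> nat \<Rightarrow> real"
  assumes fin: "finite S" "finite T" and sym: "\<And>i j. f i j = f j i"
  shows "(\<Sum>i\<in>S. \<Sum>j\<in>T. f i j) = (\<Sum>t\<in>{t \<in> S \<times> T. fst t < snd t}. f (fst t) (snd t))
    + (\<Sum>t\<in>{t \<in> T \<times> S. fst t < snd t}. f (fst t) (snd t)) + (\<Sum>i\<in>S \<inter> T. f i i)"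
proof -
  let ?g = "\<lambda>t. f (fst t) (snd t)"
  let ?A = "{t \<in> S \<times> T. fst t < snd t}" and ?B = "{t \<in> S \<times> T. snd t < fst t}" and ?C = "{t \<in> S \<times> T. fst t = snd t}"
  have fS: "finite (S \<times> T)" using fin by simp
  have "(\<Sum>i\<in>S. \<Sum>j\<in>T. f i j) = sum ?g (S \<times> T)" by (simp add: sum.cartesian_product split_def)
  also have "S \<times> T = ?A \<union> (?B \<union> ?C)" by auto
  also have "sum ?g (?A \<union> (?B \<union> ?C)) = sum ?g ?A + (sum ?g ?B + sum ?g ?C)"
    using fS by (subst sum.union_disjoint, auto) (subst sum.union_disjoint, auto)
  also have "sum ?g ?B = sum ?g {t \<in> T \<times> S. fst t < snd t}"
    by (rule sum.reindex_bij_witness[of _ prod.swap prod.swap]) (auto simp: sym)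
  also have "sum ?g ?C = (\<Sum>i\<in>S \<inter> T. f i i)"
    by (rule sum.reindex_bij_witness[of _ "\<lambda>i. (i, i)" fst]) auto
  finally show ?thesis by simp
qed

context bounded_degrees begin

lemma avg_union_bound:
  assumes "finite X"
  shows "avg (\<lambda>M. of_bool (\<exists>x\<in>X. P x M)) \<le> (\<Sum>x\<in>X. avg (\<lambda>M. of_bool (P x M)))"
proof -
  have "avg (\<lambda>M. of_bool (\<exists>x\<in>X. P x M)) \<le> avg (\<lambda>M. \<Sum>x\<in>X. of_bool (P x M))"
  proof (rule avg_mono)
    fix M
    show "of_bool (\<exists>x\<in>X. P x M) \<le> (\<Sum>x\<in>X. of_bool (P x M) :: real)"
    proof (cases "\<exists>x\<in>X. P x M")
      case True
      then obtain x where x: "x \<in> X" "P x M" by blast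
      have "of_bool (P x M) \<le> (\<Sum>x\<in>X. of_bool (P x M) :: real)"
        by (rule member_le_sum) (use x assms in auto)
      then show ?thesis using x True by simp
    qed (simp add: sum_nonneg)
  qed
  then show ?thesis by (simp only: avg_sum)
qed

lemma avg_of_bool_mono:
  "(\<And>M. M \<in> simple_matchings \<Longrightarrow> P M \<Longrightarrow> Q M) \<Longrightarrow> avg (\<lambda>M. of_bool (P M)) \<le> avg (\<lambda>M. of_bool (Q M))"
  by (rule avg_mono) auto

text \<open>
  A matching that contains at least \<open>y\<close> pairs of \<open>P\<close> contains at least \<open>y choose k\<close> subsets of \<open>P\<close>
  with \<open>k\<close> elements, and the expected number of these subsets is bounded by \<open>avg_containing\<close>.
\<close>

lemma matching_tail:
  assumes P: "finite P" and k: "2 * k + 2 * ((D + 1) * D) < card H"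
  shows "avg (\<lambda>M. of_bool (y \<le> card (M \<inter> P))) * real (y choose k)
    \<le> real (card P choose k) * edge_bound k ^ k"
proof -
  let ?F = "{F. F \<subseteq> P \<and> card F = k}"
  have "avg (\<lambda>M. of_bool (y \<le> card (M \<inter> P))) * real (y choose k)
      = avg (\<lambda>M. real (y choose k) * of_bool (y \<le> card (M \<inter> P)))"
    by (simp add: avg_scale)
  also have "\<dots> \<le> avg (\<lambda>M. \<Sum>F\<in>?F. of_bool (F \<subseteq> M))"
  proof (rule avg_mono)
    fix M
    have "(\<Sum>F\<in>?F. of_bool (F \<subseteq> M) :: real) = real (card {F. F \<subseteq> M \<inter> P \<and> card F = k})"
    proof -
      have "?F \<inter> {F. F \<subseteq> M} = {F. F \<subseteq> M \<inter> P \<and> card F = k}" by auto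
      then show ?thesis using P by (simp add: of_bool_def sum.If_cases)
    qed
    also have "\<dots> = real (card (M \<inter> P) choose k)" using P n_subsets[of "M \<inter> P" k] by simp
    finally have "(\<Sum>F\<in>?F. of_bool (F \<subseteq> M)) = real (card (M \<inter> P) choose k)" .
    then show "real (y choose k) * of_bool (y \<le> card (M \<inter> P)) \<le> (\<Sum>F\<in>?F. of_bool (F \<subseteq> M))"
      by (auto intro: binomial_right_mono)
  qed
  also have "\<dots> = (\<Sum>F\<in>?F. avg (\<lambda>M. of_bool (F \<subseteq> M)))" by (rule avg_sum)
  also have "\<dots> \<le> (\<Sum>F\<in>?F. edge_bound k ^ k)"
  proof (rule sum_mono)
    fix F assume "F \<in> ?F"
    then show "avg (\<lambda>M. of_bool (F \<subseteq> M)) \<le> edge_bound k ^ k"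
      using avg_containing[OF k, of F] P finite_subset by auto
  qed
  also have "\<dots> = real (card P choose k) * edge_bound k ^ k" using P by (simp add: n_subsets)
  finally show ?thesis .
qed

definition half_edge_pairs :: "(nat \<times> nat) set \<Rightarrow> (nat \<times> nat) set set" where
  "half_edge_pairs E = (\<lambda>(t, k, l). {(fst t, k), (snd t, l)}) ` (SIGMA t:E. {..<\<delta> (fst t)} \<times> {..<\<delta> (snd t)})"

definition pair_vol :: "(nat \<times> nat) set \<Rightarrow> real" where
  "pair_vol E = (\<Sum>t\<in>E. real (\<delta> (fst t)) * real (\<delta> (snd t)))"

lemma card_half_edge_pairs:
  assumes "finite E"
  shows "finite (half_edge_pairs E)" "real (card (half_edge_pairs E)) \<le> pair_vol E"
proof -
  have f: "finite (SIGMA t:E. {..<\<delta> (fst t)} \<times> {..<\<delta> (snd t)})" using assms by auto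
  then show "finite (half_edge_pairs E)" by (simp add: half_edge_pairs_def)
  have "card (half_edge_pairs E) \<le> card (SIGMA t:E. {..<\<delta> (fst t)} \<times> {..<\<delta> (snd t)})"
    unfolding half_edge_pairs_def by (rule card_image_le[OF f])
  also have "\<dots> = (\<Sum>t\<in>E. \<delta> (fst t) * \<delta> (snd t))" using assms by simp
  finally have "real (card (half_edge_pairs E)) \<le> real (\<Sum>t\<in>E. \<delta> (fst t) * \<delta> (snd t))" by (rule of_nat_mono)
  then show "real (card (half_edge_pairs E)) \<le> pair_vol E" by (simp add: pair_vol_def)
qed

definition ordered_pairs :: "(nat \<times> nat) set" where
  "ordered_pairs = {t \<in> {..<n} \<times> {..<n}. fst t < snd t}"

lemma adj_sum_le_card:
  assumes M: "M \<in> simple_matchings" and E: "E \<subseteq> ordered_pairs"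
  shows "(\<Sum>t\<in>E. adj M (fst t) (snd t)) \<le> real (card (M \<inter> half_edge_pairs E))"
proof -
  note PM = simple_matchings_PM[OF M]
  have finM: "finite M" by (rule finite_perfect_matching[OF finite_H PM])
  have finE: "finite E" by (rule finite_subset[OF E]) (simp add: ordered_pairs_def)
  let ?A = "\<lambda>t. {e \<in> M. \<exists>k l. e = {(fst t, k), (snd t, l)}}"
  have "(\<Sum>t\<in>E. card (?A t)) = card (\<Union>t\<in>E. ?A t)"
  proof (rule card_UN_disjoint[symmetric])
    show "\<forall>t\<in>E. \<forall>u\<in>E. t \<noteq> u \<longrightarrow> ?A t \<inter> ?A u = {}"
    proof (intro ballI impI equals0I)
      fix t u e assume t: "t \<in> E" and u: "u \<in> E" and ne: "t \<noteq> u" and e: "e \<in> ?A t \<inter> ?A u"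
      have lt: "fst t < snd t" "fst u < snd u" using E t u by (auto simp: ordered_pairs_def)
      from e have "fst ` e = {fst t, snd t}" "fst ` e = {fst u, snd u}" by auto
      then have "{fst t, snd t} = {fst u, snd u}" by simp
      then show False using lt ne by (auto simp: doubleton_eq_iff prod_eq_iff)
    qed
  qed (use finE finM in auto)
  also have "\<dots> \<le> card (M \<inter> half_edge_pairs E)"
  proof (rule card_mono)
    show "(\<Union>t\<in>E. ?A t) \<subseteq> M \<inter> half_edge_pairs E"
    proof
      fix e assume "e \<in> (\<Union>t\<in>E. ?A t)"
      then obtain t k l where t: "t \<in> E" "e \<in> M" "e = {(fst t, k), (snd t, l)}" by blast
      then have "(fst t, k) \<in> H" "(snd t, l) \<in> H" using perfect_matchingD(1)[OF PM] by blast+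
      then have "k < \<delta> (fst t)" "l < \<delta> (snd t)" by (auto simp: half_edges_def)
      then have "e \<in> half_edge_pairs E"
        unfolding half_edge_pairs_def using t by (intro image_eqI[of _ _ "(t, k, l)"]) auto
      then show "e \<in> M \<inter> half_edge_pairs E" using t by blast
    qed
  qed (use finM in simp)
  finally have "real (\<Sum>t\<in>E. card (?A t)) \<le> real (card (M \<inter> half_edge_pairs E))" by (rule of_nat_mono)
  then show ?thesis by (simp add: adj_def edge_count_def)
qed

lemma pair_vol_ordered:
  assumes E: "E \<subseteq> ordered_pairs"
  shows "pair_vol E \<le> (msum 1)\<^sup>2 / 2"
proof -
  let ?g = "\<lambda>t. real (\<delta> (fst t)) * real (\<delta> (snd t))"
  have finE: "finite E" by (rule finite_subset[OF E]) (simp add: ordered_pairs_def)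
  have "t \<notin> prod.swap ` E" if "t \<in> E" for t
  proof
    assume "t \<in> prod.swap ` E"
    then obtain u where u: "u \<in> E" "t = prod.swap u" by blast
    have "fst t < snd t" "fst u < snd u" using E u(1) that by (auto simp: ordered_pairs_def)
    then show False using u(2) by simp
  qed
  then have "E \<inter> prod.swap ` E = {}" by blast
  then have "sum ?g E + sum ?g (prod.swap ` E) = sum ?g (E \<union> prod.swap ` E)"
    using finE by (intro sum.union_disjoint[symmetric]) auto
  also have "\<dots> \<le> sum ?g ({..<n} \<times> {..<n})"
    by (rule sum_mono2) (use E in \<open>auto simp: ordered_pairs_def\<close>)
  also have "\<dots> = (msum 1)\<^sup>2"
  proof -
    have "(\<Sum>i<n. \<Sum>j<n. real (\<delta> i) * real (\<delta> j)) = sum ?g ({..<n} \<times> {..<n})"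
      by (simp only: sum.cartesian_product split_def)
    then show ?thesis by (simp add: msum_def power2_eq_square sum_product)
  qed
  also have "sum ?g (prod.swap ` E) = sum ?g E"
    by (subst sum.reindex) (auto simp: mult.commute)
  finally show ?thesis by (simp add: pair_vol_def)
qed

lemma edge_bound_nonneg: "2 * k + 2 * ((D + 1) * D) < card H \<Longrightarrow> edge_bound k > 0"
  using of_nat_less_iff[where 'a = real, of "2 * k + 2 * ((D + 1) * D)" "card H"]
  by (simp add: edge_bound_def algebra_simps)

text \<open>
  If the sum exceeds \<open>\<epsilon> D |W|\<close>, then at least \<open>k = \<lceil>\<epsilon> D |W| / 2\<rceil>\<close> pairs of half-edges over \<open>W\<close> are
  matched. There are at most \<open>(D |W|)\<^sup>2\<close> such pairs, each matched with probability at most of order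
  \<open>1 / (n D)\<close>, so the probability is at most the \<open>k\<close>-th power of a multiple of \<open>|W| / (\<epsilon> n)\<close>.
\<close>

lemma dense_set_rare:
  fixes \<epsilon> \<theta> :: real
  assumes \<epsilon>: "0 < \<epsilon>" "\<epsilon> \<le> 1" and \<theta>: "1 \<le> \<theta>" and D: "1 \<le> D"
    and m1: "real n * real D \<le> \<theta> * msum 1"
    and sparse: "2 + 2 * real ((D + 1) * D) \<le> real n * real D / (4 * \<theta>)"
    and r: "real r \<le> \<epsilon> * real D / 2"
    and W: "W \<subseteq> {..<n}" "W \<noteq> {}" "real (card W) \<le> \<epsilon> * real n / (24 * \<theta>)"
  shows "avg (\<lambda>M. of_bool (\<epsilon> * real D * real (card W) < (\<Sum>i\<in>W. \<Sum>j\<in>W. adj M i j)))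
    \<le> (12 * \<theta> * real (card W) / (\<epsilon> * real n)) ^ (r * card W)"
proof -
  define w where "w = real (card W)"
  define E where "E = {t \<in> W \<times> W. fst t < snd t}"
  define P where "P = half_edge_pairs E"
  define k where "k = nat \<lceil>\<epsilon> * real D * w / 2\<rceil>"
  define y where "y = 12 * \<theta> * w / (\<epsilon> * real n)"
  have finW: "finite W" using W(1) finite_subset by blast
  have w1: "w \<ge> 1" using W(2) finW by (simp add: w_def Suc_le_eq card_gt_0_iff)
  have n0: "real n > 0" using W(1,2) by auto
  have D0: "real D \<ge> 1" using D by simp
  have x0: "\<epsilon> * real D * w / 2 > 0" using \<epsilon> D0 w1 by simp
  have kx: "\<epsilon> * real D * w / 2 \<le> real k" "real k \<le> \<epsilon> * real D * w / 2 + 1"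
    using x0 unfolding k_def by linarith+
  have k1: "k \<ge> 1" using kx(1) x0 by linarith
  have m1pos: "msum 1 > 0"
  proof -
    have "0 < real n * real D" using n0 D0 by simp
    then have "0 < \<theta> * msum 1" using m1 by linarith
    then show ?thesis using \<theta> by (simp add: zero_less_mult_iff)
  qed
  have half: "2 * real k + 2 * real ((D + 1) * D) \<le> msum 1 / 2"
  proof -
    have "\<epsilon> * real D * w \<le> 1 * real D * (\<epsilon> * real n / (24 * \<theta>))"
      using \<epsilon> D0 W(3) w1 by (intro mult_mono) (auto simp: w_def)
    also have "\<dots> = real D * (\<epsilon> * real n / (24 * \<theta>))" by simp
    also have "\<dots> \<le> real D * (1 * real n / (24 * \<theta>))"
      using \<epsilon> \<theta> by (intro mult_left_mono divide_right_mono mult_right_mono) auto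
    also have "\<dots> \<le> real n * real D / (4 * \<theta>)"
      using \<theta> n0 D0 by (simp add: field_simps)
    finally have "2 * real k + 2 * real ((D + 1) * D) \<le> real n * real D / (4 * \<theta>) + real n * real D / (4 * \<theta>)"
      using kx(2) sparse by linarith
    also have "\<dots> = real n * real D / \<theta> / 2" using \<theta> by (simp add: field_simps)
    also have "\<dots> \<le> msum 1 / 2" using m1 \<theta> by (intro divide_right_mono) (auto simp: pos_divide_le_eq mult.commute)
    finally show ?thesis .
  qed
  have kH: "2 * k + 2 * ((D + 1) * D) < card H"
  proof -
    have "real (2 * k + 2 * ((D + 1) * D)) < real (card H)"
      using half m1pos unfolding card_H by simp
    then show ?thesis by (simp only: of_nat_less_iff)
  qed
  have eb0: "edge_bound k > 0" by (rule edge_bound_nonneg[OF kH])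
  have eb: "edge_bound k \<le> 2 * \<theta> / (real n * real D)"
  proof -
    have "edge_bound k \<le> 1 / (msum 1 / 2)"
      unfolding edge_bound_def card_H using half m1pos by (intro divide_left_mono) auto
    also have "\<dots> \<le> 2 * \<theta> / (real n * real D)"
      using m1 m1pos n0 D0 by (simp add: field_simps)
    finally show ?thesis .
  qed
  have finE: "finite E" using finW by (simp add: E_def)
  have P: "finite P" "real (card P) \<le> w\<^sup>2 * (real D)\<^sup>2"
  proof -
    show "finite P" unfolding P_def by (rule card_half_edge_pairs(1)[OF finE])
    have "real (card P) \<le> pair_vol E" unfolding P_def by (rule card_half_edge_pairs(2)[OF finE])
    also have "\<dots> \<le> (\<Sum>t\<in>E. (real D)\<^sup>2)"
      unfolding pair_vol_def power2_eq_square
      by (intro sum_mono mult_mono deg_le_real) (use W(1) in \<open>auto simp: E_def\<close>)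
    also have "\<dots> = real (card E) * (real D)\<^sup>2" by simp
    also have "\<dots> \<le> w\<^sup>2 * (real D)\<^sup>2"
    proof (rule mult_right_mono)
      have "card E \<le> card (W \<times> W)" unfolding E_def using finW by (intro card_mono) auto
      then have "real (card E) \<le> real (card (W \<times> W))" by (rule of_nat_mono)
      then show "real (card E) \<le> w\<^sup>2" by (simp add: w_def card_cartesian_product power2_eq_square)
    qed simp
    finally show "real (card P) \<le> w\<^sup>2 * (real D)\<^sup>2" .
  qed
  have "avg (\<lambda>M. of_bool (\<epsilon> * real D * w < (\<Sum>i\<in>W. \<Sum>j\<in>W. adj M i j)))
      \<le> avg (\<lambda>M. of_bool (k \<le> card (M \<inter> P)))"
  proof (rule avg_of_bool_mono)
    fix M assume M: "M \<in> simple_matchings" and gt: "\<epsilon> * real D * w < (\<Sum>i\<in>W. \<Sum>j\<in>W. adj M i j)"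
    have diag: "(\<Sum>i\<in>W \<inter> W. adj M i i) = 0"
      using M W(1) by (intro sum.neutral) (auto simp: adj_def simple_matchings_def simple_matching_def)
    have "(\<Sum>i\<in>W. \<Sum>j\<in>W. adj M i j) = 2 * (\<Sum>t\<in>E. adj M (fst t) (snd t))"
      using sum_rectangle_split[OF finW finW, of "adj M"] adj_commute diag by (simp add: E_def)
    also have "\<dots> \<le> 2 * real (card (M \<inter> P))"
      unfolding P_def using adj_sum_le_card[OF M, of E] W(1) by (auto simp: E_def ordered_pairs_def)
    finally have "\<epsilon> * real D * w / 2 < real (card (M \<inter> P))" using gt by linarith
    then show "k \<le> card (M \<inter> P)" unfolding k_def by linarith
  qed
  also have "\<dots> \<le> real (card P choose k) * edge_bound k ^ k"
    using matching_tail[OF P(1) kH, of k] by simp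
  also have "\<dots> \<le> (3 * real (card P) / real k) ^ k * edge_bound k ^ k"
    using eb0 by (intro mult_right_mono binomial_le_three_power[OF k1]) auto
  also have "\<dots> = (3 * real (card P) / real k * edge_bound k) ^ k" by (rule power_mult_distrib[symmetric])
  also have "\<dots> \<le> y ^ k"
  proof (rule power_mono)
    have "3 * real (card P) / real k * edge_bound k
        \<le> 3 * (w\<^sup>2 * (real D)\<^sup>2) / (\<epsilon> * real D * w / 2) * (2 * \<theta> / (real n * real D))"
      using P(2) kx(1) eb eb0 x0 by (intro mult_mono frac_le) auto
    also have "\<dots> = y" using n0 D0 w1 \<epsilon> by (simp add: y_def field_simps power2_eq_square)
    finally show "3 * real (card P) / real k * edge_bound k \<le> y" .
  qed (use eb0 in simp)
  also have "\<dots> \<le> y ^ (r * card W)"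
  proof (rule power_decreasing)
    have "real r * w \<le> \<epsilon> * real D / 2 * w" using r w1 by (intro mult_right_mono) auto
    then have "real (r * card W) \<le> real k" using kx(1) by (simp add: w_def)
    then show "r * card W \<le> k" by (simp only: of_nat_le_iff)
    show "0 \<le> y" using \<theta> w1 \<epsilon> n0 by (simp add: y_def)
    have "24 * (\<theta> * w) \<le> \<epsilon> * real n" using W(3) \<theta> by (simp add: w_def field_simps)
    moreover have "0 \<le> \<theta> * w" using \<theta> w1 by simp
    ultimately have "12 * \<theta> * w \<le> \<epsilon> * real n" by linarith
    then show "y \<le> 1" using \<epsilon> n0 by (simp add: y_def pos_divide_le_eq)
  qed
  finally show ?thesis by (simp add: w_def y_def)
qed

text \<open>
  The number of sets of size \<open>w\<close> is at most \<open>(3 n / w)\<^sup>w\<close>, and \<open>dense_set_rare\<close> contributes the power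
  \<open>r w\<close> of a multiple of \<open>w / n\<close>. One factor \<open>w / n\<close> per vertex absorbs the number of sets; the other
  \<open>r - 1\<close> factors are at most \<open>1 / 2\<close> each and make the sum over \<open>w\<close> geometric.
\<close>

lemma dense_sets_rare:
  fixes \<epsilon> \<theta> :: real
  assumes \<epsilon>: "0 < \<epsilon>" "\<epsilon> \<le> 1" and \<theta>: "1 \<le> \<theta>" and D: "1 \<le> D"
    and m1: "real n * real D \<le> \<theta> * msum 1"
    and sparse: "2 + 2 * real ((D + 1) * D) \<le> real n * real D / (4 * \<theta>)"
    and r: "1 \<le> r" "real r \<le> \<epsilon> * real D / 2"
    and Q: "Q = 36 * \<theta> / \<epsilon> * (1 / 2) ^ (r - 1)" "Q \<le> 1 / 2"
  shows "avg (\<lambda>M. of_bool (\<exists>W\<subseteq>{..<n}. W \<noteq> {} \<and> real (card W) \<le> \<epsilon> * real n / (24 * \<theta>) \<and>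
      \<epsilon> * real D * real (card W) < (\<Sum>i\<in>W. \<Sum>j\<in>W. adj M i j))) \<le> 2 * Q"
proof -
  define X where "X = {W. W \<subseteq> {..<n} \<and> W \<noteq> {} \<and> real (card W) \<le> \<epsilon> * real n / (24 * \<theta>)}"
  have finX: "finite X" by (rule finite_subset[of _ "Pow {..<n}"]) (auto simp: X_def)
  define y where "y w = 12 * \<theta> * real w / (\<epsilon> * real n)" for w :: nat
  have "avg (\<lambda>M. of_bool (\<exists>W\<subseteq>{..<n}. W \<noteq> {} \<and> real (card W) \<le> \<epsilon> * real n / (24 * \<theta>) \<and>
      \<epsilon> * real D * real (card W) < (\<Sum>i\<in>W. \<Sum>j\<in>W. adj M i j)))
     = avg (\<lambda>M. of_bool (\<exists>W\<in>X. \<epsilon> * real D * real (card W) < (\<Sum>i\<in>W. \<Sum>j\<in>W. adj M i j)))"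
    by (rule avg_cong) (auto simp: X_def)
  also have "\<dots> \<le> (\<Sum>W\<in>X. avg (\<lambda>M. of_bool (\<epsilon> * real D * real (card W) < (\<Sum>i\<in>W. \<Sum>j\<in>W. adj M i j))))"
    by (rule avg_union_bound[OF finX])
  also have "\<dots> \<le> (\<Sum>W\<in>X. y (card W) ^ (r * card W))"
    unfolding y_def by (intro sum_mono dense_set_rare[OF \<epsilon> \<theta> D m1 sparse r(2)]) (auto simp: X_def)
  also have "\<dots> = (\<Sum>w\<in>{1..n}. \<Sum>W\<in>{W\<in>X. card W = w}. y (card W) ^ (r * card W))"
  proof (rule sum.group[symmetric])
    show "card ` X \<subseteq> {1..n}"
    proof
      fix w assume "w \<in> card ` X"
      then obtain W where W: "W \<in> X" "w = card W" by blast
      then have "W \<subseteq> {..<n}" "W \<noteq> {}" "finite W" by (auto simp: X_def intro: finite_subset)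
      then show "w \<in> {1..n}" using W card_mono[of "{..<n}" W] by (auto simp: Suc_le_eq card_gt_0_iff)
    qed
  qed (use finX in auto)
  also have "\<dots> \<le> (\<Sum>w\<in>{1..n}. Q ^ w)"
  proof (rule sum_mono)
    fix w assume w: "w \<in> {1..n}"
    have n0: "real n > 0" using w by auto
    show "(\<Sum>W\<in>{W\<in>X. card W = w}. y (card W) ^ (r * card W)) \<le> Q ^ w"
    proof (cases "real w \<le> \<epsilon> * real n / (24 * \<theta>)")
      case False
      then have "{W\<in>X. card W = w} = {}" by (auto simp: X_def)
      moreover have "0 \<le> Q ^ w" using \<theta> \<epsilon> unfolding Q(1) by simp
      ultimately show ?thesis by (simp only: sum.empty)
    next
      case True
      have y0: "y w > 0" using w \<theta> \<epsilon> n0 by (simp add: y_def)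
      have yh: "y w \<le> 1 / 2"
      proof -
        have "24 * \<theta> * real w \<le> \<epsilon> * real n" using True \<theta> by (simp add: field_simps)
        then show ?thesis using \<epsilon> n0 by (simp add: y_def pos_divide_le_eq)
      qed
      have "(\<Sum>W\<in>{W\<in>X. card W = w}. y (card W) ^ (r * card W)) = real (card {W\<in>X. card W = w}) * y w ^ (r * w)"
        by simp
      also have "\<dots> \<le> real (n choose w) * y w ^ (r * w)"
      proof (rule mult_right_mono)
        have "card {W\<in>X. card W = w} \<le> card {W. W \<subseteq> {..<n} \<and> card W = w}"
          by (rule card_mono) (auto simp: X_def)
        then show "real (card {W\<in>X. card W = w}) \<le> real (n choose w)" by (simp add: n_subsets)
      qed (use y0 in simp)
      also have "\<dots> \<le> (3 * real n / real w) ^ w * y w ^ (r * w)"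
        using w y0 by (intro mult_right_mono binomial_le_three_power) auto
      also have "\<dots> = (3 * real n / real w * y w ^ r) ^ w" by (simp only: power_mult power_mult_distrib)
      also have "\<dots> \<le> Q ^ w"
      proof (rule power_mono)
        have "y w ^ r = y w * y w ^ (r - 1)" using r(1) by (metis Suc_diff_1 less_eq_Suc_le power_Suc One_nat_def)
        then have "3 * real n / real w * y w ^ r = (3 * real n / real w * y w) * y w ^ (r - 1)" by simp
        also have "3 * real n / real w * y w = 36 * \<theta> / \<epsilon>" using n0 w by (simp add: y_def)
        also have "36 * \<theta> / \<epsilon> * y w ^ (r - 1) \<le> Q"
          unfolding Q(1) using y0 yh \<theta> \<epsilon> by (intro mult_left_mono power_mono) auto
        finally show "3 * real n / real w * y w ^ r \<le> Q" .
      qed (use y0 in simp)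
      finally show ?thesis .
    qed
  qed
  also have "\<dots> \<le> 2 * Q" by (rule geometric_sum_le) (use Q \<theta> \<epsilon> in auto)
  finally show ?thesis .
qed

text \<open>
  The pairs in \<open>E\<close> carry about \<open>pair_vol E / m\<^sub>1\<close> edges on average. To see a surplus of \<open>\<epsilon> m\<^sub>1\<close>, take
  subsets of size \<open>k \<approx> \<epsilon> m\<^sub>1 / 4\<close> in \<open>matching_tail\<close>: this is small enough that \<open>edge_bound k\<close> is still
  close to \<open>1 / m\<^sub>1\<close>, and the ratio of the binomial coefficients beats it by a factor
  \<open>1 + \<epsilon> / 16\<close> in each of the \<open>k\<close> steps.
\<close>

lemma pair_set_tail:
  fixes \<epsilon> :: real
  assumes \<epsilon>: "0 < \<epsilon>" "\<epsilon> \<le> 1" and m1pos: "msum 1 > 0"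
    and sparse: "2 * real ((D + 1) * D) \<le> \<epsilon> * msum 1 / 16"
    and E: "E \<subseteq> ordered_pairs" and k: "k = nat \<lfloor>\<epsilon> * msum 1 / 4\<rfloor>"
  shows "avg (\<lambda>M. of_bool (pair_vol E / msum 1 + \<epsilon> * msum 1 \<le> (\<Sum>t\<in>E. adj M (fst t) (snd t))))
    \<le> (1 / (1 + \<epsilon> / 16)) ^ k"
proof -
  define m where "m = msum 1"
  define V where "V = pair_vol E"
  define P where "P = half_edge_pairs E"
  define y where "y = nat \<lceil>V / m + \<epsilon> * m\<rceil>"
  define Y where "Y = V / m + 3 / 4 * \<epsilon> * m"
  let ?p = "avg (\<lambda>M. of_bool (V / m + \<epsilon> * m \<le> (\<Sum>t\<in>E. adj M (fst t) (snd t))))"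
  have m0: "m > 0" using m1pos by (simp add: m_def)
  have finE: "finite E" by (rule finite_subset[OF E]) (simp add: ordered_pairs_def)
  have V0: "V \<ge> 0" by (simp add: V_def pair_vol_def sum_nonneg)
  have V1: "V \<le> m\<^sup>2 / 2" unfolding V_def m_def by (rule pair_vol_ordered[OF E])
  have Vm: "V / m \<ge> 0" using V0 m0 by simp
  have em: "\<epsilon> * m > 0" using \<epsilon> m0 by simp
  have kx: "real k \<le> \<epsilon> * m / 4" using em unfolding k m_def[symmetric] by linarith
  have yx: "V / m + \<epsilon> * m \<le> real y" unfolding y_def by linarith
  have Y: "Y > 0" "Y \<le> real y - real k"
    using kx yx em Vm unfolding Y_def by linarith+
  have ky: "k \<le> y" using Y by linarith
  have den: "m * (1 - 9 / 16 * \<epsilon>) \<le> m - 2 * real k - 2 * real ((D + 1) * D)"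
    using kx sparse unfolding m_def[symmetric] by (simp add: algebra_simps)
  have "m * (1 - 9 / 16 * \<epsilon>) > 0" using m0 \<epsilon> by simp
  then have den0: "m - 2 * real k - 2 * real ((D + 1) * D) > 0" using den by linarith
  have kH: "2 * k + 2 * ((D + 1) * D) < card H"
  proof -
    have "real (2 * k + 2 * ((D + 1) * D)) < real (card H)" using den0 unfolding card_H m_def by simp
    then show ?thesis by (simp only: of_nat_less_iff)
  qed
  have q0: "edge_bound k > 0" by (rule edge_bound_nonneg[OF kH])
  have q1: "edge_bound k \<le> 1 / (m * (1 - 9 / 16 * \<epsilon>))"
    unfolding edge_bound_def card_H m_def[symmetric]
    using den den0 \<open>m * (1 - 9 / 16 * \<epsilon>) > 0\<close> by (intro divide_left_mono) auto
  have P: "finite P" "real (card P) \<le> V"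
    unfolding P_def V_def by (rule card_half_edge_pairs[OF finE])+
  have p0: "?p \<ge> 0" by (rule avg_nonneg) simp
  have pp: "?p \<le> avg (\<lambda>M. of_bool (y \<le> card (M \<inter> P)))"
  proof (rule avg_of_bool_mono)
    fix M assume M: "M \<in> simple_matchings" and a: "V / m + \<epsilon> * m \<le> (\<Sum>t\<in>E. adj M (fst t) (snd t))"
    then have "V / m + \<epsilon> * m \<le> real (card (M \<inter> P))"
      using adj_sum_le_card[OF M E] unfolding P_def by linarith
    then show "y \<le> card (M \<inter> P)" unfolding y_def by linarith
  qed
  have "?p * Y ^ k \<le> ?p * real ((y choose k) * fact k)"
  proof (rule mult_left_mono[OF _ p0])
    have "Y ^ k \<le> (real y - real k) ^ k" using Y by (intro power_mono) auto
    also have "\<dots> = real ((y - k) ^ k)" using ky by (simp add: of_nat_diff)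
    also have "\<dots> \<le> real ((y choose k) * fact k)" using power_le_binomial_fact[OF ky] by (rule of_nat_mono)
    finally show "Y ^ k \<le> real ((y choose k) * fact k)" .
  qed
  also have "\<dots> \<le> (avg (\<lambda>M. of_bool (y \<le> card (M \<inter> P))) * real (y choose k)) * fact k"
    using mult_right_mono[OF pp, of "real (y choose k) * fact k"] by (simp add: mult_ac)
  also have "\<dots> \<le> (real (card P choose k) * edge_bound k ^ k) * fact k"
    by (intro mult_right_mono matching_tail[OF P(1) kH]) simp
  also have "\<dots> = real ((card P choose k) * fact k) * edge_bound k ^ k" by simp
  also have "\<dots> \<le> real (card P ^ k) * edge_bound k ^ k"
    using q0 binomial_fact_pow by (intro mult_right_mono of_nat_mono) auto
  also have "\<dots> = (real (card P) * edge_bound k) ^ k" by (simp add: power_mult_distrib)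
  also have "\<dots> \<le> (V * (1 / (m * (1 - 9 / 16 * \<epsilon>)))) ^ k"
    using P q0 q1 V0 by (intro power_mono mult_mono) auto
  finally have "?p \<le> (V * (1 / (m * (1 - 9 / 16 * \<epsilon>)))) ^ k / Y ^ k"
    using Y by (simp add: pos_le_divide_eq)
  also have "\<dots> = (V * (1 / (m * (1 - 9 / 16 * \<epsilon>))) / Y) ^ k" by (rule power_divide[symmetric])
  also have "\<dots> \<le> (1 / (1 + \<epsilon> / 16)) ^ k"
  proof (rule power_mono)
    have Y3: "V * (1 + 3 / 2 * \<epsilon>) \<le> m * Y"
    proof -
      have "3 / 2 * \<epsilon> * V \<le> 3 / 2 * \<epsilon> * (m\<^sup>2 / 2)" using V1 \<epsilon> by (intro mult_left_mono) auto
      then show ?thesis using m0 by (simp add: Y_def algebra_simps power2_eq_square)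
    qed
    have c: "1 + \<epsilon> / 16 \<le> (1 + 3 / 2 * \<epsilon>) * (1 - 9 / 16 * \<epsilon>)"
    proof -
      have "\<epsilon> * \<epsilon> \<le> \<epsilon> * 1" using \<epsilon> by (intro mult_left_mono) auto
      moreover have "(1 + 3 / 2 * \<epsilon>) * (1 - 9 / 16 * \<epsilon>) = 1 + 15 / 16 * \<epsilon> - 27 / 32 * (\<epsilon> * \<epsilon>)"
        by (simp add: field_simps)
      ultimately show ?thesis using \<epsilon>(1) by linarith
    qed
    have "V * (1 + \<epsilon> / 16) \<le> V * ((1 + 3 / 2 * \<epsilon>) * (1 - 9 / 16 * \<epsilon>))"
      by (rule mult_left_mono[OF c V0])
    also have "\<dots> \<le> m * Y * (1 - 9 / 16 * \<epsilon>)"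
      using mult_right_mono[OF Y3, of "1 - 9 / 16 * \<epsilon>"] \<epsilon> by (simp add: mult_ac)
    finally have le: "V * (1 + \<epsilon> / 16) \<le> m * (1 - 9 / 16 * \<epsilon>) * Y" by (simp add: mult_ac)
    have "V * (1 / (m * (1 - 9 / 16 * \<epsilon>))) / Y = V / (m * (1 - 9 / 16 * \<epsilon>) * Y)" by simp
    also have "\<dots> \<le> 1 / (1 + \<epsilon> / 16)"
      using le Y \<open>m * (1 - 9 / 16 * \<epsilon>) > 0\<close> \<epsilon> by (subst divide_le_eq, simp) (simp add: pos_le_divide_eq mult.commute)
    finally show "V * (1 / (m * (1 - 9 / 16 * \<epsilon>))) / Y \<le> 1 / (1 + \<epsilon> / 16)" .
  qed (use V0 Y m0 \<epsilon> in simp)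
  finally show ?thesis by (simp add: V_def m_def)
qed

definition centred :: "(nat \<times> nat) set set \<Rightarrow> nat \<Rightarrow> nat \<Rightarrow> real" where
  "centred M i j = adj M i j - real (\<delta> i) * real (\<delta> j) / msum 1"

lemma centred_commute: "centred M i j = centred M j i"
  by (simp add: centred_def adj_commute[of M i j] mult.commute)

text \<open>
  A union bound over all \<open>4\<^sup>n\<close> pairs of vertex sets. The tail in \<open>pair_set_tail\<close> has an exponent of
  order \<open>m\<^sub>1\<close>, which exceeds any multiple of \<open>n\<close> when the degrees are large.
\<close>

lemma large_discrepancy_rare:
  fixes \<epsilon> :: real
  assumes \<epsilon>: "0 < \<epsilon>" "\<epsilon> \<le> 1" and m1pos: "msum 1 > 0"
    and sparse: "2 * real ((D + 1) * D) \<le> \<epsilon> * msum 1 / 16"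
    and k: "k = nat \<lfloor>\<epsilon> * msum 1 / 4\<rfloor>"
  shows "avg (\<lambda>M. of_bool (\<exists>S\<subseteq>{..<n}. \<exists>T\<subseteq>{..<n}. 2 * \<epsilon> * msum 1 < (\<Sum>i\<in>S. \<Sum>j\<in>T. centred M i j)))
    \<le> 4 ^ n * (1 / (1 + \<epsilon> / 16)) ^ k"
proof -
  let ?X = "Pow {..<n} \<times> Pow {..<n}"
  define E where "E X = {t \<in> fst X \<times> snd X. fst t < snd t}" for X :: "nat set \<times> nat set"
  define ev where "ev F M \<longleftrightarrow> pair_vol F / msum 1 + \<epsilon> * msum 1 \<le> (\<Sum>t\<in>F. adj M (fst t) (snd t))" for F M
  have "avg (\<lambda>M. of_bool (\<exists>S\<subseteq>{..<n}. \<exists>T\<subseteq>{..<n}. 2 * \<epsilon> * msum 1 < (\<Sum>i\<in>S. \<Sum>j\<in>T. centred M i j)))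
     \<le> avg (\<lambda>M. of_bool (\<exists>X\<in>?X. ev (E X) M))"
  proof (rule avg_of_bool_mono)
    fix M assume M: "M \<in> simple_matchings"
      and "\<exists>S\<subseteq>{..<n}. \<exists>T\<subseteq>{..<n}. 2 * \<epsilon> * msum 1 < (\<Sum>i\<in>S. \<Sum>j\<in>T. centred M i j)"
    then obtain S T where ST: "S \<subseteq> {..<n}" "T \<subseteq> {..<n}"
      and gt: "2 * \<epsilon> * msum 1 < (\<Sum>i\<in>S. \<Sum>j\<in>T. centred M i j)" by blast
    have fin: "finite S" "finite T" using ST finite_subset by blast+
    have diag: "(\<Sum>i\<in>S \<inter> T. centred M i i) \<le> 0"
    proof (rule sum_nonpos)
      fix i assume "i \<in> S \<inter> T"
      then have "adj M i i = 0" using M ST by (auto simp: adj_def simple_matchings_def simple_matching_def)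
      then show "centred M i i \<le> 0" using m1pos by (simp add: centred_def)
    qed
    have conv: "(\<Sum>t\<in>F. centred M (fst t) (snd t)) = (\<Sum>t\<in>F. adj M (fst t) (snd t)) - pair_vol F / msum 1" for F
      by (simp add: centred_def sum_subtractf pair_vol_def sum_divide_distrib)
    have "(\<Sum>i\<in>S. \<Sum>j\<in>T. centred M i j) = (\<Sum>t\<in>E (S, T). centred M (fst t) (snd t))
       + (\<Sum>t\<in>E (T, S). centred M (fst t) (snd t)) + (\<Sum>i\<in>S \<inter> T. centred M i i)"
      using sum_rectangle_split[OF fin, of "centred M"] centred_commute by (simp add: E_def)
    then have "ev (E (S, T)) M \<or> ev (E (T, S)) M"
      using gt diag unfolding conv ev_def by linarith
    then show "\<exists>X\<in>?X. ev (E X) M" using ST by blast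
  qed
  also have "\<dots> \<le> (\<Sum>X\<in>?X. avg (\<lambda>M. of_bool (ev (E X) M)))" by (rule avg_union_bound) simp
  also have "\<dots> \<le> (\<Sum>X\<in>?X. (1 / (1 + \<epsilon> / 16)) ^ k)"
    unfolding ev_def by (intro sum_mono pair_set_tail[OF \<epsilon> m1pos sparse _ k]) (auto simp: E_def ordered_pairs_def)
  also have "\<dots> = 4 ^ n * (1 / (1 + \<epsilon> / 16)) ^ k"
  proof -
    have "real (card ?X) = 4 ^ n"
      by (simp add: card_cartesian_product card_Pow power_mult_distrib[symmetric])
    then show ?thesis by simp
  qed
  finally show ?thesis .
qed

text \<open>
  Let \<open>\<kappa> = \<epsilon> / (24 \<theta>)\<close>. If \<open>S\<close> and \<open>T\<close> together have fewer than \<open>\<kappa> n\<close> elements, the upper bound follows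
  from the sparsity of small sets and the lower bound from the smallness of \<open>d d\<^sup>T / m\<^sub>1\<close> alone.
  Otherwise the absence of a large excess is the upper bound, and it gives the lower bound too: the
  rows of the centred matrix sum to \<open>0\<close> and \<open>T\<close> may be replaced by its complement.
\<close>

lemma discrepancy_if_no_excess:
  fixes \<epsilon> \<theta> :: real
  assumes \<epsilon>: "0 < \<epsilon>" "\<epsilon> \<le> 1" and \<theta>: "1 \<le> \<theta>" and D: "1 \<le> D" and n: "1 \<le> n"
    and m1: "real n * real D \<le> \<theta> * msum 1"
    and M: "M \<in> simple_matchings"
    and a: "\<not> (\<exists>W\<subseteq>{..<n}. W \<noteq> {} \<and> real (card W) \<le> \<epsilon> * real n / (24 * \<theta>) \<and>
      \<epsilon> * real D * real (card W) < (\<Sum>i\<in>W. \<Sum>j\<in>W. adj M i j))"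
    and b: "\<not> (\<exists>S\<subseteq>{..<n}. \<exists>T\<subseteq>{..<n}. 2 * (\<epsilon>\<^sup>2 / (48 * \<theta>)) * msum 1 < (\<Sum>i\<in>S. \<Sum>j\<in>T. centred M i j))"
    and ST: "S \<subseteq> {..<n}" "T \<subseteq> {..<n}"
  shows "\<bar>\<Sum>i\<in>S. \<Sum>j\<in>T. centred M i j\<bar> \<le> \<epsilon> * real D * (real (card S) + real (card T))"
proof -
  define \<kappa> where "\<kappa> = \<epsilon> / (24 * \<theta>)"
  have \<kappa>: "\<kappa> > 0" "\<theta> * \<kappa> \<le> \<epsilon>" using \<epsilon> \<theta> by (auto simp: \<kappa>_def)
  have fin: "finite S" "finite T" using ST finite_subset by blast+
  have n0: "real n > 0" and D0: "real D > 0" using n D by auto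
  have m1pos: "msum 1 > 0"
  proof -
    have "0 < real n * real D" using n0 D0 by simp
    then have "0 < \<theta> * msum 1" using m1 by linarith
    then show ?thesis using \<theta> by (simp add: zero_less_mult_iff)
  qed
  have m1D: "msum 1 \<le> real n * real D"
  proof -
    have "msum 1 \<le> (\<Sum>i<n. real D)" unfolding msum_def by (rule sum_mono) (use deg_le in auto)
    then show ?thesis by simp
  qed
  have big: "(\<Sum>i\<in>S'. \<Sum>j\<in>T'. centred M i j) \<le> \<epsilon> * real D * (real (card S) + real (card T))"
    if sub: "S' \<subseteq> {..<n}" "T' \<subseteq> {..<n}" and large: "\<kappa> * real n \<le> real (card S) + real (card T)" for S' T'
  proof -
    have "(\<Sum>i\<in>S'. \<Sum>j\<in>T'. centred M i j) \<le> 2 * (\<epsilon>\<^sup>2 / (48 * \<theta>)) * msum 1" using b sub by (meson not_le)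
    also have "\<dots> = \<epsilon> * \<kappa> * msum 1" by (simp add: \<kappa>_def power2_eq_square)
    also have "\<dots> \<le> \<epsilon> * \<kappa> * (real n * real D)" using m1D \<epsilon> \<kappa> by (intro mult_left_mono) auto
    also have "\<dots> = \<epsilon> * real D * (\<kappa> * real n)" by simp
    also have "\<dots> \<le> \<epsilon> * real D * (real (card S) + real (card T))"
      using large \<epsilon> by (intro mult_left_mono) auto
    finally show ?thesis .
  qed
  have upper: "(\<Sum>i\<in>S. \<Sum>j\<in>T. centred M i j) \<le> \<epsilon> * real D * (real (card S) + real (card T))"
  proof (cases "\<kappa> * real n \<le> real (card S) + real (card T)")
    case True
    then show ?thesis using big ST by blast
  next
    case False
    let ?W = "S \<union> T"
    have cW: "real (card ?W) \<le> real (card S) + real (card T)" using card_Un_le[of S T] by linarith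
    have "(\<Sum>i\<in>S. \<Sum>j\<in>T. centred M i j) \<le> (\<Sum>i\<in>S. \<Sum>j\<in>T. adj M i j)"
      using m1pos by (intro sum_mono) (simp add: centred_def)
    also have "\<dots> \<le> (\<Sum>i\<in>S. \<Sum>j\<in>?W. adj M i j)" using fin by (intro sum_mono sum_mono2) auto
    also have "\<dots> \<le> (\<Sum>i\<in>?W. \<Sum>j\<in>?W. adj M i j)" using fin by (intro sum_mono2 sum_nonneg) auto
    also have "\<dots> \<le> \<epsilon> * real D * real (card ?W)"
    proof (cases "?W = {}")
      case False
      have "real (card ?W) \<le> \<epsilon> * real n / (24 * \<theta>)"
        using cW \<open>\<not> \<kappa> * real n \<le> _\<close> by (simp add: \<kappa>_def)
      moreover have "?W \<subseteq> {..<n}" using ST by blast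
      ultimately show ?thesis using a False by (meson not_le)
    qed simp
    also have "\<dots> \<le> \<epsilon> * real D * (real (card S) + real (card T))"
      using cW \<epsilon> by (intro mult_left_mono) auto
    finally show ?thesis .
  qed
  have lower: "- (\<Sum>i\<in>S. \<Sum>j\<in>T. centred M i j) \<le> \<epsilon> * real D * (real (card S) + real (card T))"
  proof (cases "\<kappa> * real n \<le> real (card S) + real (card T)")
    case True
    have row: "(\<Sum>j<n. centred M i j) = 0" if "i < n" for i
    proof -
      have "(\<Sum>j<n. real (\<delta> i) * real (\<delta> j) / msum 1) = real (\<delta> i) * msum 1 / msum 1"
        by (simp add: msum_def sum_distrib_left sum_divide_distrib)
      then show ?thesis using adj_row_sum[OF M that] m1pos by (simp add: centred_def sum_subtractf)
    qed
    have "(\<Sum>i\<in>S. \<Sum>j\<in>{..<n} - T. centred M i j) = (\<Sum>i\<in>S. - (\<Sum>j\<in>T. centred M i j))"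
      using row ST by (intro sum.cong refl) (auto simp: sum_diff)
    then have "- (\<Sum>i\<in>S. \<Sum>j\<in>T. centred M i j) = (\<Sum>i\<in>S. \<Sum>j\<in>{..<n} - T. centred M i j)"
      by (simp add: sum_negf)
    then show ?thesis using big[OF ST(1), of "{..<n} - T"] True by auto
  next
    case False
    have "- (\<Sum>i\<in>S. \<Sum>j\<in>T. centred M i j) = (\<Sum>i\<in>S. \<Sum>j\<in>T. real (\<delta> i) * real (\<delta> j) / msum 1 - adj M i j)"
      by (simp add: centred_def sum_negf[symmetric])
    also have "\<dots> \<le> (\<Sum>i\<in>S. \<Sum>j\<in>T. real D * real D / msum 1)"
    proof (intro sum_mono)
      fix i j assume "i \<in> S" "j \<in> T"
      then have "real (\<delta> i) * real (\<delta> j) \<le> real D * real D"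
        using ST by (intro mult_mono deg_le_real) auto
      then have "real (\<delta> i) * real (\<delta> j) / msum 1 \<le> real D * real D / msum 1"
        using m1pos by (intro divide_right_mono) auto
      then show "real (\<delta> i) * real (\<delta> j) / msum 1 - adj M i j \<le> real D * real D / msum 1"
        using adj_nonneg[of M i j] by linarith
    qed
    also have "\<dots> = real (card S) * real (card T) * (real D * real D / msum 1)" by simp
    also have "\<dots> \<le> real (card S) * real (card T) * (\<theta> * real D / real n)"
    proof (rule mult_left_mono)
      have "real D * (real n * real D) \<le> real D * (\<theta> * msum 1)" using m1 by (intro mult_left_mono) auto
      then show "real D * real D / msum 1 \<le> \<theta> * real D / real n"
        using m1pos n0 by (simp add: field_simps)
    qed simp
    also have "\<dots> \<le> real (card S) * (\<kappa> * real n) * (\<theta> * real D / real n)"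
      using False \<theta> by (intro mult_right_mono mult_left_mono) auto
    also have "\<dots> = (\<theta> * \<kappa>) * real D * real (card S)" using n0 by simp
    also have "\<dots> \<le> \<epsilon> * real D * (real (card S) + real (card T))"
      using \<kappa> \<epsilon> by (intro mult_mono) auto
    finally show ?thesis .
  qed
  show ?thesis using upper lower by linarith
qed

end

section \<open>From discrepancy to a bound on a bilinear form\<close>

lemma weighted_sum_le_subset_sums:
  fixes c u :: "'a \<Rightarrow> real"
  assumes fin: "finite S" and bd: "\<And>S'. S' \<subseteq> S \<Longrightarrow> \<bar>\<Sum>i\<in>S'. c i\<bar> \<le> M"
    and u: "\<And>i. i \<in> S \<Longrightarrow> \<bar>u i\<bar> \<le> 1"
  shows "\<bar>\<Sum>i\<in>S. u i * c i\<bar> \<le> 2 * M"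
proof -
  have "\<bar>\<Sum>i\<in>S. u i * c i\<bar> \<le> (\<Sum>i\<in>S. \<bar>c i\<bar>)"
  proof (rule order_trans[OF sum_abs], rule sum_mono)
    fix i assume "i \<in> S"
    then show "\<bar>u i * c i\<bar> \<le> \<bar>c i\<bar>"
      using mult_right_mono[OF u, of i "\<bar>c i\<bar>"] by (simp add: abs_mult)
  qed
  also have "\<dots> = (\<Sum>i\<in>{i\<in>S. c i \<ge> 0}. \<bar>c i\<bar>) + (\<Sum>i\<in>S - {i\<in>S. c i \<ge> 0}. \<bar>c i\<bar>)"
    by (subst sum.subset_diff[of "{i\<in>S. c i \<ge> 0}" S]) (auto simp: fin)
  also have "(\<Sum>i\<in>{i\<in>S. c i \<ge> 0}. \<bar>c i\<bar>) = (\<Sum>i\<in>{i\<in>S. c i \<ge> 0}. c i)"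
    by (rule sum.cong) auto
  also have "(\<Sum>i\<in>S - {i\<in>S. c i \<ge> 0}. \<bar>c i\<bar>) = - (\<Sum>i\<in>S - {i\<in>S. c i \<ge> 0}. c i)"
    unfolding sum_negf[symmetric] by (rule sum.cong) auto
  finally show ?thesis
    using bd[of "{i\<in>S. c i \<ge> 0}"] bd[of "S - {i\<in>S. c i \<ge> 0}"] by force
qed

text \<open>
  A bilinear form on a product of cubes is extremal at vertices of the cubes. The factor \<open>4\<close> comes
  from splitting each index set according to a sign.
\<close>

lemma bilinear_le_subset_sums:
  fixes B :: "'a \<Rightarrow> 'b \<Rightarrow> real"
  assumes fin: "finite S" "finite T"
    and bd: "\<And>S' T'. S' \<subseteq> S \<Longrightarrow> T' \<subseteq> T \<Longrightarrow> \<bar>\<Sum>i\<in>S'. \<Sum>j\<in>T'. B i j\<bar> \<le> M"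
    and u: "\<And>i. i \<in> S \<Longrightarrow> \<bar>u i\<bar> \<le> 1" and w: "\<And>j. j \<in> T \<Longrightarrow> \<bar>w j\<bar> \<le> 1"
  shows "\<bar>\<Sum>i\<in>S. \<Sum>j\<in>T. u i * B i j * w j\<bar> \<le> 4 * M"
proof -
  have "\<bar>\<Sum>i\<in>S. u i * (\<Sum>j\<in>T. w j * B i j)\<bar> \<le> 2 * (2 * M)"
  proof (rule weighted_sum_le_subset_sums[OF fin(1) _ u])
    fix S' assume S': "S' \<subseteq> S"
    have "(\<Sum>i\<in>S'. \<Sum>j\<in>T. w j * B i j) = (\<Sum>j\<in>T. w j * (\<Sum>i\<in>S'. B i j))"
      by (subst sum.swap) (simp add: sum_distrib_left)
    moreover have "\<bar>\<Sum>j\<in>T. w j * (\<Sum>i\<in>S'. B i j)\<bar> \<le> 2 * M"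
    proof (rule weighted_sum_le_subset_sums[OF fin(2) _ w])
      fix T' assume "T' \<subseteq> T"
      then show "\<bar>\<Sum>j\<in>T'. \<Sum>i\<in>S'. B i j\<bar> \<le> M" using bd[OF S'] by (subst sum.swap) simp
    qed
    ultimately show "\<bar>\<Sum>i\<in>S'. \<Sum>j\<in>T. w j * B i j\<bar> \<le> 2 * M" by simp
  qed
  then show ?thesis by (simp add: sum_distrib_left mult_ac)
qed

lemma floor_log_bounds:
  fixes x K :: real
  assumes "K > 1" "x \<noteq> 0"
  shows "K powr real_of_int \<lfloor>log K \<bar>x\<bar>\<rfloor> \<le> \<bar>x\<bar>" "\<bar>x\<bar> \<le> K powr (real_of_int \<lfloor>log K \<bar>x\<bar>\<rfloor> + 1)"
proof -
  have x: "K powr log K \<bar>x\<bar> = \<bar>x\<bar>" using assms by simp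
  show "K powr real_of_int \<lfloor>log K \<bar>x\<bar>\<rfloor> \<le> \<bar>x\<bar>"
    by (subst (2) x[symmetric], rule powr_mono) (use assms in auto)
  show "\<bar>x\<bar> \<le> K powr (real_of_int \<lfloor>log K \<bar>x\<bar>\<rfloor> + 1)"
    by (subst (1) x[symmetric], rule powr_mono) (use assms in linarith)+
qed

lemma far_levels_product:
  fixes x y K :: real
  assumes K: "K > 1" and nz: "x \<noteq> 0" "y \<noteq> 0"
    and far: "\<bar>\<lfloor>log K \<bar>x\<bar>\<rfloor> - \<lfloor>log K \<bar>y\<bar>\<rfloor>\<bar> > 1"
  shows "\<bar>x\<bar> * \<bar>y\<bar> \<le> (x\<^sup>2 + y\<^sup>2) / K"
proof -
  have main: "\<bar>a\<bar> * \<bar>b\<bar> \<le> a\<^sup>2 / K"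
    if nz: "a \<noteq> 0" "b \<noteq> 0" and f: "\<lfloor>log K \<bar>a\<bar>\<rfloor> - \<lfloor>log K \<bar>b\<bar>\<rfloor> \<ge> 2" for a b :: real
  proof -
    have "K * \<bar>b\<bar> \<le> K * K powr (real_of_int \<lfloor>log K \<bar>b\<bar>\<rfloor> + 1)"
      using floor_log_bounds(2)[OF K nz(2)] K by simp
    also have "\<dots> = K powr (real_of_int \<lfloor>log K \<bar>b\<bar>\<rfloor> + 2)"
      using K by (simp add: powr_add power2_eq_square)
    also have "\<dots> \<le> K powr real_of_int \<lfloor>log K \<bar>a\<bar>\<rfloor>"
      by (rule powr_mono) (use f K in linarith)+
    also have "\<dots> \<le> \<bar>a\<bar>" by (rule floor_log_bounds(1)[OF K nz(1)])
    finally have "\<bar>a\<bar> * (K * \<bar>b\<bar>) \<le> \<bar>a\<bar> * \<bar>a\<bar>" by (rule mult_left_mono) simp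
    also have "\<dots> = a\<^sup>2" by (simp add: power2_eq_square)
    finally show ?thesis using K by (simp add: pos_le_divide_eq mult_ac)
  qed
  from far consider "\<lfloor>log K \<bar>x\<bar>\<rfloor> - \<lfloor>log K \<bar>y\<bar>\<rfloor> \<ge> 2" | "\<lfloor>log K \<bar>y\<bar>\<rfloor> - \<lfloor>log K \<bar>x\<bar>\<rfloor> \<ge> 2" by linarith
  then show ?thesis
  proof cases
    case 1
    have "\<bar>x\<bar> * \<bar>y\<bar> \<le> x\<^sup>2 / K" by (rule main[OF nz 1])
    also have "\<dots> \<le> (x\<^sup>2 + y\<^sup>2) / K" using K by (simp add: divide_right_mono)
    finally show ?thesis .
  next
    case 2
    have "\<bar>y\<bar> * \<bar>x\<bar> \<le> y\<^sup>2 / K" by (rule main[OF nz(2,1) 2])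
    also have "\<dots> \<le> (x\<^sup>2 + y\<^sup>2) / K" using K by (simp add: divide_right_mono)
    finally show ?thesis by (simp add: mult.commute)
  qed
qed

text \<open>
  Sort the entries of \<open>x\<close> and \<open>y\<close> into levels \<open>K\<^sup>k \<le> |x\<^sub>i| < K\<^sup>k\<^sup>+\<^sup>1\<close>. For levels that are not adjacent, a
  product \<open>|x\<^sub>i y\<^sub>j|\<close> is at most \<open>1 / K\<close> times the larger of the two squares, and the bound \<open>L\<close> for
  rows and columns suffices. For adjacent levels the vectors are nearly constant, and the discrepancy
  bound applies to each of the three families of blocks.
\<close>

lemma discrepancy_bilinear_sum:
  fixes B :: "nat \<Rightarrow> nat \<Rightarrow> real" and x y :: "nat \<Rightarrow> real"
  assumes K: "K > 1" and e0: "\<epsilon> \<ge> 0"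
    and row: "\<And>i. i < n \<Longrightarrow> (\<Sum>j<n. \<bar>B i j\<bar>) \<le> L"
    and col: "\<And>j. j < n \<Longrightarrow> (\<Sum>i<n. \<bar>B i j\<bar>) \<le> L"
    and disc: "\<And>S T. S \<subseteq> {..<n} \<Longrightarrow> T \<subseteq> {..<n} \<Longrightarrow>
        \<bar>\<Sum>i\<in>S. \<Sum>j\<in>T. B i j\<bar> \<le> \<epsilon> * (real (card S) + real (card T))"
  shows "\<bar>\<Sum>i<n. \<Sum>j<n. x i * B i j * y j\<bar>
    \<le> (12 * \<epsilon> * K ^ 3 + L / K) * ((\<Sum>i<n. (x i)\<^sup>2) + (\<Sum>i<n. (y i)\<^sup>2))"
proof -
  define X where "X = (\<Sum>i<n. (x i)\<^sup>2)"
  define Y where "Y = (\<Sum>i<n. (y i)\<^sup>2)"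
  define I where "I = {i\<in>{..<n}. x i \<noteq> 0}"
  define J where "J = {j\<in>{..<n}. y j \<noteq> 0}"
  define b where "b i = \<lfloor>log K \<bar>x i\<bar>\<rfloor>" for i
  define c where "c j = \<lfloor>log K \<bar>y j\<bar>\<rfloor>" for j
  define f where "f i j = x i * B i j * y j" for i j
  define near where "near i = {j\<in>J. \<bar>b i - c j\<bar> \<le> 1}" for i
  have finI: "finite I" and finJ: "finite J" and finN: "finite (near i)" for i
    by (simp_all add: I_def J_def near_def)
  have split: "(\<Sum>i<n. \<Sum>j<n. f i j) = (\<Sum>i\<in>I. \<Sum>j\<in>near i. f i j) + (\<Sum>i\<in>I. \<Sum>j\<in>J - near i. f i j)"
  proof -
    have "(\<Sum>i<n. \<Sum>j<n. f i j) = (\<Sum>i<n. \<Sum>j\<in>J. f i j)"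
      by (intro sum.cong sum.mono_neutral_right refl) (auto simp: J_def f_def)
    also have "\<dots> = (\<Sum>i\<in>I. \<Sum>j\<in>J. f i j)"
      by (rule sum.mono_neutral_right) (auto simp: I_def f_def)
    also have "\<dots> = (\<Sum>i\<in>I. (\<Sum>j\<in>near i. f i j) + (\<Sum>j\<in>J - near i. f i j))"
      by (rule sum.cong[OF refl], subst add.commute, rule sum.subset_diff)
         (auto simp: near_def finJ)
    finally show ?thesis by (simp add: sum.distrib)
  qed
  have far: "\<bar>\<Sum>i\<in>I. \<Sum>j\<in>J - near i. f i j\<bar> \<le> L / K * (X + Y)"
  proof -
    have "\<bar>\<Sum>i\<in>I. \<Sum>j\<in>J - near i. f i j\<bar> \<le> (\<Sum>i\<in>I. \<Sum>j\<in>J - near i. \<bar>f i j\<bar>)"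
      by (rule order_trans[OF sum_abs]) (intro sum_mono sum_abs)
    also have "\<dots> \<le> (\<Sum>i\<in>I. \<Sum>j\<in>J - near i. \<bar>B i j\<bar> * (((x i)\<^sup>2 + (y j)\<^sup>2) / K))"
    proof (intro sum_mono)
      fix i j assume "i \<in> I" "j \<in> J - near i"
      then have "\<bar>x i\<bar> * \<bar>y j\<bar> \<le> ((x i)\<^sup>2 + (y j)\<^sup>2) / K"
        by (intro far_levels_product[OF K]) (auto simp: I_def J_def near_def b_def c_def)
      then have "\<bar>B i j\<bar> * (\<bar>x i\<bar> * \<bar>y j\<bar>) \<le> \<bar>B i j\<bar> * (((x i)\<^sup>2 + (y j)\<^sup>2) / K)"
        by (rule mult_left_mono) simp
      then show "\<bar>f i j\<bar> \<le> \<bar>B i j\<bar> * (((x i)\<^sup>2 + (y j)\<^sup>2) / K)"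
        by (simp add: f_def abs_mult mult_ac)
    qed
    also have "\<dots> \<le> (\<Sum>i\<in>I. \<Sum>j<n. \<bar>B i j\<bar> * (((x i)\<^sup>2 + (y j)\<^sup>2) / K))"
      by (intro sum_mono sum_mono2) (use K in \<open>auto simp: J_def\<close>)
    also have "\<dots> \<le> (\<Sum>i<n. \<Sum>j<n. \<bar>B i j\<bar> * (((x i)\<^sup>2 + (y j)\<^sup>2) / K))"
      by (intro sum_mono2 sum_nonneg) (use K in \<open>auto simp: I_def\<close>)
    also have "\<dots> = ((\<Sum>i<n. (x i)\<^sup>2 * (\<Sum>j<n. \<bar>B i j\<bar>)) + (\<Sum>j<n. (y j)\<^sup>2 * (\<Sum>i<n. \<bar>B i j\<bar>))) / K"
    proof -
      have "(\<Sum>i<n. \<Sum>j<n. \<bar>B i j\<bar> * (((x i)\<^sup>2 + (y j)\<^sup>2) / K))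
          = (\<Sum>i<n. \<Sum>j<n. (x i)\<^sup>2 * \<bar>B i j\<bar> / K) + (\<Sum>i<n. \<Sum>j<n. (y j)\<^sup>2 * \<bar>B i j\<bar> / K)"
        unfolding sum.distrib[symmetric]
        by (intro sum.cong refl) (simp add: add_divide_distrib[symmetric] algebra_simps)
      moreover have "(\<Sum>i<n. \<Sum>j<n. (y j)\<^sup>2 * \<bar>B i j\<bar> / K) = (\<Sum>j<n. \<Sum>i<n. (y j)\<^sup>2 * \<bar>B i j\<bar> / K)"
        by (rule sum.swap)
      ultimately show ?thesis
        by (simp add: sum_distrib_left sum_divide_distrib add_divide_distrib)
    qed
    also have "\<dots> \<le> ((\<Sum>i<n. (x i)\<^sup>2 * L) + (\<Sum>j<n. (y j)\<^sup>2 * L)) / K"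
      using K row col by (intro divide_right_mono add_mono sum_mono mult_left_mono) auto
    also have "\<dots> = L / K * (X + Y)"
      unfolding X_def Y_def sum_distrib_right[symmetric] by (simp add: algebra_simps add_divide_distrib)
    finally show ?thesis .
  qed
  have block: "\<bar>\<Sum>i\<in>{i\<in>I. b i = k}. \<Sum>j\<in>{j\<in>J. c j - o' = k}. f i j\<bar>
      \<le> 4 * \<epsilon> * K ^ 3 * ((\<Sum>i\<in>{i\<in>I. b i = k}. (x i)\<^sup>2) + (\<Sum>j\<in>{j\<in>J. c j - o' = k}. (y j)\<^sup>2))"
    if o: "o' \<in> {-1, 0, 1}" for k o' :: int
  proof -
    let ?S = "{i\<in>I. b i = k}" and ?T = "{j\<in>J. c j - o' = k}"
    define p where "p = K powr (real_of_int k + 1)"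
    define q where "q = K powr (real_of_int (k + o') + 1)"
    have pq: "p > 0" "q > 0" using K by (auto simp: p_def q_def)
    have x: "\<bar>x i\<bar> \<le> p" "K powr real_of_int k \<le> \<bar>x i\<bar>" if "i \<in> ?S" for i
      using that floor_log_bounds[OF K, of "x i"] by (auto simp: I_def b_def p_def)
    have y: "\<bar>y j\<bar> \<le> q" "K powr real_of_int (k + o') \<le> \<bar>y j\<bar>" if "j \<in> ?T" for j
    proof -
      have "y j \<noteq> 0" "\<lfloor>log K \<bar>y j\<bar>\<rfloor> = k + o'" using that by (auto simp: J_def c_def)
      then show "\<bar>y j\<bar> \<le> q" "K powr real_of_int (k + o') \<le> \<bar>y j\<bar>"
        using floor_log_bounds[OF K, of "y j"] by (auto simp: q_def)
    qed
    have "\<bar>\<Sum>i\<in>?S. \<Sum>j\<in>?T. (x i / p) * B i j * (y j / q)\<bar> \<le> 4 * (\<epsilon> * (real (card ?S) + real (card ?T)))"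
    proof (rule bilinear_le_subset_sums)
      fix S' T' assume s: "S' \<subseteq> ?S" and t: "T' \<subseteq> ?T"
      have "\<bar>\<Sum>i\<in>S'. \<Sum>j\<in>T'. B i j\<bar> \<le> \<epsilon> * (real (card S') + real (card T'))"
        by (rule disc) (use s t in \<open>auto simp: I_def J_def\<close>)
      also have "\<dots> \<le> \<epsilon> * (real (card ?S) + real (card ?T))"
        using s t e0 finI finJ by (intro mult_left_mono add_mono) (auto intro: card_mono)
      finally show "\<bar>\<Sum>i\<in>S'. \<Sum>j\<in>T'. B i j\<bar> \<le> \<epsilon> * (real (card ?S) + real (card ?T))" .
    qed (use finI finJ x y pq in \<open>auto simp: divide_le_eq\<close>)
    moreover have "(\<Sum>i\<in>?S. \<Sum>j\<in>?T. (x i / p) * B i j * (y j / q)) = (\<Sum>i\<in>?S. \<Sum>j\<in>?T. f i j) / (p * q)"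
      by (simp add: f_def sum_divide_distrib)
    ultimately have "\<bar>\<Sum>i\<in>?S. \<Sum>j\<in>?T. f i j\<bar> \<le> 4 * (\<epsilon> * (real (card ?S) + real (card ?T))) * (p * q)"
      using pq by (simp add: abs_mult abs_divide pos_divide_le_eq)
    also have "\<dots> = 4 * \<epsilon> * (p * q * real (card ?S) + p * q * real (card ?T))" by (simp add: algebra_simps)
    also have "\<dots> \<le> 4 * \<epsilon> * (K ^ 3 * (\<Sum>i\<in>?S. (x i)\<^sup>2) + K ^ 3 * (\<Sum>j\<in>?T. (y j)\<^sup>2))"
    proof (intro mult_left_mono add_mono)
      have p3: "K ^ 3 = K powr 3" using K by simp
      have "p * q \<le> K ^ 3 * (K powr real_of_int k)\<^sup>2"
      proof -
        have "p * q = K powr (2 * real_of_int k + real_of_int o' + 2)"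
          by (simp add: p_def q_def powr_add[symmetric] algebra_simps)
        also have "\<dots> \<le> K powr (3 + (real_of_int k + real_of_int k))"
          by (rule powr_mono) (use K o in auto)
        also have "\<dots> = K ^ 3 * (K powr real_of_int k)\<^sup>2"
          by (simp only: p3 powr_add power2_eq_square)
        finally show ?thesis .
      qed
      then have "p * q * real (card ?S) \<le> K ^ 3 * (K powr real_of_int k)\<^sup>2 * real (card ?S)"
        by (rule mult_right_mono) simp
      also have "\<dots> = K ^ 3 * (\<Sum>i\<in>?S. (K powr real_of_int k)\<^sup>2)" by simp
      also have "\<dots> \<le> K ^ 3 * (\<Sum>i\<in>?S. (x i)\<^sup>2)"
      proof (intro mult_left_mono sum_mono)
        fix i assume "i \<in> ?S"
        then show "(K powr real_of_int k)\<^sup>2 \<le> (x i)\<^sup>2" using x(2)[of i] K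
          by (metis abs_ge_zero power2_abs power_mono powr_ge_zero)
      qed (use K in auto)
      finally show "p * q * real (card ?S) \<le> K ^ 3 * (\<Sum>i\<in>?S. (x i)\<^sup>2)" .
      have "p * q \<le> K ^ 3 * (K powr real_of_int (k + o'))\<^sup>2"
      proof -
        have "p * q = K powr (2 * real_of_int k + real_of_int o' + 2)"
          by (simp add: p_def q_def powr_add[symmetric] algebra_simps)
        also have "\<dots> \<le> K powr (3 + (real_of_int (k + o') + real_of_int (k + o')))"
          by (rule powr_mono) (use K o in auto)
        also have "\<dots> = K ^ 3 * (K powr real_of_int (k + o'))\<^sup>2"
          by (simp only: p3 powr_add power2_eq_square)
        finally show ?thesis .
      qed
      then have "p * q * real (card ?T) \<le> K ^ 3 * (K powr real_of_int (k + o'))\<^sup>2 * real (card ?T)"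
        by (rule mult_right_mono) simp
      also have "\<dots> = K ^ 3 * (\<Sum>j\<in>?T. (K powr real_of_int (k + o'))\<^sup>2)" by simp
      also have "\<dots> \<le> K ^ 3 * (\<Sum>j\<in>?T. (y j)\<^sup>2)"
      proof (intro mult_left_mono sum_mono)
        fix j assume "j \<in> ?T"
        then show "(K powr real_of_int (k + o'))\<^sup>2 \<le> (y j)\<^sup>2" using y(2)[of j] K
          by (metis abs_ge_zero power2_abs power_mono powr_ge_zero)
      qed (use K in auto)
      finally show "p * q * real (card ?T) \<le> K ^ 3 * (\<Sum>j\<in>?T. (y j)\<^sup>2)" .
    qed (use e0 in auto)
    finally show ?thesis by (simp add: algebra_simps)
  qed
  have diag: "\<bar>\<Sum>k\<in>b ` I. \<Sum>i\<in>{i\<in>I. b i = k}. \<Sum>j\<in>{j\<in>J. c j - o' = k}. f i j\<bar> \<le> 4 * \<epsilon> * K ^ 3 * (X + Y)"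
    if o: "o' \<in> {-1, 0, 1}" for o' :: int
  proof -
    have "\<bar>\<Sum>k\<in>b ` I. \<Sum>i\<in>{i\<in>I. b i = k}. \<Sum>j\<in>{j\<in>J. c j - o' = k}. f i j\<bar>
       \<le> (\<Sum>k\<in>b ` I. 4 * \<epsilon> * K ^ 3 * ((\<Sum>i\<in>{i\<in>I. b i = k}. (x i)\<^sup>2) + (\<Sum>j\<in>{j\<in>J. c j - o' = k}. (y j)\<^sup>2)))"
      by (rule order_trans[OF sum_abs], rule sum_mono, rule block[OF o])
    also have "\<dots> = 4 * \<epsilon> * K ^ 3 * ((\<Sum>k\<in>b ` I. \<Sum>i\<in>{i\<in>I. b i = k}. (x i)\<^sup>2)
        + (\<Sum>k\<in>b ` I. \<Sum>j\<in>{j\<in>J. c j - o' = k}. (y j)\<^sup>2))"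
      by (simp add: sum_distrib_left[symmetric] sum.distrib)
    also have "\<dots> \<le> 4 * \<epsilon> * K ^ 3 * (X + Y)"
    proof (intro mult_left_mono add_mono)
      have "(\<Sum>k\<in>b ` I. \<Sum>i\<in>{i\<in>I. b i = k}. (x i)\<^sup>2) = (\<Sum>i\<in>I. (x i)\<^sup>2)"
        by (rule sum.group) (auto simp: finI)
      also have "\<dots> \<le> X" unfolding X_def by (rule sum_mono2) (auto simp: I_def)
      finally show "(\<Sum>k\<in>b ` I. \<Sum>i\<in>{i\<in>I. b i = k}. (x i)\<^sup>2) \<le> X" .
      let ?T = "{j\<in>J. c j - o' \<in> b ` I}"
      have "(\<Sum>k\<in>b ` I. \<Sum>j\<in>{j\<in>J. c j - o' = k}. (y j)\<^sup>2)
          = (\<Sum>k\<in>b ` I. \<Sum>j\<in>{j\<in>?T. c j - o' = k}. (y j)\<^sup>2)"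
        by (intro sum.cong refl) auto
      also have "\<dots> = (\<Sum>j\<in>?T. (y j)\<^sup>2)"
        by (rule sum.group) (auto simp: finI finJ)
      also have "\<dots> \<le> Y" unfolding Y_def by (rule sum_mono2) (auto simp: J_def)
      finally show "(\<Sum>k\<in>b ` I. \<Sum>j\<in>{j\<in>J. c j - o' = k}. (y j)\<^sup>2) \<le> Y" .
    qed (use e0 K in auto)
    finally show ?thesis .
  qed
  have near: "\<bar>\<Sum>i\<in>I. \<Sum>j\<in>near i. f i j\<bar> \<le> 12 * \<epsilon> * K ^ 3 * (X + Y)"
  proof -
    have "(\<Sum>i\<in>I. \<Sum>j\<in>near i. f i j) = (\<Sum>i\<in>I. \<Sum>o'\<in>{-1,0,1::int}. \<Sum>j\<in>{j\<in>J. c j - o' = b i}. f i j)"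
    proof (rule sum.cong[OF refl])
      fix i assume "i \<in> I"
      have "(\<Sum>o'\<in>{-1,0,1::int}. \<Sum>j\<in>{j\<in>near i. c j - b i = o'}. f i j) = (\<Sum>j\<in>near i. f i j)"
        by (rule sum.group) (auto simp: near_def finJ)
      moreover have "{j\<in>near i. c j - b i = o'} = {j\<in>J. c j - o' = b i}" if "o' \<in> {-1,0,1::int}" for o'
        using that by (auto simp: near_def)
      ultimately show "(\<Sum>j\<in>near i. f i j) = (\<Sum>o'\<in>{-1,0,1::int}. \<Sum>j\<in>{j\<in>J. c j - o' = b i}. f i j)"
        by (metis (no_types, lifting) sum.cong)
    qed
    also have "\<dots> = (\<Sum>o'\<in>{-1,0,1::int}. \<Sum>i\<in>I. \<Sum>j\<in>{j\<in>J. c j - o' = b i}. f i j)"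
      by (rule sum.swap)
    also have "\<dots> = (\<Sum>o'\<in>{-1,0,1::int}. \<Sum>k\<in>b ` I. \<Sum>i\<in>{i\<in>I. b i = k}. \<Sum>j\<in>{j\<in>J. c j - o' = k}. f i j)"
    proof (rule sum.cong[OF refl])
      fix o' :: int
      have "(\<Sum>k\<in>b ` I. \<Sum>i\<in>{i\<in>I. b i = k}. \<Sum>j\<in>{j\<in>J. c j - o' = k}. f i j)
         = (\<Sum>k\<in>b ` I. \<Sum>i\<in>{i\<in>I. b i = k}. \<Sum>j\<in>{j\<in>J. c j - o' = b i}. f i j)"
        by (intro sum.cong refl) auto
      also have "\<dots> = (\<Sum>i\<in>I. \<Sum>j\<in>{j\<in>J. c j - o' = b i}. f i j)"
        by (rule sum.group) (auto simp: finI)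
      finally show "(\<Sum>i\<in>I. \<Sum>j\<in>{j\<in>J. c j - o' = b i}. f i j)
        = (\<Sum>k\<in>b ` I. \<Sum>i\<in>{i\<in>I. b i = k}. \<Sum>j\<in>{j\<in>J. c j - o' = k}. f i j)" by simp
    qed
    finally have eq: "(\<Sum>i\<in>I. \<Sum>j\<in>near i. f i j)
        = (\<Sum>o'\<in>{-1,0,1::int}. \<Sum>k\<in>b ` I. \<Sum>i\<in>{i\<in>I. b i = k}. \<Sum>j\<in>{j\<in>J. c j - o' = k}. f i j)" .
    have "\<bar>\<Sum>i\<in>I. \<Sum>j\<in>near i. f i j\<bar> \<le> (\<Sum>o'\<in>{-1,0,1::int}. 4 * \<epsilon> * K ^ 3 * (X + Y))"
      unfolding eq by (rule order_trans[OF sum_abs], rule sum_mono, rule diag)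
    then show ?thesis by simp
  qed
  have "\<bar>\<Sum>i<n. \<Sum>j<n. f i j\<bar> \<le> 12 * \<epsilon> * K ^ 3 * (X + Y) + L / K * (X + Y)"
    unfolding split using near far by linarith
  then show ?thesis by (simp add: f_def X_def Y_def algebra_simps)
qed

text \<open>
  Normalising both vectors turns the sum of the squared norms in \<open>discrepancy_bilinear_sum\<close> into the
  product of the norms.
\<close>

lemma discrepancy_bilinear_bound:
  fixes B :: "nat \<Rightarrow> nat \<Rightarrow> real" and x y :: "nat \<Rightarrow> real"
  assumes K: "K > 1" and e0: "\<epsilon> \<ge> 0"
    and row: "\<And>i. i < n \<Longrightarrow> (\<Sum>j<n. \<bar>B i j\<bar>) \<le> L"
    and col: "\<And>j. j < n \<Longrightarrow> (\<Sum>i<n. \<bar>B i j\<bar>) \<le> L"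
    and disc: "\<And>S T. S \<subseteq> {..<n} \<Longrightarrow> T \<subseteq> {..<n} \<Longrightarrow>
        \<bar>\<Sum>i\<in>S. \<Sum>j\<in>T. B i j\<bar> \<le> \<epsilon> * (real (card S) + real (card T))"
  shows "\<bar>\<Sum>i<n. \<Sum>j<n. x i * B i j * y j\<bar>
    \<le> (24 * \<epsilon> * K ^ 3 + 2 * L / K) * (sqrt (\<Sum>i<n. (x i)\<^sup>2) * sqrt (\<Sum>i<n. (y i)\<^sup>2))"
proof -
  define p where "p = sqrt (\<Sum>i<n. (x i)\<^sup>2)"
  define q where "q = sqrt (\<Sum>i<n. (y i)\<^sup>2)"
  have p2: "p\<^sup>2 = (\<Sum>i<n. (x i)\<^sup>2)" and q2: "q\<^sup>2 = (\<Sum>i<n. (y i)\<^sup>2)"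
    by (auto simp: p_def q_def sum_nonneg)
  have pq0: "p \<ge> 0" "q \<ge> 0" by (auto simp: p_def q_def sum_nonneg)
  show ?thesis
  proof (cases "p = 0 \<or> q = 0")
    case True
    then have "(\<forall>i<n. x i = 0) \<or> (\<forall>i<n. y i = 0)"
      using p2 q2 by (auto simp: sum_nonneg_eq_0_iff)
    then have "(\<Sum>i<n. \<Sum>j<n. x i * B i j * y j) = 0" by (auto intro!: sum.neutral)
    then show ?thesis using True by (auto simp: p_def[symmetric] q_def[symmetric])
  next
    case False
    then have pq: "p > 0" "q > 0" using pq0 by auto
    have "\<bar>\<Sum>i<n. \<Sum>j<n. (x i / p) * B i j * (y j / q)\<bar>
      \<le> (12 * \<epsilon> * K ^ 3 + L / K) * ((\<Sum>i<n. (x i / p)\<^sup>2) + (\<Sum>i<n. (y i / q)\<^sup>2))"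
      by (rule discrepancy_bilinear_sum[OF K e0 row col disc])
    also have "(\<Sum>i<n. (x i / p)\<^sup>2) = 1"
      using pq by (simp add: power_divide sum_divide_distrib[symmetric] p2[symmetric])
    also have "(\<Sum>i<n. (y i / q)\<^sup>2) = 1"
      using pq by (simp add: power_divide sum_divide_distrib[symmetric] q2[symmetric])
    also have "(\<Sum>i<n. \<Sum>j<n. (x i / p) * B i j * (y j / q)) = (\<Sum>i<n. \<Sum>j<n. x i * B i j * y j) / (p * q)"
      by (simp add: sum_divide_distrib)
    finally have "\<bar>\<Sum>i<n. \<Sum>j<n. x i * B i j * y j\<bar> \<le> (12 * \<epsilon> * K ^ 3 + L / K) * (1 + 1) * (p * q)"
      using pq by (simp add: abs_divide abs_mult pos_divide_le_eq)
    then show ?thesis by (simp add: p_def q_def algebra_simps)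
  qed
qed

section \<open>The largest eigenvalue of a symmetric matrix\<close>

definition ip :: "nat \<Rightarrow> (nat \<Rightarrow> real) \<Rightarrow> (nat \<Rightarrow> real) \<Rightarrow> real" where
  "ip n x y = (\<Sum>i<n. x i * y i)"

definition mat_vec :: "nat \<Rightarrow> (nat \<Rightarrow> nat \<Rightarrow> real) \<Rightarrow> (nat \<Rightarrow> real) \<Rightarrow> nat \<Rightarrow> real" where
  "mat_vec n A x = (\<lambda>i. \<Sum>j<n. A i j * x j)"

lemma ip_commute: "ip n x y = ip n y x"
  by (simp add: ip_def mult.commute)

lemma ip_nonneg [simp]: "ip n x x \<ge> 0"
  by (simp add: ip_def sum_nonneg)

lemma ip_eq_0_iff: "ip n x x = 0 \<longleftrightarrow> (\<forall>i<n. x i = 0)"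
  by (auto simp: ip_def sum_nonneg_eq_0_iff)

lemma ip_add_right: "ip n x (\<lambda>i. y i + z i) = ip n x y + ip n x z"
  by (simp add: ip_def distrib_left sum.distrib)

lemma ip_scale_right: "ip n x (\<lambda>i. c * y i) = c * ip n x y"
  by (simp add: ip_def sum_distrib_left mult_ac)

lemma ip_cong: "(\<And>i. i < n \<Longrightarrow> x i = x' i) \<Longrightarrow> (\<And>i. i < n \<Longrightarrow> y i = y' i) \<Longrightarrow> ip n x y = ip n x' y'"
  by (simp add: ip_def)

lemma ip_mat_vec: "ip n x (mat_vec n A y) = (\<Sum>i<n. \<Sum>j<n. x i * A i j * y j)"
  by (simp add: ip_def mat_vec_def sum_distrib_left mult_ac)

lemma ip_mat_vec_symmetric:
  assumes "\<And>i j. i < n \<Longrightarrow> j < n \<Longrightarrow> A i j = A j i"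
  shows "ip n x (mat_vec n A y) = ip n (mat_vec n A x) y"
proof -
  have "ip n x (mat_vec n A y) = (\<Sum>j<n. \<Sum>i<n. x i * A i j * y j)"
    unfolding ip_mat_vec by (rule sum.swap)
  also have "\<dots> = (\<Sum>j<n. \<Sum>i<n. y j * A j i * x i)"
    using assms by (intro sum.cong refl) (simp add: mult_ac)
  also have "\<dots> = ip n (mat_vec n A x) y" unfolding ip_mat_vec[symmetric] by (rule ip_commute)
  finally show ?thesis .
qed

lemma ip_Cauchy_Schwarz: "\<bar>ip n x y\<bar> \<le> sqrt (ip n x x) * sqrt (ip n y y)"
proof -
  have "(ip n x y)\<^sup>2 \<le> ip n x x * ip n y y"
    using Cauchy_Schwarz_ineq_sum[of x y "{..<n}"] by (simp add: ip_def power2_eq_square)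
  then have "sqrt ((ip n x y)\<^sup>2) \<le> sqrt (ip n x x * ip n y y)" by (rule real_sqrt_le_mono)
  then show ?thesis by (simp add: real_sqrt_mult)
qed

text \<open>
  The unit sphere of \<open>n\<close>-dimensional space, embedded into the product space of all real sequences so
  that \<open>n\<close> may vary.
\<close>

lemma compact_sphere: "compact {x :: nat \<Rightarrow> real. (\<forall>i\<ge>n. x i = 0) \<and> ip n x x = 1}"
proof -
  define C where "C = (\<Pi>\<^sub>E i\<in>UNIV. (if i < n then {-1..1} else {0 :: real}))"
  have "compactin (product_topology (\<lambda>i. euclidean) UNIV) C"
    unfolding C_def by (subst compactin_PiE) auto
  then have C: "compact C" by (simp add: euclidean_product_topology)
  have cont: "continuous_on UNIV (\<lambda>x :: nat \<Rightarrow> real. ip n x x)"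
    unfolding ip_def by (intro continuous_intros continuous_on_product_coordinates)
  have "closed {x :: nat \<Rightarrow> real. ip n x x = 1}"
    by (rule closed_Collect_eq[OF cont]) simp
  then have "compact (C \<inter> {x. ip n x x = 1})" using C by blast
  moreover have "{x :: nat \<Rightarrow> real. (\<forall>i\<ge>n. x i = 0) \<and> ip n x x = 1} = C \<inter> {x. ip n x x = 1}"
  proof (intro equalityI subsetI)
    fix x :: "nat \<Rightarrow> real" assume x: "x \<in> {x. (\<forall>i\<ge>n. x i = 0) \<and> ip n x x = 1}"
    have "\<bar>x i\<bar> \<le> 1" if "i < n" for i
    proof -
      have "(x i)\<^sup>2 \<le> (\<Sum>i<n. (x i)\<^sup>2)" by (rule member_le_sum) (use that in auto)
      also have "\<dots> = 1" using x by (simp add: ip_def power2_eq_square)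
      finally show ?thesis by (simp add: abs_square_le_1)
    qed
    then show "x \<in> C \<inter> {x. ip n x x = 1}" using x by (auto simp: C_def PiE_iff abs_le_iff)
  next
    fix x :: "nat \<Rightarrow> real" assume x: "x \<in> C \<inter> {x. ip n x x = 1}"
    have "x i = 0" if "i \<ge> n" for i
    proof -
      have "x i \<in> (if i < n then {-1..1} else {0})" using x by (auto simp: C_def PiE_iff)
      then show ?thesis using that by simp
    qed
    then show "x \<in> {x. (\<forall>i\<ge>n. x i = 0) \<and> ip n x x = 1}" using x by auto
  qed
  ultimately show ?thesis by simp
qed

text \<open>
  A maximiser \<open>x\<close> of the Rayleigh quotient on the sphere, with value \<open>\<Lambda>\<close>. The form
  \<open>\<Lambda> \<langle>y, y\<rangle> - \<langle>y, A y\<rangle>\<close> is nonnegative and vanishes at \<open>x\<close>, so moving from \<open>x\<close> in the direction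
  \<open>w = \<Lambda> x - A x\<close> shows that \<open>w = 0\<close>.
\<close>

lemma symmetric_top_eigenvector:
  assumes n: "n \<ge> 1" and sym: "\<And>i j. i < n \<Longrightarrow> j < n \<Longrightarrow> A i j = A j i"
  obtains \<Lambda> x where "\<exists>i<n. x i \<noteq> 0" "\<And>i. i < n \<Longrightarrow> mat_vec n A x i = \<Lambda> * x i"
    "\<And>y. ip n y (mat_vec n A y) \<le> \<Lambda> * ip n y y"
proof -
  let ?S = "{x :: nat \<Rightarrow> real. (\<forall>i\<ge>n. x i = 0) \<and> ip n x x = 1}"
  let ?Q = "\<lambda>x. ip n x (mat_vec n A x)"
  define e :: "nat \<Rightarrow> real" where "e = (\<lambda>i. if i = 0 then 1 else 0)"
  have "ip n e e = (\<Sum>i<n. if i = 0 then 1 else 0)"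
    unfolding ip_def by (rule sum.cong) (auto simp: e_def)
  also have "\<dots> = 1" using n by (simp add: sum.delta)
  finally have "e \<in> ?S" using n by (simp add: e_def)
  then have ne: "?S \<noteq> {}" by blast
  have "continuous_on UNIV ?Q"
    unfolding ip_mat_vec by (intro continuous_intros continuous_on_product_coordinates)
  then have "continuous_on ?S ?Q" by (rule continuous_on_subset) simp
  from continuous_attains_sup[OF compact_sphere ne this]
  obtain x where x: "x \<in> ?S" and "\<forall>y\<in>?S. ?Q y \<le> ?Q x" by (elim bexE)
  then have max: "\<And>y. y \<in> ?S \<Longrightarrow> ?Q y \<le> ?Q x" by (elim ballE) auto
  define l where "l = ?Q x"
  have bound: "?Q y \<le> l * ip n y y" for y
  proof (cases "ip n y y = 0")
    case True
    then have "?Q y = 0" by (simp add: ip_eq_0_iff) (simp add: ip_def)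
    then show ?thesis using True by simp
  next
    case False
    then have pos: "ip n y y > 0" using ip_nonneg[of n y] by linarith
    define z where "z = (\<lambda>i. if i < n then y i / sqrt (ip n y y) else 0)"
    have zz: "ip n z z = 1"
    proof -
      have "ip n z z = (\<Sum>i<n. (y i * y i) / ip n y y)"
        unfolding ip_def[of n z] by (rule sum.cong) (use pos in \<open>auto simp: z_def\<close>)
      then show ?thesis using pos by (simp add: sum_divide_distrib[symmetric] ip_def[symmetric])
    qed
    then have "z \<in> ?S" by (simp add: z_def)
    then have "?Q z \<le> l" unfolding l_def by (rule max)
    moreover have "?Q z = ?Q y / ip n y y"
    proof -
      have "?Q z = (\<Sum>i<n. \<Sum>j<n. (y i * A i j * y j) / ip n y y)"
        unfolding ip_mat_vec by (intro sum.cong refl) (use pos in \<open>auto simp: z_def\<close>)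
      then show ?thesis by (simp add: ip_mat_vec sum_divide_distrib)
    qed
    ultimately show ?thesis using pos by (simp add: pos_divide_le_eq)
  qed
  define w where "w i = l * x i - mat_vec n A x i" for i
  define W where "W = ip n w w"
  define G where "G = l * W - ?Q w"
  have "W = 0"
  proof (rule ccontr)
    assume "W \<noteq> 0"
    then have W: "W > 0" using ip_nonneg[of n w] unfolding W_def by linarith
    have G: "G \<ge> 0" using bound[of w] by (simp add: G_def W_def)
    \<comment> \<open>the nonnegative form evaluated at \<open>x + t w\<close>\<close>
    have quad: "2 * t * W + t\<^sup>2 * G \<ge> 0" for t
    proof -
      let ?y = "\<lambda>i. x i + t * w i"
      have Ay: "mat_vec n A ?y = (\<lambda>i. mat_vec n A x i + t * mat_vec n A w i)"
        by (simp add: mat_vec_def sum.distrib sum_distrib_left algebra_simps)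
      have "ip n ?y ?y = ip n x x + 2 * t * ip n x w + t\<^sup>2 * ip n w w"
        by (simp add: ip_def sum.distrib sum_distrib_left algebra_simps power2_eq_square)
      moreover have "?Q ?y = ?Q x + t * ip n x (mat_vec n A w) + t * ip n w (mat_vec n A x) + t\<^sup>2 * ?Q w"
        unfolding Ay by (simp add: ip_def sum.distrib sum_distrib_left algebra_simps power2_eq_square)
      moreover have "ip n x (mat_vec n A w) = ip n w (mat_vec n A x)"
        using ip_mat_vec_symmetric[OF sym, where x = x and y = w] by (simp add: ip_commute)
      moreover have We: "W = l * ip n x w - ip n w (mat_vec n A x)"
      proof -
        have "W = (\<Sum>i<n. l * (x i * w i) - w i * mat_vec n A x i)"
          unfolding W_def ip_def by (rule sum.cong[OF refl]) (simp add: w_def algebra_simps)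
        then show ?thesis by (simp add: ip_def sum_subtractf sum_distrib_left)
      qed
      moreover have "ip n x x = 1" using x by simp
      ultimately have "l + 2 * t * ip n w (mat_vec n A x) + t\<^sup>2 * ?Q w \<le> l * (1 + 2 * t * ip n x w + t\<^sup>2 * W)"
        using bound[of ?y] by (simp add: W_def[symmetric] l_def[symmetric])
      moreover have "2 * t * W = 2 * t * (l * ip n x w - ip n w (mat_vec n A x))" by (simp only: We)
      ultimately show ?thesis by (simp add: G_def algebra_simps)
    qed
    define k where "k = 1 / (G + 1)"
    have k: "k > 0" "G * k < 1" using G by (auto simp: k_def field_simps)
    have "2 * (- W * k) * W + (- W * k)\<^sup>2 * G = - (W\<^sup>2 * k * (2 - G * k))"
      by (simp add: algebra_simps power2_eq_square)
    moreover have "W\<^sup>2 * k * (2 - G * k) > 0" using W k by simp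
    ultimately show False using quad[of "- W * k"] by linarith
  qed
  then have "\<forall>i<n. w i = 0" by (simp add: W_def ip_eq_0_iff)
  moreover have "\<exists>i<n. x i \<noteq> 0" using x ip_eq_0_iff[of n x] by auto
  ultimately show ?thesis using that[of x l] bound by (auto simp: w_def)
qed

lemma eigenvalue_mat_iff:
  "eigenvalue (Matrix.mat n n (\<lambda>(i, j). A i j)) k \<longleftrightarrow>
     (\<exists>v. (\<exists>i<n. v i \<noteq> 0) \<and> (\<forall>i<n. mat_vec n A v i = k * v i))"
proof -
  let ?A = "Matrix.mat n n (\<lambda>(i, j). A i j)"
  have mv: "(?A *\<^sub>v w) $ i = mat_vec n A (\<lambda>j. w $ j) i" if "i < n" "w \<in> carrier_vec n" for w i
    using that by (auto simp: scalar_prod_def mat_vec_def atLeast0LessThan)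
  show ?thesis
  proof
    assume "eigenvalue ?A k"
    then obtain w where w: "w \<in> carrier_vec n" "w \<noteq> 0\<^sub>v n" "?A *\<^sub>v w = k \<cdot>\<^sub>v w"
      by (auto simp: eigenvalue_def eigenvector_def)
    have "\<exists>i<n. w $ i \<noteq> 0" using w(1,2) by (metis carrier_vecD eq_vecI index_zero_vec)
    moreover have "mat_vec n A (\<lambda>j. w $ j) i = k * w $ i" if "i < n" for i
      using mv[OF that w(1)] w that by simp
    ultimately show "\<exists>v. (\<exists>i<n. v i \<noteq> 0) \<and> (\<forall>i<n. mat_vec n A v i = k * v i)" by blast
  next
    assume "\<exists>v. (\<exists>i<n. v i \<noteq> 0) \<and> (\<forall>i<n. mat_vec n A v i = k * v i)"
    then obtain v where v: "\<exists>i<n. v i \<noteq> 0" "\<And>i. i < n \<Longrightarrow> mat_vec n A v i = k * v i" by blast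
    let ?w = "Matrix.vec n v"
    have "?w \<noteq> 0\<^sub>v n" using v(1) by (metis index_vec index_zero_vec(1))
    moreover have "?A *\<^sub>v ?w = k \<cdot>\<^sub>v ?w"
    proof (rule eq_vecI)
      fix i assume "i < dim_vec (k \<cdot>\<^sub>v ?w)"
      then have i: "i < n" by simp
      have "(?A *\<^sub>v ?w) $ i = mat_vec n A (\<lambda>j. ?w $ j) i" by (rule mv[OF i]) simp
      also have "\<dots> = mat_vec n A v i" by (simp add: mat_vec_def)
      finally show "(?A *\<^sub>v ?w) $ i = (k \<cdot>\<^sub>v ?w) $ i" using v(2)[OF i] i by simp
    qed simp
    ultimately show "eigenvalue ?A k" by (auto simp: eigenvalue_def eigenvector_def intro!: exI[of _ ?w])
  qed
qed

lemma Max_spectrum_symmetric: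
  assumes n: "n \<ge> 1" and sym: "\<And>i j. i < n \<Longrightarrow> j < n \<Longrightarrow> A i j = A j i"
  defines "\<Lambda> \<equiv> Max (spectrum (Matrix.mat n n (\<lambda>(i, j). A i j)))"
  obtains v where "\<exists>i<n. v i \<noteq> 0" "\<And>i. i < n \<Longrightarrow> mat_vec n A v i = \<Lambda> * v i"
    "\<And>y. ip n y (mat_vec n A y) \<le> \<Lambda> * ip n y y"
proof -
  let ?A = "Matrix.mat n n (\<lambda>(i, j). A i j)"
  have fin: "finite (spectrum ?A)" by (rule card_finite_spectrum(1)[of _ n]) simp
  obtain l x where lx: "\<exists>i<n. x i \<noteq> 0" "\<And>i. i < n \<Longrightarrow> mat_vec n A x i = l * x i"
    "\<And>y. ip n y (mat_vec n A y) \<le> l * ip n y y"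
    by (rule symmetric_top_eigenvector[OF n sym]) blast+
  have "l \<in> spectrum ?A"
    unfolding spectrum_def mem_Collect_eq eigenvalue_mat_iff using lx by blast
  then have le: "l \<le> \<Lambda>" and "spectrum ?A \<noteq> {}" using fin by (auto simp: \<Lambda>_def)
  then have "\<Lambda> \<in> spectrum ?A" unfolding \<Lambda>_def using fin by (intro Max_in)
  then have "\<exists>v. (\<exists>i<n. v i \<noteq> 0) \<and> (\<forall>i<n. mat_vec n A v i = \<Lambda> * v i)"
    by (simp add: spectrum_def eigenvalue_mat_iff)
  then obtain v where "\<exists>i<n. v i \<noteq> 0" "\<And>i. i < n \<Longrightarrow> mat_vec n A v i = \<Lambda> * v i" by blast
  moreover have "ip n y (mat_vec n A y) \<le> \<Lambda> * ip n y y" for y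
    using lx(3)[of y] mult_right_mono[OF le ip_nonneg[of n y]] by linarith
  ultimately show ?thesis by (rule that)
qed

section \<open>Perturbation of a rank-one matrix\<close>

text \<open>
  The estimate of \<open>rank_one_perturbation_eigenvalue\<close> once the eigenvalue equation has been expanded: it
  replaces \<open>\<mu> / \<Lambda>\<close> by \<open>1\<close>. The error of this in the first-order term is of order \<open>\<rho> (\<Lambda> - \<mu>) / m0\<close>,
  and \<open>\<Lambda> - \<mu>\<close> is itself of order \<open>\<rho> + s\<close>, which explains the term \<open>\<rho>\<^sup>2 / m0\<close>.
\<close>

lemma perturbation_arith:
  fixes \<Lambda> \<mu> \<rho> s r b \<theta> m0 :: real
  assumes eq: "\<Lambda> - \<mu> = \<rho> * \<mu> / \<Lambda> + s * \<mu>\<^sup>2 / \<Lambda>\<^sup>2 + r"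
    and r: "\<bar>r\<bar> \<le> 2 * b * s * \<mu>\<^sup>2 / \<Lambda> ^ 3"
    and \<rho>: "\<bar>\<rho>\<bar> \<le> b" and s: "0 \<le> s" "s \<le> b\<^sup>2 / \<mu>"
    and m0: "0 < m0" "m0 \<le> \<Lambda>" "2 * b \<le> m0" "m0 \<le> \<mu>" "\<mu> \<le> \<theta> * m0"
  shows "\<bar>\<Lambda> - \<mu>\<bar> \<le> 2 * \<theta> * b"
    and "\<bar>\<Lambda> - \<mu> - \<rho> - s\<bar> \<le> \<theta> * \<rho>\<^sup>2 / m0 + 8 * \<theta>\<^sup>2 * (b / m0) * s"
proof -
  define x where "x = \<mu> / \<Lambda>"
  have b: "b \<ge> 0" using \<rho> by linarith
  have l0: "\<Lambda> > 0" "\<mu> > 0" using m0 by linarith+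
  have x0: "x > 0" using l0 by (simp add: x_def)
  have "1 * m0 \<le> \<theta> * m0" using m0 by linarith
  then have th1: "\<theta> \<ge> 1" using m0(1) by (rule mult_right_le_imp_le)
  have "\<mu> \<le> \<theta> * \<Lambda>" using m0(5) mult_left_mono[OF m0(2), of \<theta>] th1 by linarith
  then have xth: "x \<le> \<theta>" using l0 by (simp add: x_def pos_divide_le_eq)
  have eq': "\<Lambda> - \<mu> = \<rho> * x + s * x\<^sup>2 + r" using eq by (simp add: x_def power_divide)
  have r': "\<bar>r\<bar> \<le> 2 * b * s * x\<^sup>2 / m0"
  proof -
    have "2 * b * s * \<mu>\<^sup>2 / \<Lambda> ^ 3 = 2 * b * s * x\<^sup>2 / \<Lambda>"
      using l0 by (simp add: x_def power_divide power2_eq_square power3_eq_cube)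
    also have "\<dots> \<le> 2 * b * s * x\<^sup>2 / m0" using m0 b s by (intro divide_left_mono) auto
    finally show ?thesis using r by linarith
  qed
  have r'': "\<bar>r\<bar> \<le> s * x\<^sup>2"
  proof -
    have "2 * b * s * x\<^sup>2 / m0 = (2 * b / m0) * (s * x\<^sup>2)" by simp
    also have "\<dots> \<le> 1 * (s * x\<^sup>2)" using m0 s by (intro mult_right_mono) auto
    finally show ?thesis using r' by linarith
  qed
  have d0: "\<bar>\<Lambda> - \<mu>\<bar> \<le> \<bar>\<rho>\<bar> * x + 2 * (s * x\<^sup>2)"
  proof -
    have "\<bar>\<rho> * x\<bar> = \<bar>\<rho>\<bar> * x" using x0 by (simp add: abs_mult)
    moreover have "s * x\<^sup>2 \<ge> 0" using s by simp
    ultimately show ?thesis using eq' r'' by linarith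
  qed
  have sx: "s * x\<^sup>2 \<le> b / 2 * x"
  proof -
    have "s * x\<^sup>2 \<le> b\<^sup>2 / \<mu> * x\<^sup>2" using s by (intro mult_right_mono) auto
    also have "\<dots> = b * (b / \<Lambda>) * x" using l0 by (simp add: x_def power2_eq_square)
    also have "\<dots> \<le> b * (1 / 2) * x"
      using m0 l0 b x0 by (intro mult_right_mono mult_left_mono) (auto simp: pos_divide_le_eq)
    finally show ?thesis by simp
  qed
  have "\<bar>\<rho>\<bar> * x \<le> b * x" using \<rho> x0 by (intro mult_right_mono) auto
  then have "\<bar>\<Lambda> - \<mu>\<bar> \<le> 2 * b * x" using d0 sx by linarith
  also have "\<dots> \<le> 2 * b * \<theta>" using xth b by (intro mult_left_mono) auto
  finally show dA: "\<bar>\<Lambda> - \<mu>\<bar> \<le> 2 * \<theta> * b" by (simp add: mult_ac)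
  have x2: "x\<^sup>2 \<le> \<theta>\<^sup>2" using x0 xth by (intro power_mono) auto
  have "\<bar>\<rho>\<bar> * x \<le> \<bar>\<rho>\<bar> * \<theta>" using xth by (intro mult_left_mono) auto
  moreover have "s * x\<^sup>2 \<le> s * \<theta>\<^sup>2" using x2 s by (intro mult_left_mono) auto
  ultimately have dB: "\<bar>\<Lambda> - \<mu>\<bar> \<le> \<theta> * \<bar>\<rho>\<bar> + 2 * \<theta>\<^sup>2 * s" using d0 by (simp add: mult_ac)
  have x1: "x - 1 = (\<mu> - \<Lambda>) / \<Lambda>" using l0 by (simp add: x_def field_simps)
  have dl: "\<bar>\<mu> - \<Lambda>\<bar> / \<Lambda> \<le> \<bar>\<Lambda> - \<mu>\<bar> / m0"
    using m0 l0 by (simp add: abs_minus_commute divide_left_mono)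
  have t1: "\<bar>\<rho> * x - \<rho>\<bar> \<le> \<theta> * \<rho>\<^sup>2 / m0 + 2 * \<theta>\<^sup>2 * (b / m0) * s"
  proof -
    have "\<bar>\<rho> * x - \<rho>\<bar> = \<bar>\<rho>\<bar> * \<bar>x - 1\<bar>" by (simp add: abs_mult[symmetric] algebra_simps)
    also have "\<dots> = \<bar>\<rho>\<bar> * (\<bar>\<mu> - \<Lambda>\<bar> / \<Lambda>)" using l0 unfolding x1 by (simp add: abs_divide)
    also have "\<dots> \<le> \<bar>\<rho>\<bar> * ((\<theta> * \<bar>\<rho>\<bar> + 2 * \<theta>\<^sup>2 * s) / m0)"
      using dl dB m0 by (intro mult_left_mono order_trans[OF dl] divide_right_mono) auto
    also have "\<dots> = \<theta> * \<rho>\<^sup>2 / m0 + 2 * \<theta>\<^sup>2 * (\<bar>\<rho>\<bar> / m0) * s"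
    proof -
      have "\<bar>\<rho>\<bar> * ((\<theta> * \<bar>\<rho>\<bar> + 2 * \<theta>\<^sup>2 * s) / m0)
          = \<theta> * (\<bar>\<rho>\<bar> * \<bar>\<rho>\<bar>) / m0 + 2 * \<theta>\<^sup>2 * (\<bar>\<rho>\<bar> / m0) * s"
        by (simp add: algebra_simps add_divide_distrib)
      then show ?thesis by (simp only: abs_mult_self_eq power2_eq_square)
    qed
    also have "\<dots> \<le> \<theta> * \<rho>\<^sup>2 / m0 + 2 * \<theta>\<^sup>2 * (b / m0) * s"
      using \<rho> m0 s by (intro add_left_mono mult_right_mono mult_left_mono divide_right_mono) auto
    finally show ?thesis .
  qed
  have t2: "\<bar>s * x\<^sup>2 - s\<bar> \<le> 4 * \<theta>\<^sup>2 * (b / m0) * s"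
  proof -
    have "s * x\<^sup>2 - s = s * ((x - 1) * (x + 1))" by (simp add: algebra_simps power2_eq_square)
    then have "\<bar>s * x\<^sup>2 - s\<bar> = s * (\<bar>x - 1\<bar> * \<bar>x + 1\<bar>)" using s by (simp add: abs_mult)
    also have "\<dots> \<le> s * ((2 * \<theta> * b / m0) * (2 * \<theta>))"
    proof (intro mult_left_mono mult_mono)
      have "\<bar>x - 1\<bar> = \<bar>\<mu> - \<Lambda>\<bar> / \<Lambda>" using l0 unfolding x1 by (simp add: abs_divide)
      also have "\<dots> \<le> 2 * \<theta> * b / m0"
        using dA m0 by (intro order_trans[OF dl] divide_right_mono) auto
      finally show "\<bar>x - 1\<bar> \<le> 2 * \<theta> * b / m0" .
      show "\<bar>x + 1\<bar> \<le> 2 * \<theta>" using x0 xth th1 by linarith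
    qed (use s b m0 th1 in auto)
    also have "\<dots> = 4 * \<theta>\<^sup>2 * (b / m0) * s" by (simp add: power2_eq_square)
    finally show ?thesis .
  qed
  have t3: "\<bar>r\<bar> \<le> 2 * \<theta>\<^sup>2 * (b / m0) * s"
  proof -
    have "2 * b * s * x\<^sup>2 / m0 \<le> 2 * b * s * \<theta>\<^sup>2 / m0"
      using x2 b s m0 by (intro divide_right_mono mult_left_mono) auto
    then show ?thesis using r' by (simp add: mult_ac)
  qed
  have "\<Lambda> - \<mu> - \<rho> - s = (\<rho> * x - \<rho>) + (s * x\<^sup>2 - s) + r" using eq' by simp
  then have "\<bar>\<Lambda> - \<mu> - \<rho> - s\<bar> \<le> \<bar>\<rho> * x - \<rho>\<bar> + \<bar>s * x\<^sup>2 - s\<bar> + \<bar>r\<bar>" by linarith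
  moreover have "8 * \<theta>\<^sup>2 * (b / m0) * s
      = 2 * \<theta>\<^sup>2 * (b / m0) * s + 4 * \<theta>\<^sup>2 * (b / m0) * s + 2 * \<theta>\<^sup>2 * (b / m0) * s"
    by (simp add: algebra_simps)
  ultimately show "\<bar>\<Lambda> - \<mu> - \<rho> - s\<bar> \<le> \<theta> * \<rho>\<^sup>2 / m0 + 8 * \<theta>\<^sup>2 * (b / m0) * s"
    using t1 t2 t3 by linarith
qed

text \<open>
  The vector \<open>B v\<close> in the remainder is controlled by applying \<open>B\<close> to the eigenvalue equation: this gives
  \<open>(\<Lambda> - b) |B v| \<le> |B d| |\<langle>d, v\<rangle>| / m1\<close>. Hence the remainder, relative to \<open>\<langle>d, v\<rangle>\<close>, is a multiple of
  \<open>|B d|\<^sup>2\<close>, just as the second-order term \<open>s\<close> is.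
\<close>

lemma rank_one_perturbation_eigenvalue:
  fixes B :: "nat \<Rightarrow> nat \<Rightarrow> real" and dv v :: "nat \<Rightarrow> real"
  assumes sym: "\<And>i j. i < n \<Longrightarrow> j < n \<Longrightarrow> B i j = B j i"
    and B: "\<And>x y. \<bar>ip n x (mat_vec n B y)\<bar> \<le> b * (sqrt (ip n x x) * sqrt (ip n y y))"
    and v: "\<exists>i<n. v i \<noteq> 0"
    and ev: "\<And>i. i < n \<Longrightarrow> mat_vec n (\<lambda>i j. dv i * dv j / m1 + B i j) v i = \<Lambda> * v i"
    and m1: "m1 > 0" and m0: "0 < m0" "m0 \<le> \<Lambda>" "0 \<le> b" "2 * b \<le> m0"
    and \<mu>: "\<mu> = ip n dv dv / m1" "m0 \<le> \<mu>" "\<mu> \<le> \<theta> * m0"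
    and \<rho>: "\<rho> = ip n dv (mat_vec n B dv) / ip n dv dv"
    and s: "s = ip n (mat_vec n B dv) (mat_vec n B dv) / (ip n dv dv * \<mu>)"
  shows "\<bar>\<Lambda> - \<mu>\<bar> \<le> 2 * \<theta> * b"
    and "\<bar>\<Lambda> - \<mu> - \<rho> - s\<bar> \<le> \<theta> * \<rho>\<^sup>2 / m0 + 8 * \<theta>\<^sup>2 * (b / m0) * s"
proof -
  define Bd where "Bd = mat_vec n B dv"
  define Bv where "Bv = mat_vec n B v"
  define c where "c = ip n dv v"
  define m2 where "m2 = ip n dv dv"
  define q where "q = sqrt (ip n Bd Bd)"
  define w where "w = sqrt (ip n Bv Bv)"
  have l0: "\<Lambda> > 0" and mu0: "\<mu> > 0" and lb: "\<Lambda> - b > 0" using m0 \<mu> by linarith+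
  have m2: "m2 > 0" using mu0 m1 \<mu>(1) by (simp add: m2_def zero_less_divide_iff)
  note ss = ip_mat_vec_symmetric[of n B, OF sym]
  \<comment> \<open>the eigenvalue equation paired with an arbitrary vector \<open>x\<close>\<close>
  have test: "\<Lambda> * ip n x v = ip n x dv * c / m1 + ip n x Bv" for x
  proof -
    have "\<Lambda> * v i = (c / m1) * dv i + Bv i" if "i < n" for i
    proof -
      have "\<Lambda> * v i = (\<Sum>j<n. dv i / m1 * (dv j * v j) + B i j * v j)"
        using ev[OF that, symmetric] by (simp add: mat_vec_def algebra_simps)
      also have "\<dots> = dv i / m1 * (\<Sum>j<n. dv j * v j) + (\<Sum>j<n. B i j * v j)"
        by (simp only: sum.distrib sum_distrib_left[symmetric])
      finally show ?thesis by (simp add: Bv_def mat_vec_def c_def ip_def)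
    qed
    then have "ip n x (\<lambda>i. \<Lambda> * v i) = ip n x (\<lambda>i. (c / m1) * dv i + Bv i)" by (intro ip_cong) auto
    also have "\<dots> = (c / m1) * ip n x dv + ip n x Bv"
      by (subst ip_add_right, subst ip_scale_right) (rule refl)
    finally show ?thesis by (simp add: ip_scale_right)
  qed
  have vv: "ip n v v > 0" using v ip_eq_0_iff[of n v] ip_nonneg[of n v] by (metis order_le_less)
  have c0: "c \<noteq> 0"
  proof
    assume "c = 0"
    then have "\<Lambda> * ip n v v = ip n v Bv" using test[of v] by simp
    also have "\<dots> \<le> b * ip n v v" using B[of v v] vv by (simp add: Bv_def)
    finally show False using vv lb by simp
  qed
  have e2: "\<Lambda> * c = \<mu> * c + ip n Bd v"
    using test[of dv] by (simp add: c_def[symmetric] \<mu>(1) Bv_def ss Bd_def)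
  have e3: "\<Lambda> * ip n Bd v = ip n dv Bd * c / m1 + ip n Bd Bv"
    using test[of Bd] by (simp add: ip_commute[of n Bd dv])
  define BBd where "BBd = mat_vec n B Bd"
  have e4: "\<Lambda> * ip n Bd Bv = q\<^sup>2 * c / m1 + ip n BBd Bv"
  proof -
    have "ip n BBd dv = ip n Bd Bd" by (simp add: BBd_def Bd_def ss[symmetric])
    moreover have "ip n BBd v = ip n Bd Bv" by (simp add: BBd_def Bv_def ss[symmetric])
    ultimately show ?thesis using test[of BBd] by (simp add: q_def)
  qed
  have w0: "w \<ge> 0" "q \<ge> 0" by (auto simp: w_def q_def)
  \<comment> \<open>the eigenvalue equation paired with \<open>B\<^sup>2 v\<close>\<close>
  have wq: "w * (\<Lambda> - b) \<le> q * \<bar>c\<bar> / m1"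
  proof (cases "w = 0")
    case True
    then show ?thesis using w0 m1 by simp
  next
    case False
    let ?BBv = "mat_vec n B Bv"
    have 1: "ip n ?BBv dv = ip n Bv Bd" by (simp add: Bd_def ss[symmetric])
    have "ip n Bv (mat_vec n B v) = ip n ?BBv v" by (rule ss)
    moreover have "w\<^sup>2 = ip n Bv Bv" by (simp add: w_def)
    ultimately have 2: "ip n ?BBv v = w\<^sup>2" by (simp only: Bv_def[symmetric])
    have 3: "ip n ?BBv Bv \<le> b * w\<^sup>2" using B[of Bv Bv] by (simp add: ip_commute[of n ?BBv] w_def)
    have "\<bar>ip n Bv Bd\<bar> \<le> w * q" unfolding w_def q_def by (rule ip_Cauchy_Schwarz)
    then have "\<bar>ip n Bv Bd\<bar> * \<bar>c\<bar> / m1 \<le> w * q * \<bar>c\<bar> / m1"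
      using m1 by (intro divide_right_mono mult_right_mono) auto
    moreover have "ip n Bv Bd * c / m1 \<le> \<bar>ip n Bv Bd\<bar> * \<bar>c\<bar> / m1"
      using m1 by (intro divide_right_mono) (auto simp flip: abs_mult)
    ultimately have "\<Lambda> * w\<^sup>2 \<le> w * q * \<bar>c\<bar> / m1 + b * w\<^sup>2"
      using test[of ?BBv] 1 2 3 by simp
    then have "w * (w * (\<Lambda> - b)) \<le> w * (q * \<bar>c\<bar> / m1)" by (simp add: algebra_simps power2_eq_square)
    moreover have "w > 0" using False w0 by simp
    ultimately show ?thesis by (rule mult_left_le_imp_le)
  qed
  have wq': "w \<le> (q * \<bar>c\<bar> / m1) / (\<Lambda> - b)" by (subst pos_le_divide_eq[OF lb]) (rule wq)
  have gb: "\<bar>ip n BBd Bv\<bar> \<le> b * q\<^sup>2 * \<bar>c\<bar> / (m1 * (\<Lambda> - b))"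
  proof -
    have "ip n BBd Bv = ip n Bd (mat_vec n B Bv)" by (simp add: BBd_def ss[symmetric])
    then have "\<bar>ip n BBd Bv\<bar> \<le> b * (q * w)" using B[of Bd Bv] by (simp add: q_def w_def)
    also have "\<dots> \<le> b * (q * ((q * \<bar>c\<bar> / m1) / (\<Lambda> - b)))"
      using wq' m0 w0 by (intro mult_left_mono)
    finally show ?thesis by (simp add: power2_eq_square mult_ac)
  qed
  define r where "r = ip n BBd Bv / (c * \<Lambda>\<^sup>2)"
  have q2: "q\<^sup>2 = s * (m2 * \<mu>)" using m2 mu0 by (simp add: s q_def Bd_def m2_def)
  have p1: "ip n dv Bd = \<rho> * m2" using m2 by (simp add: \<rho> Bd_def m2_def)
  have m1\<mu>: "m2 / m1 = \<mu>" by (simp add: \<mu>(1) m2_def)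
  have main: "\<Lambda> - \<mu> = \<rho> * \<mu> / \<Lambda> + s * \<mu>\<^sup>2 / \<Lambda>\<^sup>2 + r"
  proof -
    have f: "ip n Bd Bv = (q\<^sup>2 * c / m1 + ip n BBd Bv) / \<Lambda>" using e4 l0 by (simp add: field_simps)
    have e: "ip n Bd v = (ip n dv Bd * c / m1 + ip n Bd Bv) / \<Lambda>" using e3 l0 by (simp add: field_simps)
    have "\<Lambda> - \<mu> = ip n Bd v / c" using e2 c0 by (simp add: field_simps)
    also have "\<dots> = ip n dv Bd / (m1 * \<Lambda>) + q\<^sup>2 / (m1 * \<Lambda>\<^sup>2) + r"
      unfolding e f r_def using c0 l0 m1 by (simp add: field_simps power2_eq_square)
    also have "ip n dv Bd / (m1 * \<Lambda>) = \<rho> * (m2 / m1) / \<Lambda>" by (simp add: p1)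
    also have "q\<^sup>2 / (m1 * \<Lambda>\<^sup>2) = s * ((m2 / m1) * \<mu>) / \<Lambda>\<^sup>2" by (simp add: q2)
    finally show ?thesis unfolding m1\<mu> by (simp add: power2_eq_square)
  qed
  have q2bound: "q\<^sup>2 \<le> b\<^sup>2 * m2"
  proof (cases "q = 0")
    case False
    have "q\<^sup>2 = ip n Bd (mat_vec n B dv)" by (simp add: q_def Bd_def)
    also have "\<dots> \<le> b * (q * sqrt m2)" using B[of Bd dv] by (simp add: q_def m2_def)
    finally have "q * q \<le> q * (b * sqrt m2)" by (simp add: power2_eq_square mult_ac)
    then have "q \<le> b * sqrt m2" using False w0 by simp
    then have "q\<^sup>2 \<le> (b * sqrt m2)\<^sup>2" using w0 by (intro power_mono) auto
    then show ?thesis using m2 by (simp add: power_mult_distrib)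
  qed (use m2 in simp)
  have s0: "s \<ge> 0" using m2 mu0 by (simp add: s m2_def[symmetric])
  have s1: "s \<le> b\<^sup>2 / \<mu>"
  proof -
    have "s * \<mu> * m2 \<le> b\<^sup>2 * m2" using q2bound q2 by (simp add: mult_ac)
    then have "s * \<mu> \<le> b\<^sup>2" using m2 by simp
    then show ?thesis using mu0 by (simp add: pos_le_divide_eq)
  qed
  have \<rho>b: "\<bar>\<rho>\<bar> \<le> b"
  proof -
    have "\<bar>\<rho>\<bar> * m2 \<le> b * m2" using B[of dv dv] m2 p1
      by (simp add: m2_def[symmetric] Bd_def[symmetric] abs_mult)
    then show ?thesis using m2 by simp
  qed
  have rb: "\<bar>r\<bar> \<le> 2 * b * s * \<mu>\<^sup>2 / \<Lambda> ^ 3"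
  proof -
    have "\<bar>r\<bar> = \<bar>ip n BBd Bv\<bar> / (\<bar>c\<bar> * \<Lambda>\<^sup>2)" by (simp add: r_def abs_mult)
    also have "\<dots> \<le> (b * q\<^sup>2 * \<bar>c\<bar> / (m1 * (\<Lambda> - b))) / (\<bar>c\<bar> * \<Lambda>\<^sup>2)"
      using gb by (rule divide_right_mono) simp
    also have "\<dots> = b * s * (m2 / m1 * \<mu>) / (\<Lambda> - b) / \<Lambda>\<^sup>2" using c0 by (simp add: q2)
    also have "\<dots> = b * s * \<mu>\<^sup>2 / \<Lambda>\<^sup>2 / (\<Lambda> - b)" unfolding m1\<mu> by (simp add: power2_eq_square)
    also have "\<dots> \<le> b * s * \<mu>\<^sup>2 / \<Lambda>\<^sup>2 / (\<Lambda> / 2)"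
    proof (rule divide_left_mono)
      show "\<Lambda> / 2 \<le> \<Lambda> - b" using m0 by linarith
      show "0 \<le> b * s * \<mu>\<^sup>2 / \<Lambda>\<^sup>2" using m0 s0 by simp
    qed (use l0 lb in simp)
    also have "\<dots> = 2 * b * s * \<mu>\<^sup>2 / \<Lambda> ^ 3" by (simp add: power2_eq_square power3_eq_cube)
    finally show ?thesis .
  qed
  note res = perturbation_arith[OF main rb \<rho>b s0 s1 m0(1,2,4) \<mu>(2,3)]
  show "\<bar>\<Lambda> - \<mu>\<bar> \<le> 2 * \<theta> * b" by (rule res(1))
  show "\<bar>\<Lambda> - \<mu> - \<rho> - s\<bar> \<le> \<theta> * \<rho>\<^sup>2 / m0 + 8 * \<theta>\<^sup>2 * (b / m0) * s" by (rule res(2))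
qed

section \<open>The largest eigenvalue for a fixed degree sequence\<close>

locale comparable_degrees = sparse_degrees +
  fixes m0 :: nat and \<theta> :: real
  assumes deg_ge: "i < n \<Longrightarrow> m0 \<le> \<delta> i" and m0: "1 \<le> m0" and n1: "1 \<le> n"
    and ratio: "real D \<le> \<theta> * real m0" and \<theta>1: "1 \<le> \<theta>"
begin

definition \<mu> :: real where "\<mu> = msum 2 / msum 1"

text \<open>
  The relative error of \<open>p\<close> as an approximation of \<open>1 / m\<^sub>1\<close>.
\<close>

definition excess :: real where "excess = msum 1 * p - 1"

text \<open>
  By \<open>rho_eq_ip\<close> and \<open>fluct_eq_ip\<close> below, \<open>rho\<close> and \<open>fluct\<close> are the first- and second-order corrections
  \<open>\<langle>d, B d\<rangle> / m\<^sub>2\<close> and \<open>|B d|\<^sup>2 / (m\<^sub>2 \<mu>)\<close> of the largest eigenvalue.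
\<close>

definition rho :: "(nat \<times> nat) set set \<Rightarrow> real" where
  "rho M = quad M / msum 2 - \<mu>"

definition fluct :: "(nat \<times> nat) set set \<Rightarrow> real" where
  "fluct M = (\<Sum>i<n. (adj_deg M i - \<mu> * real (\<delta> i))\<^sup>2) / (msum 2 * \<mu>)"

lemma msum_Suc_ge: "real m0 * msum r \<le> msum (Suc r)"
  unfolding msum_def sum_distrib_left by (rule sum_mono) (use deg_ge in \<open>auto intro!: mult_right_mono\<close>)

lemma msum_Suc_le: "msum (Suc r) \<le> real D * msum r"
  unfolding msum_def sum_distrib_left by (rule sum_mono) (use deg_le in \<open>auto intro!: mult_right_mono\<close>)

lemma msum_0: "msum 0 = real n"
  by (simp add: msum_def)

lemma m0_pos: "real m0 > 0"
  using m0 by simp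

lemma n_pos: "real n > 0"
  using n1 by simp

lemma m0_le_D: "real m0 \<le> real D"
  using deg_ge[of 0] deg_le[of 0] n1 by simp

lemma D_pos: "real D \<ge> 1"
  using m0_le_D m0 by simp

lemma msum_bounds:
  shows msum1_ge: "real m0 * real n \<le> msum 1" and msum1_le: "msum 1 \<le> real D * real n"
    and msum2_ge: "real m0 * msum 1 \<le> msum 2" and msum2_le: "msum 2 \<le> real D * msum 1"
    and msum3_ge: "real m0 * msum 2 \<le> msum 3" and msum3_le: "msum 3 \<le> real D * msum 2"
  using msum_Suc_ge[of 0] msum_Suc_le[of 0] msum_Suc_ge[of 1] msum_Suc_le[of 1]
    msum_Suc_ge[of 2] msum_Suc_le[of 2]
  by (simp_all add: msum_0 numeral_2_eq_2 numeral_3_eq_3)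

lemma msum1_pos: "msum 1 > 0"
proof -
  have "real m0 * real n > 0" using m0_pos n_pos by simp
  then show ?thesis using msum1_ge by linarith
qed

lemma msum2_pos: "msum 2 > 0"
proof -
  have "real m0 * msum 1 > 0" using m0_pos msum1_pos by simp
  then show ?thesis using msum2_ge by linarith
qed

lemma \<mu>_bounds: "real m0 \<le> \<mu>" "\<mu> \<le> real D" "\<mu> > 0"
proof -
  show 1: "real m0 \<le> \<mu>" using msum2_ge msum1_pos by (simp add: \<mu>_def pos_le_divide_eq)
  show "\<mu> \<le> real D" using msum2_le msum1_pos by (simp add: \<mu>_def pos_divide_le_eq)
  show "\<mu> > 0" using 1 m0_pos by linarith
qed

lemma n_D_le: "real n * real D \<le> \<theta> * msum 1"
proof -
  have "real n * real D \<le> real n * (\<theta> * real m0)" using ratio by (intro mult_left_mono) auto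
  also have "\<dots> = \<theta> * (real m0 * real n)" by simp
  also have "\<dots> \<le> \<theta> * msum 1" using msum1_ge \<theta>1 by (intro mult_left_mono) auto
  finally show ?thesis .
qed

lemma D_over_m0: "real D / real m0 \<le> \<theta>"
  using ratio m0_pos by (simp add: pos_divide_le_eq)

lemma excess_nonneg: "0 \<le> excess"
  using m1_p by (simp add: excess_def)

lemma p_eq: "p = (1 + excess) / msum 1"
  using msum1_pos by (simp add: excess_def)

lemma m2_\<mu>: "msum 2 = \<mu> * msum 1"
  using msum1_pos by (simp add: \<mu>_def)

lemma avg_rho_bound: "\<bar>avg rho\<bar> \<le> \<theta> * real D * excess"
proof -
  have eq: "avg rho = avg quad / msum 2 - \<mu>"
  proof -
    have "avg rho = avg (\<lambda>M. 1 / msum 2 * quad M) - avg (\<lambda>M. \<mu>)"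
      unfolding avg_diff[symmetric] by (rule avg_cong) (simp add: rho_def)
    then show ?thesis unfolding avg_scale by (simp add: avg_const nonempty)
  qed
  have up: "avg quad / msum 2 \<le> \<mu> + \<mu> * excess"
  proof -
    have "avg quad / msum 2 \<le> p * (msum 2)\<^sup>2 / msum 2"
      using avg_quad(1) msum2_pos by (intro divide_right_mono) auto
    also have "\<dots> = \<mu> + \<mu> * excess"
      using msum1_pos msum2_pos by (simp add: p_eq \<mu>_def power2_eq_square field_simps)
    finally show ?thesis .
  qed
  have lo: "\<mu> + \<mu> * excess - \<theta> * real D * excess \<le> avg quad / msum 2"
  proof -
    have "p * (msum 1)\<^sup>2 - msum 1 = excess * msum 1"
      using msum1_pos by (simp add: p_eq power2_eq_square field_simps)
    then have "p * (msum 2)\<^sup>2 - (real D)\<^sup>2 * (excess * msum 1) \<le> avg quad" using avg_quad(2) by simp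
    then have "(p * (msum 2)\<^sup>2 - (real D)\<^sup>2 * (excess * msum 1)) / msum 2 \<le> avg quad / msum 2"
      using msum2_pos by (intro divide_right_mono) auto
    moreover have "(p * (msum 2)\<^sup>2 - (real D)\<^sup>2 * (excess * msum 1)) / msum 2
        = \<mu> + \<mu> * excess - (real D)\<^sup>2 * excess / \<mu>"
      using msum1_pos msum2_pos by (simp add: p_eq \<mu>_def power2_eq_square field_simps)
    moreover have "(real D)\<^sup>2 * excess / \<mu> \<le> \<theta> * real D * excess"
    proof -
      have "real D / \<mu> \<le> real D / real m0" using \<mu>_bounds m0_pos by (intro divide_left_mono) auto
      then have "real D / \<mu> \<le> \<theta>" using D_over_m0 by linarith
      then have "(real D / \<mu>) * (real D * excess) \<le> \<theta> * (real D * excess)"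
        using excess_nonneg by (intro mult_right_mono) auto
      then show ?thesis by (simp add: power2_eq_square mult_ac)
    qed
    ultimately show ?thesis by linarith
  qed
  have "\<mu> * excess \<le> \<theta> * real D * excess"
  proof -
    have "1 * real D \<le> \<theta> * real D" using \<theta>1 by (intro mult_right_mono) auto
    then have "\<mu> \<le> \<theta> * real D" using \<mu>_bounds by linarith
    then show ?thesis using excess_nonneg by (rule mult_right_mono)
  qed
  moreover have "\<mu> * excess \<ge> 0" using \<mu>_bounds excess_nonneg by simp
  ultimately show ?thesis using up lo eq by linarith
qed

text \<open>
  The second moment of \<open>quad\<close> is nearly the square of its mean, so \<open>rho\<close>, its relative deviation times
  \<open>\<mu>\<close>, has a second moment of smaller order than \<open>D\<close> when \<open>D * excess\<close> is small.
\<close>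

lemma avg_rho_square_bound:
  "avg (\<lambda>M. (rho M)\<^sup>2) \<le> (real D)\<^sup>2 * (2 * excess + excess\<^sup>2) + 2 * \<theta> ^ 3 * real D / real n
    + 2 * \<theta> * (real D)\<^sup>2 * excess"
proof -
  have "avg (\<lambda>M. (rho M)\<^sup>2) = avg (\<lambda>M. (1 / (msum 2)\<^sup>2) * (quad M)\<^sup>2 - (2 * \<mu> * rho M + \<mu>\<^sup>2))"
    by (rule avg_cong) (simp add: rho_def power2_diff power_divide algebra_simps power2_eq_square)
  also have "\<dots> = avg (\<lambda>M. (quad M)\<^sup>2) / (msum 2)\<^sup>2 - (2 * \<mu> * avg rho + \<mu>\<^sup>2)"
    unfolding avg_diff avg_add avg_scale by (simp add: avg_const nonempty)
  also have "\<dots> \<le> (p\<^sup>2 * (msum 2) ^ 4 + 2 * (real D) ^ 4 * msum 1) / (msum 2)\<^sup>2 - (2 * \<mu> * avg rho + \<mu>\<^sup>2)"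
    using avg_quad_square by (intro diff_right_mono divide_right_mono) auto
  also have "(p\<^sup>2 * (msum 2) ^ 4 + 2 * (real D) ^ 4 * msum 1) / (msum 2)\<^sup>2
      = p\<^sup>2 * (msum 2)\<^sup>2 + 2 * (real D) ^ 4 * msum 1 / (msum 2)\<^sup>2"
    using msum2_pos by (simp add: add_divide_distrib power2_eq_square power4_eq_xxxx)
  also have "p\<^sup>2 * (msum 2)\<^sup>2 = \<mu>\<^sup>2 * (1 + excess)\<^sup>2"
    by (simp add: p_eq \<mu>_def power_divide power_mult_distrib)
  finally have main: "avg (\<lambda>M. (rho M)\<^sup>2) \<le> \<mu>\<^sup>2 * (2 * excess + excess\<^sup>2)
      + 2 * (real D) ^ 4 * msum 1 / (msum 2)\<^sup>2 - 2 * \<mu> * avg rho"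
    by (simp add: algebra_simps power2_eq_square)
  have t1: "\<mu>\<^sup>2 * (2 * excess + excess\<^sup>2) \<le> (real D)\<^sup>2 * (2 * excess + excess\<^sup>2)"
    using \<mu>_bounds excess_nonneg by (intro mult_right_mono power_mono) auto
  have t2: "2 * (real D) ^ 4 * msum 1 / (msum 2)\<^sup>2 \<le> 2 * \<theta> ^ 3 * real D / real n"
  proof -
    have "real m0 * (real m0 * real n) \<le> real m0 * msum 1" using msum1_ge by (intro mult_left_mono) auto
    then have m2n: "(real m0)\<^sup>2 * real n \<le> msum 2" using msum2_ge by (simp add: power2_eq_square mult_ac)
    have "((real m0) ^ 3 * real n) * msum 1 = ((real m0)\<^sup>2 * real n) * (real m0 * msum 1)"
      by (simp add: power2_eq_square power3_eq_cube)
    also have "\<dots> \<le> msum 2 * msum 2"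
      using m2n msum2_ge msum2_pos msum1_pos by (intro mult_mono) auto
    finally have "((real m0) ^ 3 * real n) * msum 1 \<le> (msum 2)\<^sup>2" by (simp add: power2_eq_square)
    then have "msum 1 / (msum 2)\<^sup>2 \<le> 1 / ((real m0) ^ 3 * real n)"
      using m0_pos n_pos msum2_pos by (simp add: field_simps)
    then have "2 * (real D) ^ 4 * (msum 1 / (msum 2)\<^sup>2) \<le> 2 * (real D) ^ 4 * (1 / ((real m0) ^ 3 * real n))"
      by (intro mult_left_mono) auto
    also have "\<dots> = 2 * (real D / real m0) ^ 3 * real D / real n"
      by (simp add: power_divide power4_eq_xxxx power3_eq_cube)
    also have "\<dots> \<le> 2 * \<theta> ^ 3 * real D / real n"
      using D_over_m0 n_pos by (intro divide_right_mono mult_right_mono mult_left_mono power_mono) auto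
    finally show ?thesis by simp
  qed
  have t3: "- (2 * \<mu> * avg rho) \<le> 2 * \<theta> * (real D)\<^sup>2 * excess"
  proof -
    have "- (2 * \<mu> * avg rho) \<le> 2 * \<mu> * \<bar>avg rho\<bar>"
      using \<mu>_bounds by (simp add: abs_if)
    also have "\<dots> \<le> 2 * real D * (\<theta> * real D * excess)"
      using \<mu>_bounds avg_rho_bound by (intro mult_mono) auto
    finally show ?thesis by (simp add: power2_eq_square mult_ac)
  qed
  show ?thesis using main t1 t2 t3 by linarith
qed

lemma fluct_eq:
  "fluct M = (\<Sum>i<n. (adj_deg M i)\<^sup>2) / (msum 2 * \<mu>) - 2 * rho M - \<mu>"
proof -
  have "(\<Sum>i<n. (adj_deg M i - \<mu> * real (\<delta> i))\<^sup>2)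
      = (\<Sum>i<n. (adj_deg M i)\<^sup>2 - 2 * \<mu> * (real (\<delta> i) * adj_deg M i) + \<mu>\<^sup>2 * (real (\<delta> i))\<^sup>2)"
    by (rule sum.cong) (auto simp: power2_eq_square algebra_simps)
  also have "\<dots> = (\<Sum>i<n. (adj_deg M i)\<^sup>2) - 2 * \<mu> * (\<Sum>i<n. real (\<delta> i) * adj_deg M i) + \<mu>\<^sup>2 * msum 2"
    by (simp add: sum.distrib sum_subtractf sum_distrib_left msum_def)
  also have "(\<Sum>i<n. real (\<delta> i) * adj_deg M i) = quad M"
    by (simp add: adj_deg_def quad_def sum_distrib_left mult_ac)
  finally show ?thesis using msum2_pos \<mu>_bounds
    by (simp add: fluct_def rho_def diff_divide_distrib add_divide_distrib power2_eq_square)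
qed

lemma fluct_nonneg: "0 \<le> fluct M"
  unfolding fluct_def using msum2_pos \<mu>_bounds by (simp add: sum_nonneg)

lemma third_moment_ratio: "msum 1 * msum 3 / (msum 2)\<^sup>2 \<le> \<theta>"
proof -
  have "msum 1 * msum 3 / (msum 2)\<^sup>2 = (msum 3 / msum 2) / \<mu>"
    by (simp add: \<mu>_def power2_eq_square)
  also have "\<dots> \<le> real D / real m0"
    using msum3_le msum2_pos \<mu>_bounds m0_pos by (intro frac_le) (auto simp: pos_divide_le_eq)
  finally show ?thesis using D_over_m0 by linarith
qed

text \<open>
  Expanding the square in \<open>fluct\<close> leaves \<open>\<Sum>\<^sub>i (A d)\<^sub>i\<^sup>2 / (m\<^sub>2 \<mu>) - 2 \<rho> - \<mu>\<close>. The edges contribute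
  \<open>m\<^sub>1 m\<^sub>3 / m\<^sub>2\<^sup>2\<close> and the paths of length two contribute \<open>\<mu> - 1\<close> to the mean of the first term.
\<close>

lemma avg_fluct_bound:
  assumes h1: "excess \<le> 1"
  shows "\<bar>avg fluct - (msum 1 * msum 3 / (msum 2)\<^sup>2 - 1)\<bar> \<le> 10 * \<theta>\<^sup>2 * real D * excess"
proof -
  define h where "h = excess"
  define G where "G = avg (\<lambda>M. \<Sum>i<n. (adj_deg M i)\<^sup>2)"
  define R where "R = msum 1 * msum 3 / (msum 2)\<^sup>2"
  have h: "0 \<le> h" "h \<le> 1" using excess_nonneg h1 by (auto simp: h_def)
  have den: "msum 2 * \<mu> > 0" using msum2_pos \<mu>_bounds by simp
  have "avg fluct = avg (\<lambda>M. 1 / (msum 2 * \<mu>) * (\<Sum>i<n. (adj_deg M i)\<^sup>2) - (2 * rho M + \<mu>))"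
    by (rule avg_cong) (simp add: fluct_eq)
  then have eq: "avg fluct = G / (msum 2 * \<mu>) - 2 * avg rho - \<mu>"
    unfolding avg_diff avg_add avg_scale by (simp add: G_def avg_const nonempty)
  define S where "S = p * (msum 1 * msum 3) + p\<^sup>2 * ((msum 2 - msum 1) * (msum 2 * msum 2))"
  define e1 where "e1 = p * (msum 1)\<^sup>2 - msum 1"
  define e2 where "e2 = p\<^sup>2 * ((msum 2 - msum 1) * (msum 1)\<^sup>2) - (msum 2 - msum 1)"
  have up: "G \<le> S" unfolding G_def S_def by (rule avg_adj_deg_square(1))
  have lo: "S - (real D)\<^sup>2 * (e1 + e2) \<le> G"
    unfolding G_def S_def e1_def e2_def by (rule avg_adj_deg_square(2))
  have S: "S / (msum 2 * \<mu>) = (1 + h) * R + (1 + h)\<^sup>2 * (\<mu> - 1)"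
  proof -
    have "p * (msum 1 * msum 3) / (msum 2 * \<mu>) = (1 + h) * R"
      using msum1_pos msum2_pos by (simp add: p_eq h_def R_def \<mu>_def power2_eq_square)
    moreover have "p\<^sup>2 * ((msum 2 - msum 1) * (msum 2 * msum 2)) / (msum 2 * \<mu>) = (1 + h)\<^sup>2 * (\<mu> - 1)"
      using msum1_pos msum2_pos by (simp add: p_eq h_def \<mu>_def power2_eq_square power_divide field_simps)
    ultimately show ?thesis by (simp add: S_def add_divide_distrib)
  qed
  have m21: "0 \<le> msum 2 - msum 1"
  proof -
    have "1 * msum 1 \<le> real m0 * msum 1" using m0 msum1_pos by (intro mult_right_mono) auto
    then show ?thesis using msum2_ge by linarith
  qed
  have e: "e1 = h * msum 1" "e2 = (2 * h + h\<^sup>2) * (msum 2 - msum 1)"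
    using msum1_pos by (simp_all add: e1_def e2_def p_eq h_def power2_eq_square power_divide field_simps)
  have \<theta>D: "real D / \<mu> \<le> \<theta>"
  proof -
    have "real D / \<mu> \<le> real D / real m0" using \<mu>_bounds m0_pos by (intro divide_left_mono) auto
    then show ?thesis using D_over_m0 by linarith
  qed
  have hsq: "2 * h + h\<^sup>2 \<le> 3 * h"
  proof -
    have "h * h \<le> h * 1" using h by (intro mult_left_mono) auto
    then show ?thesis by (simp add: power2_eq_square)
  qed
  have D1: "1 \<le> real D" by (rule D_pos)
  have x: "\<theta> * h \<le> \<theta>\<^sup>2 * (real D * h)" "\<theta>\<^sup>2 * h \<le> \<theta>\<^sup>2 * (real D * h)"
    "\<theta> * (real D * h) \<le> \<theta>\<^sup>2 * (real D * h)" "real D * h \<le> \<theta>\<^sup>2 * (real D * h)"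
  proof -
    have t: "\<theta> \<le> \<theta>\<^sup>2" "1 \<le> \<theta>\<^sup>2" using \<theta>1 mult_mono[of 1 \<theta> 1 \<theta>] mult_left_mono[of 1 \<theta> \<theta>] by (auto simp: power2_eq_square)
    have d: "h \<le> real D * h" using D1 h mult_right_mono[of 1 "real D" h] by simp
    have d0: "0 \<le> real D * h" using h by simp
    show "\<theta> * h \<le> \<theta>\<^sup>2 * (real D * h)" using t d h \<theta>1 by (intro mult_mono) auto
    show "\<theta>\<^sup>2 * h \<le> \<theta>\<^sup>2 * (real D * h)" using d by (intro mult_left_mono) auto
    show "\<theta> * (real D * h) \<le> \<theta>\<^sup>2 * (real D * h)" using t d0 by (intro mult_right_mono) auto
    show "real D * h \<le> \<theta>\<^sup>2 * (real D * h)" using mult_right_mono[OF t(2) d0] by simp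
  qed
  have R: "0 \<le> R" "R \<le> \<theta>" using third_moment_ratio msum1_pos msum2_pos msum3_ge m0_pos
    by (auto simp: R_def intro!: divide_nonneg_nonneg mult_nonneg_nonneg order_trans[OF _ msum3_ge])
  have rho_b: "\<bar>avg rho\<bar> \<le> \<theta> * (real D * h)" using avg_rho_bound by (simp add: h_def mult.assoc)
  have hR: "0 \<le> h * R" "h * R \<le> \<theta> * h" using R h mult_left_mono[of R \<theta> h] by (auto simp: mult.commute)
  have hm: "0 \<le> (2 * h + h\<^sup>2) * (\<mu> - 1)" "(2 * h + h\<^sup>2) * (\<mu> - 1) \<le> 3 * (real D * h)"
  proof -
    have mu1: "0 \<le> \<mu> - 1" using \<mu>_bounds m0 by linarith
    then show "0 \<le> (2 * h + h\<^sup>2) * (\<mu> - 1)" using h by simp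
    have "(2 * h + h\<^sup>2) * (\<mu> - 1) \<le> (3 * h) * real D"
      using hsq mu1 \<mu>_bounds h by (intro mult_mono) auto
    then show "(2 * h + h\<^sup>2) * (\<mu> - 1) \<le> 3 * (real D * h)" by (simp add: mult_ac)
  qed
  have S': "S / (msum 2 * \<mu>) - \<mu> - (R - 1) = h * R + (2 * h + h\<^sup>2) * (\<mu> - 1)"
    unfolding S by (simp add: algebra_simps power2_eq_square)
  have low: "(real D)\<^sup>2 * (e1 + e2) / (msum 2 * \<mu>) \<le> \<theta>\<^sup>2 * h + 3 * (\<theta> * (real D * h))"
  proof -
    have "(real D)\<^sup>2 * e1 / (msum 2 * \<mu>) = (real D / \<mu>)\<^sup>2 * h"
      using msum1_pos \<mu>_bounds by (simp add: e(1) m2_\<mu> power2_eq_square)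
    also have "\<dots> \<le> \<theta>\<^sup>2 * h" using \<theta>D \<mu>_bounds h by (intro mult_right_mono power_mono) auto
    finally have 1: "(real D)\<^sup>2 * e1 / (msum 2 * \<mu>) \<le> \<theta>\<^sup>2 * h" .
    have "(real D)\<^sup>2 * e2 / (msum 2 * \<mu>) = (real D / \<mu>) * (real D * ((2 * h + h\<^sup>2) * ((msum 2 - msum 1) / msum 2)))"
      by (simp add: e(2) power2_eq_square mult_ac)
    also have "\<dots> \<le> \<theta> * (real D * ((3 * h) * 1))"
    proof (intro mult_mono)
      show "(msum 2 - msum 1) / msum 2 \<le> 1" using msum1_pos msum2_pos by (simp add: pos_divide_le_eq)
      show "0 \<le> (msum 2 - msum 1) / msum 2" using m21 msum2_pos by simp
    qed (use \<theta>D hsq h \<theta>1 m21 msum2_pos in auto)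
    finally have "(real D)\<^sup>2 * e2 / (msum 2 * \<mu>) \<le> 3 * (\<theta> * (real D * h))" by simp
    then show ?thesis using 1 by (simp add: distrib_left add_divide_distrib)
  qed
  have G1: "G / (msum 2 * \<mu>) \<le> S / (msum 2 * \<mu>)" using up den by (intro divide_right_mono) auto
  have G2: "S / (msum 2 * \<mu>) - (real D)\<^sup>2 * (e1 + e2) / (msum 2 * \<mu>) \<le> G / (msum 2 * \<mu>)"
    unfolding diff_divide_distrib[symmetric] using lo den by (intro divide_right_mono) auto
  have "\<bar>avg fluct - (R - 1)\<bar> \<le> 10 * (\<theta>\<^sup>2 * (real D * h))"
    using G1 G2 low S' hm hR rho_b x eq by (simp only: abs_le_iff) linarith
  then show ?thesis by (simp add: R_def h_def mult_ac)
qed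

end

context comparable_degrees begin

abbreviation lam :: "(nat \<times> nat) set set \<Rightarrow> real" where "lam M \<equiv> largest_eigenvalue n M"

abbreviation deg :: "nat \<Rightarrow> real" where "deg \<equiv> \<lambda>i. real (\<delta> i)"

definition small_discrepancy :: "real \<Rightarrow> (nat \<times> nat) set set \<Rightarrow> bool" where
  "small_discrepancy \<epsilon> M \<longleftrightarrow> (\<forall>S T. S \<subseteq> {..<n} \<longrightarrow> T \<subseteq> {..<n} \<longrightarrow>
     \<bar>\<Sum>i\<in>S. \<Sum>j\<in>T. centred M i j\<bar> \<le> \<epsilon> * real D * (real (card S) + real (card T)))"

lemma top_eigenvector:
  obtains v where "\<exists>i<n. v i \<noteq> 0" "\<And>i. i < n \<Longrightarrow> mat_vec n (adj M) v i = lam M * v i"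
    "\<And>y. ip n y (mat_vec n (adj M) y) \<le> lam M * ip n y y"
proof -
  have "adjacency_matrix n M = Matrix.mat n n (\<lambda>(i, j). adj M i j)"
    by (simp add: adjacency_matrix_def adj_def)
  then have lam: "lam M = Max (spectrum (Matrix.mat n n (\<lambda>(i, j). adj M i j)))"
    by (simp add: largest_eigenvalue_def)
  show ?thesis
    using Max_spectrum_symmetric[of n "adj M", OF n1 adj_commute] that unfolding lam by blast
qed

text \<open>
  The lower bound is the Rayleigh quotient of the constant vector. For the upper bound, look at an
  eigenvector where its absolute value is largest.
\<close>

lemma lam_bounds:
  assumes M: "M \<in> simple_matchings"
  shows "real m0 \<le> lam M" "lam M \<le> real D"
proof -
  obtain v where v: "\<exists>i<n. v i \<noteq> 0" "\<And>i. i < n \<Longrightarrow> mat_vec n (adj M) v i = lam M * v i"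
    and ray: "\<And>y. ip n y (mat_vec n (adj M) y) \<le> lam M * ip n y y"
    using top_eigenvector[of M] by blast
  have "ip n (\<lambda>i. 1) (mat_vec n (adj M) (\<lambda>i. 1)) = msum 1"
    by (simp add: ip_mat_vec adj_row_sum[OF M] msum_def)
  moreover have "ip n (\<lambda>i. 1) (\<lambda>i. 1) = real n" by (simp add: ip_def)
  ultimately have "msum 1 \<le> lam M * real n" using ray[of "\<lambda>i. 1"] by simp
  then have "real m0 * real n \<le> lam M * real n" using msum1_ge by linarith
  then show "real m0 \<le> lam M" using n_pos by simp
  define x where "x = Max ((\<lambda>i. \<bar>v i\<bar>) ` {..<n})"
  have "0 \<in> {..<n}" using n1 by simp
  then have "{..<n} \<noteq> {}" by blast
  then have "x \<in> (\<lambda>i. \<bar>v i\<bar>) ` {..<n}" unfolding x_def by (intro Max_in) auto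
  then obtain i where i: "i < n" "x = \<bar>v i\<bar>" by auto
  have le: "\<bar>v j\<bar> \<le> x" if "j < n" for j unfolding x_def using that by (intro Max_ge) auto
  have x0: "x > 0"
  proof -
    obtain j where "j < n" "v j \<noteq> 0" using v(1) by blast
    then show ?thesis using le[of j] by linarith
  qed
  have "lam M * x \<le> \<bar>lam M * v i\<bar>" using i by (simp add: abs_mult abs_le_iff mult_right_mono)
  also have "\<dots> = \<bar>\<Sum>j<n. adj M i j * v j\<bar>" using v(2)[OF i(1)] by (simp add: mat_vec_def)
  also have "\<dots> \<le> (\<Sum>j<n. adj M i j * x)"
    by (rule order_trans[OF sum_abs], rule sum_mono) (use le in \<open>auto simp: abs_mult intro!: mult_left_mono\<close>)
  also have "\<dots> = real (\<delta> i) * x" by (simp add: sum_distrib_right[symmetric] adj_row_sum[OF M i(1)])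
  also have "\<dots> \<le> real D * x" using deg_le_real[OF i(1)] x0 by (intro mult_right_mono) auto
  finally show "lam M \<le> real D" using x0 by simp
qed

lemma mat_vec_centred_deg:
  assumes "i < n" shows "mat_vec n (centred M) deg i = adj_deg M i - \<mu> * real (\<delta> i)"
proof -
  have "(\<Sum>j<n. real (\<delta> i) * real (\<delta> j) / msum 1 * real (\<delta> j)) = real (\<delta> i) / msum 1 * msum 2"
    by (simp add: msum_def[of 2] sum_distrib_left sum_divide_distrib power2_eq_square mult_ac)
  then show ?thesis
    by (simp add: mat_vec_def centred_def left_diff_distrib sum_subtractf adj_deg_def \<mu>_def)
qed

lemma rho_eq_ip: "rho M = ip n deg (mat_vec n (centred M) deg) / ip n deg deg"
proof -
  have "ip n deg (mat_vec n (centred M) deg) = (\<Sum>i<n. real (\<delta> i) * adj_deg M i - \<mu> * (real (\<delta> i))\<^sup>2)"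
    unfolding ip_def[of n deg "mat_vec n (centred M) deg"]
    by (rule sum.cong) (auto simp: mat_vec_centred_deg algebra_simps power2_eq_square)
  also have "\<dots> = quad M - \<mu> * msum 2"
    by (simp add: sum_subtractf adj_deg_def quad_def sum_distrib_left msum_def mult_ac)
  finally have 1: "ip n deg (mat_vec n (centred M) deg) = quad M - \<mu> * msum 2" .
  have "ip n deg deg = msum 2" by (simp add: ip_def msum_def power2_eq_square)
  then show ?thesis using 1 msum2_pos by (simp add: rho_def diff_divide_distrib)
qed

lemma fluct_eq_ip:
  "fluct M = ip n (mat_vec n (centred M) deg) (mat_vec n (centred M) deg) / (ip n deg deg * \<mu>)"
proof -
  have "ip n (mat_vec n (centred M) deg) (mat_vec n (centred M) deg) = (\<Sum>i<n. (adj_deg M i - \<mu> * real (\<delta> i))\<^sup>2)"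
    unfolding ip_def by (rule sum.cong) (auto simp: mat_vec_centred_deg power2_eq_square)
  moreover have "ip n deg deg = msum 2" by (simp add: ip_def msum_def power2_eq_square)
  ultimately show ?thesis by (simp add: fluct_def)
qed

text \<open>
  The discrepancy bounds the norm of the centred matrix by \<open>c D\<close>: the first summand of \<open>c\<close> comes from
  adjacent levels of the vectors, the second from the absolute row sums, which are at most \<open>2 D\<close>.
\<close>

lemma lam_small_discrepancy:
  fixes \<epsilon> K :: real
  assumes M: "M \<in> simple_matchings" and good: "small_discrepancy \<epsilon> M"
    and \<epsilon>: "0 \<le> \<epsilon>" and K: "1 < K" and c: "c = 24 * \<epsilon> * K ^ 3 + 4 / K" and small: "2 * \<theta> * c \<le> 1"
  shows "\<bar>lam M - \<mu>\<bar> \<le> 2 * \<theta> * (c * real D)"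
    and "\<bar>lam M - \<mu> - rho M - fluct M\<bar> \<le> \<theta> * (rho M)\<^sup>2 / real m0 + 8 * \<theta> ^ 3 * c * fluct M"
proof -
  let ?B = "centred M"
  define b where "b = c * real D"
  have c0: "c \<ge> 0" using \<epsilon> K unfolding c by simp
  have b0: "b \<ge> 0" using c0 by (simp add: b_def)
  have b2: "2 * b \<le> real m0"
  proof -
    have "2 * b \<le> 2 * c * (\<theta> * real m0)" unfolding b_def using ratio c0 by (simp add: mult_left_mono)
    also have "\<dots> = (2 * \<theta> * c) * real m0" by simp
    also have "\<dots> \<le> 1 * real m0" using small by (intro mult_right_mono) auto
    finally show ?thesis by simp
  qed
  have row: "(\<Sum>j<n. \<bar>?B i j\<bar>) \<le> 2 * real D" if i: "i < n" for i
  proof -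
    have "(\<Sum>j<n. \<bar>?B i j\<bar>) \<le> (\<Sum>j<n. adj M i j + real (\<delta> i) * real (\<delta> j) / msum 1)"
    proof (rule sum_mono)
      fix j
      have "0 \<le> real (\<delta> i) * real (\<delta> j) / msum 1" using msum1_pos by simp
      then show "\<bar>?B i j\<bar> \<le> adj M i j + real (\<delta> i) * real (\<delta> j) / msum 1"
        unfolding centred_def using adj_nonneg[of M i j] by linarith
    qed
    also have "\<dots> = real (\<delta> i) + real (\<delta> i) * msum 1 / msum 1"
      by (simp add: sum.distrib adj_row_sum[OF M i] msum_def sum_distrib_left sum_divide_distrib)
    also have "\<dots> \<le> 2 * real D" using deg_le_real[OF i] msum1_pos by simp
    finally show ?thesis .
  qed
  have col: "(\<Sum>i<n. \<bar>?B i j\<bar>) \<le> 2 * real D" if "j < n" for j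
    using row[OF that] centred_commute[of M _ j] by simp
  have B: "\<bar>ip n x (mat_vec n ?B y)\<bar> \<le> b * (sqrt (ip n x x) * sqrt (ip n y y))" for x y
  proof -
    have "\<bar>\<Sum>i<n. \<Sum>j<n. x i * ?B i j * y j\<bar>
      \<le> (24 * (\<epsilon> * real D) * K ^ 3 + 2 * (2 * real D) / K) * (sqrt (\<Sum>i<n. (x i)\<^sup>2) * sqrt (\<Sum>i<n. (y i)\<^sup>2))"
      by (rule discrepancy_bilinear_bound[OF K _ row col]) (use \<epsilon> good in \<open>auto simp: small_discrepancy_def\<close>)
    also have "24 * (\<epsilon> * real D) * K ^ 3 + 2 * (2 * real D) / K = b"
      by (simp add: b_def c algebra_simps)
    finally show ?thesis
      unfolding ip_mat_vec ip_def[of n x x] ip_def[of n y y] by (simp only: power2_eq_square)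
  qed
  obtain v where v: "\<exists>i<n. v i \<noteq> 0" "\<And>i. i < n \<Longrightarrow> mat_vec n (adj M) v i = lam M * v i"
    by (rule top_eigenvector[of M]) blast
  have A: "(\<lambda>i j. deg i * deg j / msum 1 + ?B i j) = adj M" by (simp add: centred_def fun_eq_iff)
  have ev: "mat_vec n (\<lambda>i j. deg i * deg j / msum 1 + ?B i j) v i = lam M * v i" if "i < n" for i
    unfolding A by (rule v(2)[OF that])
  have ipd: "ip n deg deg = msum 2" by (simp add: ip_def msum_def power2_eq_square)
  have \<mu>': "\<mu> = ip n deg deg / msum 1" by (simp add: ipd \<mu>_def)
  have \<mu>\<theta>: "\<mu> \<le> \<theta> * real m0" using \<mu>_bounds(2) ratio by linarith
  note res = rank_one_perturbation_eigenvalue[of n ?B b v deg "msum 1" "lam M" "real m0" \<mu> \<theta> "rho M" "fluct M",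
    OF centred_commute B v(1) ev msum1_pos m0_pos lam_bounds(1)[OF M] b0 b2 \<mu>' \<mu>_bounds(1) \<mu>\<theta> rho_eq_ip fluct_eq_ip]
  show "\<bar>lam M - \<mu>\<bar> \<le> 2 * \<theta> * (c * real D)" using res(1) by (simp add: b_def)
  have "b / real m0 \<le> c * \<theta>" using D_over_m0 c0 mult_left_mono[of "real D / real m0" \<theta> c] by (simp add: b_def)
  then have "8 * \<theta>\<^sup>2 * (b / real m0) * fluct M \<le> 8 * \<theta>\<^sup>2 * (c * \<theta>) * fluct M"
    using fluct_nonneg by (intro mult_right_mono mult_left_mono) auto
  also have "\<dots> = 8 * \<theta> ^ 3 * c * fluct M" by (simp add: power2_eq_square power3_eq_cube)
  finally show "\<bar>lam M - \<mu> - rho M - fluct M\<bar> \<le> \<theta> * (rho M)\<^sup>2 / real m0 + 8 * \<theta> ^ 3 * c * fluct M"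
    using res(2) by linarith
qed

text \<open>
  For the rare event where the discrepancy is large: all four quantities are at most of order \<open>D\<close>.
\<close>

lemma lam_trivial_bound:
  assumes M: "M \<in> simple_matchings"
  shows "\<bar>lam M - \<mu> - rho M - fluct M\<bar> \<le> 3 * \<theta> * real D"
proof -
  have ad: "0 \<le> adj_deg M i" "adj_deg M i \<le> real D * real (\<delta> i)" if i: "i < n" for i
  proof -
    show "0 \<le> adj_deg M i" by (simp add: adj_deg_def sum_nonneg)
    have "adj_deg M i \<le> (\<Sum>j<n. adj M i j * real D)"
      unfolding adj_deg_def by (intro sum_mono mult_left_mono) (use deg_le in auto)
    also have "\<dots> = real D * real (\<delta> i)" by (simp add: sum_distrib_right[symmetric] adj_row_sum[OF M i])
    finally show "adj_deg M i \<le> real D * real (\<delta> i)" .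
  qed
  have "quad M = (\<Sum>i<n. real (\<delta> i) * adj_deg M i)"
    by (simp add: adj_deg_def quad_def sum_distrib_left mult_ac)
  also have "\<dots> \<le> (\<Sum>i<n. real (\<delta> i) * (real D * real (\<delta> i)))"
    using ad by (intro sum_mono mult_left_mono) auto
  also have "\<dots> = real D * msum 2" by (simp add: msum_def sum_distrib_left power2_eq_square mult_ac)
  finally have "quad M / msum 2 \<le> real D" using msum2_pos by (simp add: pos_divide_le_eq)
  moreover have "0 \<le> quad M / msum 2"
    using msum2_pos by (simp add: quad_def sum_nonneg)
  ultimately have r: "\<bar>rho M\<bar> \<le> real D" using \<mu>_bounds unfolding rho_def by linarith
  have f: "fluct M \<le> \<theta> * real D"
  proof -
    have "(\<Sum>i<n. (adj_deg M i - \<mu> * real (\<delta> i))\<^sup>2) \<le> (\<Sum>i<n. (real D * real (\<delta> i))\<^sup>2)"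
    proof (rule sum_mono)
      fix i assume "i \<in> {..<n}"
      then have i: "i < n" by simp
      have "0 \<le> \<mu> * real (\<delta> i)" "\<mu> * real (\<delta> i) \<le> real D * real (\<delta> i)"
        using \<mu>_bounds by (auto intro!: mult_right_mono)
      then have "\<bar>adj_deg M i - \<mu> * real (\<delta> i)\<bar> \<le> \<bar>real D * real (\<delta> i)\<bar>" using ad[OF i] by linarith
      then show "(adj_deg M i - \<mu> * real (\<delta> i))\<^sup>2 \<le> (real D * real (\<delta> i))\<^sup>2" by (simp only: abs_le_square_iff)
    qed
    also have "\<dots> = (real D)\<^sup>2 * msum 2" by (simp add: msum_def power_mult_distrib sum_distrib_left)
    finally have "fluct M \<le> (real D)\<^sup>2 * msum 2 / (msum 2 * \<mu>)"
      unfolding fluct_def using msum2_pos \<mu>_bounds by (intro divide_right_mono) auto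
    also have "\<dots> = real D / \<mu> * real D" using msum2_pos by (simp add: power2_eq_square)
    also have "\<dots> \<le> \<theta> * real D"
    proof (rule mult_right_mono)
      have "real D / \<mu> \<le> real D / real m0" using \<mu>_bounds m0_pos by (intro divide_left_mono) auto
      then show "real D / \<mu> \<le> \<theta>" using D_over_m0 by linarith
    qed simp
    finally show ?thesis .
  qed
  have "\<bar>lam M - \<mu>\<bar> \<le> real D" using lam_bounds[OF M] \<mu>_bounds m0_pos by linarith
  then have "\<bar>lam M - \<mu> - rho M - fluct M\<bar> \<le> 2 * real D + \<theta> * real D" using r f fluct_nonneg[of M] by linarith
  also have "\<dots> \<le> 3 * \<theta> * real D" using \<theta>1 mult_right_mono[of 1 \<theta> "real D"] by simp
  finally show ?thesis .
qed

definition target :: real where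
  "target = msum 2 / msum 1 + msum 1 * msum 3 / (msum 2)\<^sup>2 - 1"

lemma target_\<mu>: "\<bar>target - \<mu>\<bar> \<le> \<theta>"
proof -
  have "0 \<le> msum 1 * msum 3 / (msum 2)\<^sup>2"
    using msum1_pos msum2_pos m0_pos order_trans[OF _ msum3_ge, of 0] by simp
  then show ?thesis using third_moment_ratio \<theta>1 by (simp add: target_def \<mu>_def)
qed

text \<open>
  The last summand is the contribution of the event where the discrepancy is large. On its complement
  the error of \<open>\<mu> + rho + fluct\<close> is bounded in terms of \<open>rho\<close> and \<open>fluct\<close>, whose moments are known.
\<close>

lemma avg_lam_estimate:
  fixes \<epsilon> K :: real
  assumes \<epsilon>: "0 \<le> \<epsilon>" and K: "1 < K" and c: "c = 24 * \<epsilon> * K ^ 3 + 4 / K" and small: "2 * \<theta> * c \<le> 1"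
    and h: "excess \<le> 1"
  shows "\<bar>avg lam - target\<bar> \<le> 11 * \<theta>\<^sup>2 * (real D * excess)
     + (5 * \<theta> ^ 3 * (real D * excess) + 2 * \<theta> ^ 5 / real n)
     + 8 * \<theta> ^ 3 * c * (\<theta> + 10 * \<theta>\<^sup>2 * (real D * excess))
     + 3 * \<theta> * (real D * avg (\<lambda>M. of_bool (\<not> small_discrepancy \<epsilon> M)))"
proof -
  define R where "R = msum 1 * msum 3 / (msum 2)\<^sup>2"
  define pb where "pb = avg (\<lambda>M. of_bool (\<not> small_discrepancy \<epsilon> M))"
  define e where "e = real D * excess"
  have c0: "c \<ge> 0" using \<epsilon> K unfolding c by simp
  have e0: "e \<ge> 0" using excess_nonneg by (simp add: e_def)
  let ?g = "\<lambda>M. \<theta> / real m0 * (rho M)\<^sup>2 + 8 * \<theta> ^ 3 * c * fluct M + 3 * \<theta> * real D * of_bool (\<not> small_discrepancy \<epsilon> M)"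
  have pt: "\<bar>lam M - \<mu> - rho M - fluct M\<bar> \<le> ?g M" if M: "M \<in> simple_matchings" for M
  proof (cases "small_discrepancy \<epsilon> M")
    case True
    then show ?thesis using lam_small_discrepancy(2)[OF M True \<epsilon> K c small] by simp
  next
    case False
    have "0 \<le> \<theta> / real m0 * (rho M)\<^sup>2" "0 \<le> 8 * \<theta> ^ 3 * c * fluct M"
      using \<theta>1 c0 fluct_nonneg by auto
    moreover have "?g M = \<theta> / real m0 * (rho M)\<^sup>2 + 8 * \<theta> ^ 3 * c * fluct M + 3 * \<theta> * real D"
      using False by simp
    ultimately show ?thesis using lam_trivial_bound[OF M] by linarith
  qed
  have lin: "avg (\<lambda>M. lam M - (\<mu> + (rho M + fluct M))) = avg lam - (\<mu> + (avg rho + avg fluct))"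
    unfolding avg_diff avg_add by (simp add: avg_const nonempty)
  have up: "avg (\<lambda>M. lam M - (\<mu> + (rho M + fluct M))) \<le> avg ?g"
  proof (rule avg_mono)
    fix M assume "M \<in> simple_matchings"
    then show "lam M - (\<mu> + (rho M + fluct M)) \<le> ?g M" using pt[of M] by linarith
  qed
  have "avg (\<lambda>M. (\<mu> + (rho M + fluct M)) - lam M) \<le> avg ?g"
  proof (rule avg_mono)
    fix M assume "M \<in> simple_matchings"
    then show "(\<mu> + (rho M + fluct M)) - lam M \<le> ?g M" using pt[of M] by linarith
  qed
  moreover have "avg (\<lambda>M. (\<mu> + (rho M + fluct M)) - lam M) = - (avg lam - (\<mu> + (avg rho + avg fluct)))"
    unfolding avg_diff avg_add by (simp add: avg_const nonempty)
  ultimately have main: "\<bar>avg lam - (\<mu> + (avg rho + avg fluct))\<bar> \<le> avg ?g"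
    using up lin by linarith
  have g: "avg ?g = \<theta> / real m0 * avg (\<lambda>M. (rho M)\<^sup>2) + 8 * \<theta> ^ 3 * c * avg fluct + 3 * \<theta> * (real D * pb)"
    unfolding avg_add avg_scale pb_def by simp
  have th: "\<theta> \<le> \<theta>\<^sup>2" "\<theta>\<^sup>2 \<le> \<theta> ^ 3" "0 \<le> \<theta>"
    using \<theta>1 power_increasing[of 1 2 \<theta>] power_increasing[of 2 3 \<theta>] by auto
  have A: "\<bar>avg rho\<bar> \<le> \<theta>\<^sup>2 * e"
  proof -
    have "\<theta> * e \<le> \<theta>\<^sup>2 * e" using th e0 by (intro mult_right_mono) auto
    then show ?thesis using avg_rho_bound by (simp add: e_def mult.assoc)
  qed
  have F: "\<bar>avg fluct - (R - 1)\<bar> \<le> 10 * \<theta>\<^sup>2 * e"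
    using avg_fluct_bound[OF h] by (simp add: R_def e_def mult.assoc)
  have F2: "avg fluct \<le> \<theta> + 10 * \<theta>\<^sup>2 * e" using F third_moment_ratio unfolding R_def by linarith
  have S: "\<theta> / real m0 * avg (\<lambda>M. (rho M)\<^sup>2) \<le> 5 * \<theta> ^ 3 * e + 2 * \<theta> ^ 5 / real n"
  proof -
    have "\<theta> / real m0 * avg (\<lambda>M. (rho M)\<^sup>2) \<le> \<theta> / real m0 *
        ((real D)\<^sup>2 * (2 * excess + excess\<^sup>2) + 2 * \<theta> ^ 3 * real D / real n + 2 * \<theta> * (real D)\<^sup>2 * excess)"
      using avg_rho_square_bound th by (intro mult_left_mono) auto
    also have "\<dots> = \<theta> * (real D / real m0) *
        (real D * (2 * excess + excess\<^sup>2) + 2 * \<theta> ^ 3 / real n + 2 * \<theta> * e)"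
      using m0_pos by (simp add: e_def field_simps power2_eq_square)
    also have "\<dots> \<le> \<theta> * \<theta> * (3 * e + 2 * \<theta> ^ 3 / real n + 2 * \<theta> * e)"
    proof (rule mult_mono)
      have "excess * excess \<le> excess * 1" using h excess_nonneg by (intro mult_left_mono) auto
      then have "real D * (2 * excess + excess\<^sup>2) \<le> real D * (3 * excess)"
        by (intro mult_left_mono) (auto simp: power2_eq_square)
      then show "real D * (2 * excess + excess\<^sup>2) + 2 * \<theta> ^ 3 / real n + 2 * \<theta> * e
          \<le> 3 * e + 2 * \<theta> ^ 3 / real n + 2 * \<theta> * e" by (simp add: e_def)
      show "\<theta> * (real D / real m0) \<le> \<theta> * \<theta>" using D_over_m0 th by (intro mult_left_mono) auto
    qed (use th e0 excess_nonneg in auto)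
    also have "\<dots> = 3 * (\<theta>\<^sup>2 * e) + 2 * \<theta> ^ 5 / real n + 2 * \<theta> ^ 3 * e"
      by (simp add: distrib_left power2_eq_square power3_eq_cube eval_nat_numeral)
    also have "\<dots> \<le> 5 * \<theta> ^ 3 * e + 2 * \<theta> ^ 5 / real n"
      using mult_right_mono[OF th(2) e0] by linarith
    finally show ?thesis .
  qed
  have C: "8 * \<theta> ^ 3 * c * avg fluct \<le> 8 * \<theta> ^ 3 * c * (\<theta> + 10 * \<theta>\<^sup>2 * e)"
    using F2 c0 th by (intro mult_left_mono) auto
  have t: "target = \<mu> + (R - 1)" by (simp add: target_def \<mu>_def R_def)
  have "\<bar>avg lam - target\<bar> \<le> \<bar>avg lam - (\<mu> + (avg rho + avg fluct))\<bar> + \<bar>avg rho\<bar> + \<bar>avg fluct - (R - 1)\<bar>"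
    unfolding t by linarith
  then show ?thesis using main A F S C unfolding g e_def[symmetric] pb_def[symmetric] by linarith
qed

lemma avg_lam_ge: "real m0 \<le> avg lam"
proof -
  have "avg (\<lambda>M. real m0) \<le> avg lam" by (rule avg_mono) (rule lam_bounds)
  then show ?thesis by (simp add: avg_const nonempty)
qed

text \<open>
  When the discrepancy is small, the largest eigenvalue is within \<open>2 \<theta> c D\<close> of \<open>\<mu>\<close>, and its mean is
  within a constant of \<open>\<mu>\<close>; both are small compared with \<open>m0\<close>, a lower bound for the mean.
\<close>

lemma ratio_deviation:
  fixes \<epsilon> K :: real
  assumes \<epsilon>: "0 \<le> \<epsilon>" and K: "1 < K" and c: "c = 24 * \<epsilon> * K ^ 3 + 4 / K" and small: "2 * \<theta> * c \<le> 1"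
    and close: "\<bar>avg lam - target\<bar> \<le> 1" and \<eta>: "2 * \<theta>\<^sup>2 * c + (1 + \<theta>) / real m0 \<le> \<eta>"
  shows "avg (\<lambda>M. of_bool (\<bar>lam M / avg lam - 1\<bar> > \<eta>)) \<le> avg (\<lambda>M. of_bool (\<not> small_discrepancy \<epsilon> M))"
proof (rule avg_of_bool_mono)
  fix M assume M: "M \<in> simple_matchings" and dev: "\<bar>lam M / avg lam - 1\<bar> > \<eta>"
  show "\<not> small_discrepancy \<epsilon> M"
  proof
    assume good: "small_discrepancy \<epsilon> M"
    have c0: "c \<ge> 0" using \<epsilon> K unfolding c by simp
    have pos: "avg lam > 0" using avg_lam_ge m0_pos by linarith
    have "\<bar>lam M - avg lam\<bar> \<le> 2 * \<theta> * (c * real D) + (1 + \<theta>)"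
      using lam_small_discrepancy(1)[OF M good \<epsilon> K c small] target_\<mu> close by linarith
    also have "\<dots> \<le> 2 * \<theta> * (c * (\<theta> * real m0)) + (1 + \<theta>)"
      using ratio c0 \<theta>1 by (intro add_right_mono mult_left_mono) auto
    also have "\<dots> = (2 * \<theta>\<^sup>2 * c + (1 + \<theta>) / real m0) * real m0"
      using m0_pos by (simp add: field_simps power2_eq_square)
    also have "\<dots> \<le> \<eta> * real m0" using \<eta> by (rule mult_right_mono) simp
    also have "\<dots> \<le> \<eta> * avg lam"
    proof (rule mult_left_mono[OF avg_lam_ge])
      have "0 \<le> 2 * \<theta>\<^sup>2 * c + (1 + \<theta>) / real m0" using c0 \<theta>1 by simp
      then show "0 \<le> \<eta>" using \<eta> by linarith
    qed
    finally have "\<bar>lam M - avg lam\<bar> / avg lam \<le> \<eta>" using pos by (simp add: pos_divide_le_eq)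
    moreover have "lam M / avg lam - 1 = (lam M - avg lam) / avg lam"
      using pos by (simp add: diff_divide_distrib)
    ultimately show False using dev pos by (simp add: abs_divide)
  qed
qed

end

section \<open>The conditional law\<close>

context sparse_degrees begin

lemma simple_configuration_model_eq: "simple_configuration_model n \<delta> = pmf_of_set simple_matchings"
proof (rule pmf_eqI)
  fix M :: "(nat \<times> nat) set set"
  let ?PM = "perfect_matchings H" and ?S = "{M. simple_matching n M}"
  have fin: "finite ?PM" by (rule finite_perfect_matchings[OF finite_H])
  have ne: "?PM \<noteq> {}" using nonempty simple_matchings_PM by blast
  have sm: "simple_matchings = ?PM \<inter> ?S" by (auto simp: simple_matchings_def)
  have "set_pmf (pmf_of_set ?PM) \<inter> ?S \<noteq> {}" using nonempty sm fin ne by (simp add: set_pmf_of_set)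
  then have "pmf (simple_configuration_model n \<delta>) M
      = (if M \<in> ?S then pmf (pmf_of_set ?PM) M / measure_pmf.prob (pmf_of_set ?PM) ?S else 0)"
    unfolding simple_configuration_model_def configuration_model_def by (rule pmf_cond)
  also have "\<dots> = pmf (pmf_of_set simple_matchings) M"
    using fin ne nonempty finite_simple_matchings
    by (auto simp: measure_pmf_of_set pmf_of_set sm indicator_def card_gt_0_iff)
  finally show "pmf (simple_configuration_model n \<delta>) M = pmf (pmf_of_set simple_matchings) M" .
qed

lemma expectation_eq_avg:
  "measure_pmf.expectation (simple_configuration_model n \<delta>) f = avg f"
  unfolding simple_configuration_model_eq avg_def
  by (rule integral_pmf_of_set[OF nonempty finite_simple_matchings])

lemma prob_eq_avg:
  "measure_pmf.prob (simple_configuration_model n \<delta>) {M. P M} = avg (\<lambda>M. of_bool (P M))"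
proof -
  have "(\<Sum>M\<in>simple_matchings. of_bool (P M) :: real) = real (card (simple_matchings \<inter> {M. P M}))"
    using finite_simple_matchings by (simp add: of_bool_def sum.If_cases)
  then show ?thesis
    unfolding simple_configuration_model_eq avg_def
    using measure_pmf_of_set[OF nonempty finite_simple_matchings] by simp
qed

end

section \<open>Asymptotics\<close>

context comparable_degrees begin

text \<open>
  By definition \<open>excess = q / (m\<^sub>1 - q)\<close> with \<open>q = 4 + 2 D (D + 1)\<close>, of order \<open>D / n\<close>.
\<close>

lemma excess_small:
  assumes n: "16 * \<theta> * real D \<le> real n"
  shows "real D * excess \<le> 16 * \<theta> * ((real D)\<^sup>2 / real n)"
proof -
  define q where "q = 4 + 2 * real ((D + 1) * D)"
  have DD: "real D \<le> (real D)\<^sup>2" "1 \<le> (real D)\<^sup>2"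
    using self_le_power[OF D_pos, of 2] one_le_power[OF D_pos, of 2] by auto
  have q: "q \<le> 8 * (real D)\<^sup>2" using DD by (simp add: q_def distrib_right power2_eq_square)
  have nD: "real n * real D / \<theta> \<le> msum 1" using n_D_le \<theta>1 by (simp add: pos_divide_le_eq mult.commute)
  have "16 * \<theta> * real D * real D \<le> real n * real D" using n by (rule mult_right_mono) simp
  then have "16 * (real D)\<^sup>2 \<le> real n * real D / \<theta>"
    using \<theta>1 by (simp add: pos_le_divide_eq power2_eq_square mult_ac)
  then have qm: "2 * q \<le> msum 1" using q nD by linarith
  have den: "msum 1 - q \<ge> msum 1 / 2" "msum 1 - q > 0" using qm msum1_pos by linarith+
  have "excess = q / (msum 1 - q)"
  proof -
    have "p = 1 / (msum 1 - q)" unfolding edge_bound_def card_H by (simp add: q_def)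
    then show ?thesis using den(2) by (simp add: excess_def field_simps)
  qed
  also have "\<dots> \<le> 8 * (real D)\<^sup>2 / (msum 1 / 2)"
    using q den msum1_pos by (intro frac_le) (auto simp: q_def)
  also have "\<dots> \<le> 8 * (real D)\<^sup>2 / (real n * real D / \<theta> / 2)"
    using nD n_pos D_pos \<theta>1 msum1_pos by (intro divide_left_mono divide_right_mono mult_pos_pos) auto
  finally have "real D * excess \<le> real D * (8 * (real D)\<^sup>2 / (real n * real D / \<theta> / 2))"
    by (rule mult_left_mono) simp
  also have "\<dots> = 16 * \<theta> * ((real D)\<^sup>2 / real n)"
    using n_pos D_pos \<theta>1 by (simp add: field_simps)
  finally show ?thesis .
qed

text \<open>
  The two events in \<open>discrepancy_if_no_excess\<close> are unlikely by \<open>dense_sets_rare\<close> and, with \<open>\<beta>\<close> for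
  \<open>\<epsilon>\<close>, by \<open>large_discrepancy_rare\<close>. The factor \<open>D\<close> on the left is the size of the largest eigenvalue
  on these events.
\<close>

lemma large_discrepancy_probability:
  fixes \<epsilon> :: real
  assumes \<epsilon>: "0 < \<epsilon>" "\<epsilon> \<le> 1" and \<beta>: "\<beta> = \<epsilon>\<^sup>2 / (48 * \<theta>)"
    and n: "24 * \<theta> * real D \<le> real n" "64 * \<theta> / \<beta> * real D \<le> real n"
    and D: "4 \<le> \<epsilon> * real D" "36 * \<theta> / \<epsilon> * (1 / 2) powr (\<epsilon> * real D / 2 - 2) \<le> 1 / 2"
      "4 * \<theta> * ln 8 \<le> \<beta> * real D * ln (1 + \<beta> / 16)"
  shows "real D * avg (\<lambda>M. of_bool (\<not> small_discrepancy \<epsilon> M))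
    \<le> 72 * \<theta> / \<epsilon> * (real D * (1 / 2) powr (\<epsilon> * real D / 2 - 2)) + 2 * (real n * (1 / 2) ^ n)"
proof -
  define r where "r = nat \<lfloor>\<epsilon> * real D / 2\<rfloor>"
  define Q where "Q = 36 * \<theta> / \<epsilon> * (1 / 2) ^ (r - 1)"
  define k where "k = nat \<lfloor>\<beta> * msum 1 / 4\<rfloor>"
  define a where "a = 1 + \<beta> / 16"
  have \<beta>0: "0 < \<beta>" "\<beta> \<le> 1"
  proof -
    show "0 < \<beta>" using \<epsilon> \<theta>1 by (simp add: \<beta>)
    have "\<epsilon>\<^sup>2 \<le> 1" using \<epsilon> by (simp add: power_le_one)
    then show "\<beta> \<le> 1" using \<theta>1 by (simp add: \<beta>)
  qed
  have a: "1 < a" "a \<le> 2" using \<beta>0 by (auto simp: a_def)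
  have D1: "1 \<le> D" using D_pos by simp
  have DD: "real D \<le> (real D)\<^sup>2" "1 \<le> (real D)\<^sup>2"
    using self_le_power[OF D_pos, of 2] one_le_power[OF D_pos, of 2] by auto
  have nD: "real n * real D / \<theta> \<le> msum 1" using n_D_le \<theta>1 by (simp add: pos_divide_le_eq mult.commute)
  have r: "1 \<le> r" "real r \<le> \<epsilon> * real D / 2" "\<epsilon> * real D / 2 - 2 \<le> real (r - 1)"
    using D(1) unfolding r_def by linarith+
  have Qle: "Q \<le> 36 * \<theta> / \<epsilon> * (1 / 2) powr (\<epsilon> * real D / 2 - 2)"
  proof -
    have "(1 / 2 :: real) ^ (r - 1) = (1 / 2) powr real (r - 1)" by (simp add: powr_realpow)
    also have "\<dots> \<le> (1 / 2) powr (\<epsilon> * real D / 2 - 2)" using r(3) by (intro powr_mono') auto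
    finally show ?thesis unfolding Q_def using \<theta>1 \<epsilon> by (intro mult_left_mono) auto
  qed
  have sp1: "2 + 2 * real ((D + 1) * D) \<le> real n * real D / (4 * \<theta>)"
  proof -
    have "24 * \<theta> * real D * real D \<le> real n * real D" using n(1) by (rule mult_right_mono) simp
    then have "6 * (real D)\<^sup>2 \<le> real n * real D / (4 * \<theta>)"
      using \<theta>1 by (simp add: pos_le_divide_eq power2_eq_square mult_ac)
    then show ?thesis using DD by (simp add: distrib_right power2_eq_square)
  qed
  have sp2: "2 * real ((D + 1) * D) \<le> \<beta> * msum 1 / 16"
  proof -
    have "64 * \<theta> / \<beta> * real D * real D \<le> real n * real D" using n(2) by (rule mult_right_mono) simp
    then have "64 * (real D)\<^sup>2 \<le> \<beta> * (real n * real D / \<theta>)"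
      using \<beta>0 \<theta>1 by (simp add: field_simps power2_eq_square)
    also have "\<dots> \<le> \<beta> * msum 1" using nD \<beta>0 by (intro mult_left_mono) auto
    finally show ?thesis using DD by (simp add: distrib_right power2_eq_square)
  qed
  let ?A = "\<lambda>M. \<exists>W\<subseteq>{..<n}. W \<noteq> {} \<and> real (card W) \<le> \<epsilon> * real n / (24 * \<theta>) \<and>
      \<epsilon> * real D * real (card W) < (\<Sum>i\<in>W. \<Sum>j\<in>W. adj M i j)"
  let ?B = "\<lambda>M. \<exists>S\<subseteq>{..<n}. \<exists>T\<subseteq>{..<n}. 2 * \<beta> * msum 1 < (\<Sum>i\<in>S. \<Sum>j\<in>T. centred M i j)"
  have "avg (\<lambda>M. of_bool (\<not> small_discrepancy \<epsilon> M)) \<le> avg (\<lambda>M. of_bool (?A M) + of_bool (?B M))"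
  proof (rule avg_mono)
    fix M assume M: "M \<in> simple_matchings"
    have "small_discrepancy \<epsilon> M" if "\<not> ?A M" "\<not> ?B M"
      unfolding small_discrepancy_def
      using discrepancy_if_no_excess[OF \<epsilon> \<theta>1 D1 n1 n_D_le M that(1) that(2)[unfolded \<beta>]] by blast
    then show "of_bool (\<not> small_discrepancy \<epsilon> M) \<le> (of_bool (?A M) + of_bool (?B M) :: real)"
      by (cases "?A M"; cases "?B M") auto
  qed
  also have "\<dots> = avg (\<lambda>M. of_bool (?A M)) + avg (\<lambda>M. of_bool (?B M))" by (rule avg_add)
  also have "\<dots> \<le> 2 * Q + 4 ^ n * (1 / (1 + \<beta> / 16)) ^ k"
  proof (rule add_mono)
    show "avg (\<lambda>M. of_bool (?A M)) \<le> 2 * Q"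
      by (rule dense_sets_rare[OF \<epsilon> \<theta>1 D1 n_D_le sp1 r(1,2) Q_def]) (use Qle D(2) in linarith)
    show "avg (\<lambda>M. of_bool (?B M)) \<le> 4 ^ n * (1 / (1 + \<beta> / 16)) ^ k"
      by (rule large_discrepancy_rare[OF \<beta>0 msum1_pos sp2 k_def])
  qed
  finally have main: "avg (\<lambda>M. of_bool (\<not> small_discrepancy \<epsilon> M)) \<le> 2 * Q + 4 ^ n * (1 / a) ^ k"
    by (simp add: a_def)
  \<comment> \<open>the tail is small enough for the \<open>4\<^sup>n\<close> pairs of vertex sets\<close>
  have ak: "(1 / a) ^ k \<le> 2 * (1 / 8) ^ n"
  proof -
    have k: "real n * (\<beta> * real D / (4 * \<theta>)) \<le> real k + 1"
    proof -
      have "real n * (\<beta> * real D / (4 * \<theta>)) = \<beta> * (real n * real D / \<theta>) / 4" by (simp add: mult_ac)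
      also have "\<dots> \<le> \<beta> * msum 1 / 4" using nD \<beta>0 by (intro divide_right_mono mult_left_mono) auto
      also have "\<dots> \<le> real k + 1" unfolding k_def by linarith
      finally show ?thesis .
    qed
    have la: "ln a > 0" using a by simp
    have "real n * ln 8 \<le> real n * ((\<beta> * real D / (4 * \<theta>)) * ln a)"
    proof (rule mult_left_mono)
      show "ln 8 \<le> \<beta> * real D / (4 * \<theta>) * ln a" using D(3) \<theta>1 by (simp add: a_def field_simps)
    qed simp
    also have "\<dots> \<le> (real k + 1) * ln a" using mult_right_mono[OF k, of "ln a"] la by (simp add: mult_ac)
    finally have "ln (8 ^ n) \<le> ln (a ^ Suc k)" using a by (simp add: ln_realpow ln_mult algebra_simps)
    then have "8 ^ n \<le> a ^ Suc k" using a by simp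
    also have "\<dots> \<le> 2 * a ^ k" using a by simp
    finally have "8 ^ n \<le> 2 * a ^ k" .
    then show ?thesis using a by (simp add: power_one_over field_simps)
  qed
  have "real D * avg (\<lambda>M. of_bool (\<not> small_discrepancy \<epsilon> M)) \<le> real D * (2 * Q + 4 ^ n * (1 / a) ^ k)"
    by (rule mult_left_mono[OF main]) simp
  also have "\<dots> = 2 * (real D * Q) + 4 ^ n * (real D * (1 / a) ^ k)" by (simp add: algebra_simps)
  also have "\<dots> \<le> 72 * \<theta> / \<epsilon> * (real D * (1 / 2) powr (\<epsilon> * real D / 2 - 2)) + 2 * (real n * (1 / 2) ^ n)"
  proof (rule add_mono)
    show "2 * (real D * Q) \<le> 72 * \<theta> / \<epsilon> * (real D * (1 / 2) powr (\<epsilon> * real D / 2 - 2))"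
      using mult_left_mono[OF Qle, of "2 * real D"] by (simp add: mult_ac)
    have Dn: "real D \<le> real n"
    proof -
      have "1 * real D \<le> (24 * \<theta>) * real D" using \<theta>1 by (intro mult_right_mono) auto
      then show ?thesis using n(1) by linarith
    qed
    have "4 ^ n * (real D * (1 / a) ^ k) \<le> 4 ^ n * (real n * (2 * (1 / 8) ^ n))"
      using ak Dn a by (intro mult_left_mono mult_mono) auto
    also have "\<dots> = 2 * (real n * (4 ^ n * (1 / 8) ^ n))" by simp
    also have "(4 :: real) ^ n * (1 / 8) ^ n = (1 / 2) ^ n"
      unfolding power_mult_distrib[symmetric] by simp
    finally show "4 ^ n * (real D * (1 / a) ^ k) \<le> 2 * (real n * (1 / 2) ^ n)" .
  qed
  finally show ?thesis .
qed

end

text \<open>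
  First \<open>K\<close> is chosen large to make \<open>4 / K\<close> small, and then \<open>\<epsilon>\<close> small depending on \<open>K\<close>.
\<close>

lemma exists_precision:
  fixes \<theta> e :: real
  assumes "1 \<le> \<theta>" "0 < e"
  obtains c \<epsilon> K where "0 < \<epsilon>" "\<epsilon> \<le> 1" "1 < K" "c = 24 * \<epsilon> * K ^ 3 + 4 / K"
    "2 * \<theta> * c \<le> 1" "c \<le> e" "0 < c"
proof -
  define c where "c = min e (1 / (2 * \<theta>))"
  define K where "K = 8 / c"
  define \<epsilon> where "\<epsilon> = c / (48 * K ^ 3)"
  have c: "0 < c" "c \<le> e" "c \<le> 1 / (2 * \<theta>)" using assms by (auto simp: c_def)
  have "1 / (2 * \<theta>) \<le> 1 / 2" using assms by (intro divide_left_mono) auto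
  then have c2: "c \<le> 1 / 2" using c by linarith
  have K: "1 < K" using c c2 by (simp add: K_def pos_less_divide_eq)
  have "1 \<le> K ^ 3" using K by (simp add: one_le_power)
  then have "c \<le> 1 * (48 * K ^ 3)" "0 < 48 * K ^ 3" using c2 by linarith+
  then have "\<epsilon> \<le> 1" unfolding \<epsilon>_def by (subst pos_divide_le_eq)
  moreover have "0 < \<epsilon>" using c K by (simp add: \<epsilon>_def)
  moreover have "c = 24 * \<epsilon> * K ^ 3 + 4 / K"
  proof -
    have "24 * \<epsilon> * K ^ 3 = c / 2" using K by (simp add: \<epsilon>_def)
    moreover have "4 / K = c / 2" using c by (simp add: K_def)
    ultimately show ?thesis by simp
  qed
  moreover have "2 * \<theta> * c \<le> 1" using c(3) assms by (simp add: pos_le_divide_eq mult.commute)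
  ultimately show ?thesis using that K c by blast
qed

theorem theorem1p2:
  fixes d :: "nat \<Rightarrow> nat \<Rightarrow> nat"
  assumes even_sum: "\<And>n. n \<ge> 1 \<Longrightarrow> even (\<Sum>i<n. d n i)"
    and D1: "\<exists>\<theta>::real. \<forall>n\<ge>1. real (max_degree n (d n)) \<le> \<theta> * real (min_degree n (d n))"
    and D2_lower: "filterlim (\<lambda>n. real (max_degree n (d n))) at_top sequentially"
    and D2_upper: "(\<lambda>n. real (max_degree n (d n)) / sqrt (real n)) \<longlonglongrightarrow> 0"
  shows "(\<lambda>n. expected_largest_eigenvalue n (d n)
              - (real (degree_power_sum n (d n) 2) / real (degree_power_sum n (d n) 1)
                 + real (degree_power_sum n (d n) 1) * real (degree_power_sum n (d n) 3)
                     / (real (degree_power_sum n (d n) 2))\<^sup>2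
                 - 1)) \<longlonglongrightarrow> 0
       \<and> tendsto_in_probability (\<lambda>n. simple_configuration_model n (d n))
           (\<lambda>n M. largest_eigenvalue n M / expected_largest_eigenvalue n (d n)) 1"
proof -
  define D where "D n = max_degree n (d n)" for n
  define m0 where "m0 n = min_degree n (d n)" for n
  obtain \<theta>' :: real where \<theta>': "\<And>n. n \<ge> 1 \<Longrightarrow> real (D n) \<le> \<theta>' * real (m0 n)"
    using D1 unfolding D_def m0_def by blast
  define \<theta> where "\<theta> = max 1 \<theta>'"
  have \<theta>1: "1 \<le> \<theta>" by (simp add: \<theta>_def)
  have ratio: "real (D n) \<le> \<theta> * real (m0 n)" if "n \<ge> 1" for n
    using \<theta>'[OF that] mult_right_mono[of \<theta>' \<theta> "real (m0 n)"] by (simp add: \<theta>_def)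
  have D_top: "filterlim (\<lambda>n. real (D n)) at_top sequentially" using D2_lower by (simp add: D_def)
  have D_large: "\<forall>\<^sub>F n in sequentially. C \<le> real (D n)" for C
    using D_top by (simp add: filterlim_at_top)
  have x_lim: "(\<lambda>n. (real (D n))\<^sup>2 / real n) \<longlonglongrightarrow> 0"
  proof -
    have "(\<lambda>n. (real (D n) / sqrt (real n))\<^sup>2) \<longlonglongrightarrow> 0\<^sup>2"
      using D2_upper unfolding D_def by (rule tendsto_power)
    then show ?thesis by (simp add: power_divide)
  qed
  have n_large: "\<forall>\<^sub>F n in sequentially. C * real (D n) \<le> real n" if C: "0 \<le> C" for C
  proof -
    have "\<forall>\<^sub>F n in sequentially. (real (D n))\<^sup>2 / real n < 1 / (C + 1)"
      by (rule order_tendstoD(2)[OF x_lim]) (use C in simp)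
    then show ?thesis using D_large[of 1] eventually_gt_at_top[of 0]
    proof eventually_elim
      case (elim n)
      then have "(C + 1) * (real (D n))\<^sup>2 < real n" using C by (simp add: field_simps)
      moreover have "C * real (D n) \<le> (C + 1) * (real (D n))\<^sup>2"
        using C self_le_power[OF elim(2), of 2] by (intro mult_mono) auto
      ultimately show ?case by linarith
    qed
  qed
  have \<theta>16: "0 \<le> 16 * \<theta>" using \<theta>1 by simp
  have comp: "\<forall>\<^sub>F n in sequentially. comparable_degrees n (d n) (D n) (m0 n) \<theta>"
    using n_large[of "16 * \<theta>", OF \<theta>16] D_large[of 1] eventually_ge_at_top[of 1]
  proof eventually_elim
    case (elim n)
    have n: "n \<ge> 1" using elim by simp
    have le: "d n i \<le> D n" "m0 n \<le> d n i" if "i < n" for i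
      using that by (auto simp: D_def m0_def max_degree_def min_degree_def)
    have m0: "1 \<le> m0 n"
    proof (rule ccontr)
      assume "\<not> 1 \<le> m0 n"
      then have "m0 n = 0" by simp
      then show False using ratio[OF n] elim(2) by simp
    qed
    have card: "real (card (half_edges n (d n))) = (\<Sum>i<n. real (d n i))" by (simp add: card_half_edges)
    have "real n * real (m0 n) = (\<Sum>i<n. real (m0 n))" by simp
    also have "\<dots> \<le> (\<Sum>i<n. real (d n i))" by (rule sum_mono) (use le in auto)
    finally have c: "real n * real (m0 n) \<le> real (card (half_edges n (d n)))" by (simp add: card)
    have "16 * \<theta> * real (D n) * real (m0 n) \<le> real n * real (m0 n)"
      using elim \<theta>1 by (intro mult_right_mono) auto
    moreover have "16 * (real (D n))\<^sup>2 \<le> 16 * \<theta> * real (D n) * real (m0 n)"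
      using mult_left_mono[OF ratio[OF n], of "16 * real (D n)"] by (simp add: power2_eq_square mult_ac)
    moreover have "real (D n) \<le> (real (D n))\<^sup>2" "1 \<le> (real (D n))\<^sup>2"
      using self_le_power[OF elim(2), of 2] one_le_power[OF elim(2), of 2] by auto
    ultimately have "4 + 2 * ((real (D n) + 1) * real (D n)) < real (card (half_edges n (d n)))"
      using c by (simp add: distrib_right power2_eq_square)
    then have "real (4 + 2 * ((D n + 1) * D n)) < real (card (half_edges n (d n)))" by (simp add: algebra_simps)
    then have big: "4 + 2 * ((D n + 1) * D n) < card (half_edges n (d n))" by (simp only: of_nat_less_iff)
    have "even (card (half_edges n (d n)))" using even_sum[OF n] by (simp add: card_half_edges)
    then show ?case
      by unfold_locales (use le m0 n big ratio \<theta>1 in auto)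
  qed
  have ex_small: "\<forall>\<^sub>F n in sequentially. real (D n) * comparable_degrees.excess n (d n) (D n) \<le> e" if e: "0 < e" for e
  proof -
    have "(\<lambda>n. 16 * \<theta> * ((real (D n))\<^sup>2 / real n)) \<longlonglongrightarrow> 16 * \<theta> * 0" by (intro tendsto_intros x_lim)
    then have "\<forall>\<^sub>F n in sequentially. 16 * \<theta> * ((real (D n))\<^sup>2 / real n) < e"
      by (rule order_tendstoD(2)) (use e in simp)
    moreover have "\<forall>\<^sub>F n in sequentially. 16 * \<theta> * real (D n) \<le> real n" using \<theta>1 by (intro n_large) simp
    ultimately show ?thesis using comp
    proof eventually_elim
      case (elim n)
      interpret comparable_degrees n "d n" "D n" "m0 n" \<theta> by (rule elim)
      show ?case using excess_small elim by linarith
    qed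
  qed
  define bad where "bad \<epsilon> n = bounded_degrees.avg n (d n)
      (\<lambda>M. of_bool (\<not> comparable_degrees.small_discrepancy n (d n) (D n) \<epsilon> M))" for \<epsilon> n
  have bad_small: "\<forall>\<^sub>F n in sequentially. real (D n) * bad \<epsilon> n \<le> e"
    if \<epsilon>: "0 < \<epsilon>" "\<epsilon> \<le> 1" and e: "0 < e" for \<epsilon> e
  proof -
    define \<beta> where "\<beta> = \<epsilon>\<^sup>2 / (48 * \<theta>)"
    have \<beta>: "0 < \<beta>" using \<epsilon> \<theta>1 by (simp add: \<beta>_def)
    have l: "ln (1 + \<beta> / 16) > 0" using \<beta> by simp
    have y_top: "filterlim (\<lambda>n. \<epsilon> * real (D n)) at_top sequentially"
      by (rule filterlim_tendsto_pos_mult_at_top[OF tendsto_const \<epsilon>(1) D_top])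
    have "((\<lambda>y :: real. (1 / 2) powr (y / 2 - 2)) \<longlongrightarrow> 0) at_top" by real_asymp
    then have lim1: "(\<lambda>n. 36 * \<theta> / \<epsilon> * (1 / 2) powr (\<epsilon> * real (D n) / 2 - 2)) \<longlonglongrightarrow> 0"
      by (intro tendsto_mult_right_zero) (rule filterlim_compose[OF _ y_top])
    have "((\<lambda>y :: real. y * (1 / 2) powr (y / 2 - 2)) \<longlongrightarrow> 0) at_top" by real_asymp
    then have "(\<lambda>n. 72 * \<theta> / \<epsilon>\<^sup>2 * (\<epsilon> * real (D n) * (1 / 2) powr (\<epsilon> * real (D n) / 2 - 2))) \<longlonglongrightarrow> 0"
      by (intro tendsto_mult_right_zero) (rule filterlim_compose[OF _ y_top])
    moreover have "72 * \<theta> / \<epsilon>\<^sup>2 * (\<epsilon> * real (D n) * w) = 72 * \<theta> / \<epsilon> * (real (D n) * w)" for n w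
      using \<epsilon>(1) by (simp add: power2_eq_square)
    ultimately have lim2: "(\<lambda>n. 72 * \<theta> / \<epsilon> * (real (D n) * (1 / 2) powr (\<epsilon> * real (D n) / 2 - 2))) \<longlonglongrightarrow> 0"
      by (simp only:)
    have lim3: "(\<lambda>n. 2 * (real n * (1 / 2) ^ n)) \<longlonglongrightarrow> 0" by real_asymp
    have "\<forall>\<^sub>F n in sequentially. 36 * \<theta> / \<epsilon> * (1 / 2) powr (\<epsilon> * real (D n) / 2 - 2) < 1 / 2"
      by (rule order_tendstoD(2)[OF lim1]) simp
    moreover have "\<forall>\<^sub>F n in sequentially. 72 * \<theta> / \<epsilon> * (real (D n) * (1 / 2) powr (\<epsilon> * real (D n) / 2 - 2)) < e / 2"
      by (rule order_tendstoD(2)[OF lim2]) (use e in simp)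
    moreover have "\<forall>\<^sub>F n in sequentially. 2 * (real n * (1 / 2) ^ n) < e / 2"
      by (rule order_tendstoD(2)[OF lim3]) (use e in simp)
    moreover have "\<forall>\<^sub>F n in sequentially. 24 * \<theta> * real (D n) \<le> real n" using \<theta>1 by (intro n_large) simp
    moreover have "\<forall>\<^sub>F n in sequentially. 64 * \<theta> / \<beta> * real (D n) \<le> real n" using \<theta>1 \<beta> by (intro n_large) simp
    moreover have "\<forall>\<^sub>F n in sequentially. 4 / \<epsilon> \<le> real (D n)" by (rule D_large)
    moreover have "\<forall>\<^sub>F n in sequentially. 4 * \<theta> * ln 8 / (\<beta> * ln (1 + \<beta> / 16)) \<le> real (D n)" by (rule D_large)
    ultimately show ?thesis using comp
    proof eventually_elim
      case (elim n)
      interpret comparable_degrees n "d n" "D n" "m0 n" \<theta> by (rule elim)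
      have "4 \<le> \<epsilon> * real (D n)" using elim(6) \<epsilon> by (simp add: pos_divide_le_eq mult.commute)
      moreover have "4 * \<theta> * ln 8 \<le> \<beta> * real (D n) * ln (1 + \<beta> / 16)"
        using elim(7) \<beta> l by (simp add: pos_divide_le_eq mult_ac)
      ultimately show ?case
        using large_discrepancy_probability[OF \<epsilon> \<beta>_def elim(4,5)] elim(1,2,3) unfolding bad_def by linarith
    qed
  qed
  define T where "T n = real (degree_power_sum n (d n) 2) / real (degree_power_sum n (d n) 1)
                 + real (degree_power_sum n (d n) 1) * real (degree_power_sum n (d n) 3)
                     / (real (degree_power_sum n (d n) 2))\<^sup>2 - 1" for n
  define L where "L n = expected_largest_eigenvalue n (d n)" for n
  have est: "\<forall>\<^sub>F n in sequentially. \<bar>L n - T n\<bar> < e" if e: "0 < e" for e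
  proof -
    \<comment> \<open>each of the five error terms in \<open>avg_lam_estimate\<close> will be at most \<open>e1\<close>\<close>
    define e1 where "e1 = e / 6"
    have e1: "0 < e1" using e by (simp add: e1_def)
    then have e2: "0 < e1 / (88 * \<theta> ^ 5)" using \<theta>1 by simp
    obtain c \<epsilon> K where c: "0 < \<epsilon>" "\<epsilon> \<le> 1" "1 < K" "c = 24 * \<epsilon> * K ^ 3 + 4 / K"
      "2 * \<theta> * c \<le> 1" "c \<le> e1 / (88 * \<theta> ^ 5)" "0 < c"
      by (rule exists_precision[OF \<theta>1 e2]) (rule that)
    have "(\<lambda>n. 2 * \<theta> ^ 5 / real n) \<longlonglongrightarrow> 0" by real_asymp
    then have "\<forall>\<^sub>F n in sequentially. 2 * \<theta> ^ 5 / real n < e1" by (rule order_tendstoD(2)) (rule e1)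
    moreover have "\<forall>\<^sub>F n in sequentially. real (D n) * comparable_degrees.excess n (d n) (D n) \<le> min 1 (e1 / (11 * \<theta> ^ 3))"
      by (rule ex_small) (use e1 \<theta>1 in simp)
    moreover have "\<forall>\<^sub>F n in sequentially. real (D n) * bad \<epsilon> n \<le> e1 / (3 * \<theta>)"
      by (rule bad_small[OF c(1,2)]) (use e1 \<theta>1 in simp)
    ultimately show ?thesis using comp
    proof eventually_elim
      case (elim n)
      interpret comparable_degrees n "d n" "D n" "m0 n" \<theta> by (rule elim)
      define x where "x = real (D n) * excess"
      have x: "x \<le> 1" "x \<le> e1 / (11 * \<theta> ^ 3)" "0 \<le> x"
        using elim(2) excess_nonneg by (auto simp: x_def)
      have h1: "excess \<le> 1"
        using x(1) D_pos excess_nonneg mult_right_mono[of 1 "real (D n)" excess] by (simp add: x_def)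
      have th: "\<theta>\<^sup>2 \<le> \<theta> ^ 3" "\<theta> \<le> \<theta>\<^sup>2" using \<theta>1 power_increasing[of 2 3 \<theta>] power_increasing[of 1 2 \<theta>] by auto
      have 11: "11 * \<theta> ^ 3 * x \<le> e1" using x(2) \<theta>1 by (simp add: pos_le_divide_eq mult.commute)
      have t1: "11 * \<theta>\<^sup>2 * x \<le> e1" using 11 mult_right_mono[OF th(1) x(3)] by linarith
      have t2: "5 * \<theta> ^ 3 * x \<le> e1"
      proof -
        have "0 \<le> \<theta> ^ 3 * x" using \<theta>1 x by simp
        then show ?thesis using 11 by linarith
      qed
      have t3: "8 * \<theta> ^ 3 * c * (\<theta> + 10 * \<theta>\<^sup>2 * x) \<le> e1"
      proof -
        have "\<theta>\<^sup>2 * x \<le> \<theta>\<^sup>2 * 1" using x by (intro mult_left_mono) auto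
        then have "\<theta> + 10 * \<theta>\<^sup>2 * x \<le> 11 * \<theta>\<^sup>2" using th by linarith
        then have "8 * \<theta> ^ 3 * c * (\<theta> + 10 * \<theta>\<^sup>2 * x) \<le> 8 * \<theta> ^ 3 * c * (11 * \<theta>\<^sup>2)"
          using c(7) \<theta>1 by (intro mult_left_mono) auto
        also have "\<dots> = c * (88 * \<theta> ^ 5)" by (simp add: eval_nat_numeral)
        also have "\<dots> \<le> e1" using c(6) \<theta>1 by (simp add: pos_le_divide_eq)
        finally show ?thesis .
      qed
      have t4: "3 * \<theta> * (real (D n) * bad \<epsilon> n) \<le> e1"
        using elim(3) \<theta>1 by (simp add: pos_le_divide_eq mult_ac)
      have "T n = target"
        by (simp add: T_def target_def msum_def degree_power_sum_def)
      moreover have "L n = avg lam"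
        by (simp add: L_def expected_largest_eigenvalue_def expectation_eq_avg)
      ultimately show ?case
        using avg_lam_estimate[OF less_imp_le[OF c(1)] c(3,4,5) h1] t1 t2 t3 t4 elim(1) e1
        unfolding bad_def x_def e1_def by linarith
    qed
  qed
  have "(\<lambda>n. L n - T n) \<longlonglongrightarrow> 0"
    unfolding tendsto_iff dist_real_def using est by simp
  moreover have "tendsto_in_probability (\<lambda>n. simple_configuration_model n (d n)) (\<lambda>n M. largest_eigenvalue n M / L n) 1"
    unfolding tendsto_in_probability_def
  proof (intro allI impI)
    fix \<eta> :: real assume \<eta>: "\<eta> > 0"
    then have \<eta>2: "0 < \<eta> / (4 * \<theta>\<^sup>2)" using \<theta>1 by simp
    obtain c \<epsilon> K where c: "0 < \<epsilon>" "\<epsilon> \<le> 1" "1 < K" "c = 24 * \<epsilon> * K ^ 3 + 4 / K"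
      "2 * \<theta> * c \<le> 1" "c \<le> \<eta> / (4 * \<theta>\<^sup>2)" "0 < c"
      by (rule exists_precision[OF \<theta>1 \<eta>2]) (rule that)
    let ?P = "\<lambda>n. measure_pmf.prob (simple_configuration_model n (d n)) {\<omega>. \<bar>largest_eigenvalue n \<omega> / L n - 1\<bar> > \<eta>}"
    have "\<forall>\<^sub>F n in sequentially. ?P n < e" if e: "0 < e" for e
    proof -
      have "\<forall>\<^sub>F n in sequentially. real (D n) * bad \<epsilon> n \<le> e / 2"
        by (rule bad_small[OF c(1,2)]) (use e in simp)
      moreover have "\<forall>\<^sub>F n in sequentially. \<bar>L n - T n\<bar> < 1" by (rule est) simp
      moreover have "\<forall>\<^sub>F n in sequentially. 2 * (1 + \<theta>) * \<theta> / \<eta> \<le> real (D n)" by (rule D_large)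
      ultimately show ?thesis using comp
      proof eventually_elim
        case (elim n)
        interpret comparable_degrees n "d n" "D n" "m0 n" \<theta> by (rule elim)
        have T: "T n = target" by (simp add: T_def target_def msum_def degree_power_sum_def)
        have L: "L n = avg lam" by (simp add: L_def expected_largest_eigenvalue_def expectation_eq_avg)
        have "2 * \<theta>\<^sup>2 * c \<le> \<eta> / 2" using c(6) \<theta>1 by (simp add: field_simps)
        moreover have "(1 + \<theta>) / real (m0 n) \<le> \<eta> / 2"
        proof -
          have "2 * (1 + \<theta>) * \<theta> \<le> real (D n) * \<eta>" using elim(3) \<eta> by (simp add: pos_divide_le_eq)
          also have "\<dots> \<le> (\<theta> * real (m0 n)) * \<eta>" using ratio \<eta> by (intro mult_right_mono) auto
          finally have "\<theta> * (2 * (1 + \<theta>)) \<le> \<theta> * (real (m0 n) * \<eta>)" by (simp add: mult_ac)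
          then have "2 * (1 + \<theta>) \<le> real (m0 n) * \<eta>" using \<theta>1 by simp
          then show ?thesis using m0_pos by (simp add: pos_divide_le_eq mult_ac)
        qed
        ultimately have "2 * \<theta>\<^sup>2 * c + (1 + \<theta>) / real (m0 n) \<le> \<eta>" by linarith
        then have "avg (\<lambda>M. of_bool (\<bar>lam M / avg lam - 1\<bar> > \<eta>)) \<le> bad \<epsilon> n"
          unfolding bad_def
          by (intro ratio_deviation[OF less_imp_le[OF c(1)] c(3,4,5)]) (use elim(2) in \<open>simp_all add: T L\<close>)
        moreover have "?P n = avg (\<lambda>M. of_bool (\<bar>lam M / avg lam - 1\<bar> > \<eta>))"
          unfolding L by (rule prob_eq_avg)
        moreover have "bad \<epsilon> n \<le> real (D n) * bad \<epsilon> n"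
        proof -
          have "0 \<le> bad \<epsilon> n" unfolding bad_def by (rule avg_nonneg) simp
          then show ?thesis using D_pos mult_right_mono[of 1 "real (D n)" "bad \<epsilon> n"] by simp
        qed
        ultimately show ?case using elim(1) e by linarith
      qed
    qed
    then show "?P \<longlonglongrightarrow> 0" unfolding tendsto_iff dist_real_def by (simp add: measure_nonneg)
  qed
  ultimately show ?thesis unfolding L_def T_def by blast
qed

end
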